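(* Let $n\ge 2$, $m\ge 1$ and let $A_1,\dots,A_m\in M_n$. The following conditions are equivalent. (a) $\{A_1,\dots,A_m\}$ consists of mutually commuting normal matrices. (b) There is an integer $k$ with $1\le k\le n-1$ and $|n/2-k|\le 1$ such that $W_k(A_1,\dots,A_m)$ is polyhedral. (c) There is a Hermitian $C\in M_n$ with eigenvalues $c_1\ge\cdots\ge c_n$ satisfying $c_k>c_{k+1}$ for some $k\in\{1,\dots,n-1\}$ with $|n/2-k|\le 1$ such that $W_C(A_1,\dots,A_m)$ is polyhedral. (d) For any Hermitian $C\in M_n$, $W_C(A_1,\dots,A_m)$ is polyhedral.
   Context: $M_n$ is the set of $n\times n$ complex matrices. For a Hermitian $C\in M_n$ and $A_1,\dots,A_m\in M_n$, the joint $C$-numerical range is $$W_C(A_1,\dots,A_m)=\{(\operatorname{tr} CU^*A_1U,\dots,\operatorname{tr} CU^*A_mU): U\in M_n \text{ unitary}\}\subseteq\mathbb{C}^m .$$ The joint $k$-numerical range $W_k(A_1,\dots,A_m)$ is $W_C(A_1,\dots,A_m)$ for $C=I_k\oplus 0_{n-k}$. A subset of $\mathbb{C}^m$ is polyhedral if it is the convex hull of a finite set of points. *)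

theory Defs
  imports "HOL-Analysis.Analysis" "Jordan_Normal_Form.Schur_Decomposition"
begin

definition mat_trace :: "'a::comm_monoid_add mat \<Rightarrow> 'a" where
  "mat_trace M = (\<Sum>i<dim_row M. M $$ (i, i))"

(* The equation forces equality of the two dimensions, so hermitian matrices are square. *)
definition hermitian_mat :: "complex mat \<Rightarrow> bool" where
  "hermitian_mat M \<longleftrightarrow> mat_adjoint M = M"

definition normal_mat :: "complex mat \<Rightarrow> bool" where
  "normal_mat M \<longleftrightarrow> M * mat_adjoint M = mat_adjoint M * M"

definition unitary_mat :: "nat \<Rightarrow> complex mat \<Rightarrow> bool" where
  "unitary_mat n U \<longleftrightarrow> U \<in> carrier_mat n n \<and> mat_adjoint U * U = 1\<^sub>m n"

(* The tuple of matrices is indexed by a finite type 'm, so that the range is a subset of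
   complex^'m, whose convex structure is that of a real vector space. *)
definition joint_C_range ::
    "nat \<Rightarrow> complex mat \<Rightarrow> ('m::finite \<Rightarrow> complex mat) \<Rightarrow> (complex ^ 'm) set" where
  "joint_C_range n C A =
     {(\<chi> j. mat_trace (C * mat_adjoint U * A j * U)) | U. unitary_mat n U}"

definition joint_k_range ::
    "nat \<Rightarrow> nat \<Rightarrow> ('m::finite \<Rightarrow> complex mat) \<Rightarrow> (complex ^ 'm) set" where
  "joint_k_range n k A = joint_C_range n (diag_block_mat [1\<^sub>m k, 0\<^sub>m (n - k) (n - k)]) A"

(* Eigenvalues are listed with algebraic multiplicity; c_i is cs ! (i - 1), and comparing
   degrees gives length cs = dim_row C. *)
definition ordered_eigenvalues :: "complex mat \<Rightarrow> real list \<Rightarrow> bool" where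
  "ordered_eigenvalues C cs \<longleftrightarrow>
     char_poly C = (\<Prod>c\<leftarrow>cs. [:- complex_of_real c, 1:]) \<and> sorted_wrt (\<ge>) cs"

end

theory Submission
  imports Defs "Jordan_Normal_Form.Spectral_Radius" "HOL-Combinatorics.Permutations"
begin

text \<open>
  A commuting family of normal matrices is diagonalised by one unitary matrix
  (\<open>simultaneous_diagonalization\<close>). Its C-numerical range is then the image, under a fixed linear
  map, of the set of diagonals of the matrices unitarily similar to C. By the theorem of Schur and
  Horn these diagonals are the vectors majorised by the eigenvalues of C, a set that is the convex
  hull of the permutations of the eigenvalues. Both inclusions come from one statement about
  averaging two coordinates, \<open>transfer_closed_majorized\<close>: the set of diagonals is stable under
  such averages because of plane rotations, and the convex hull is stable for trivial reasons.

  For the converse, write each A_j as H + iG with H, G Hermitian. It suffices that any two of these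
  Hermitian matrices, S and T say, commute. The values at S and T form a linear image of the range,
  hence a polygon. Each vertex p of the polygon is attained at some unitary matrix U and maximises
  all linear functionals from an open cone of directions; the first-order condition at a maximiser
  says that U C U^H commutes with the matrix xS + yT of the functional, so by openness it commutes
  with S and T. Let P_p be the spectral projection of U C U^H for the k largest eigenvalues. It
  commutes with S and T, and for every direction (x, y) one of the finitely many P_p cuts off the
  k largest eigenvalues of xS + yT.

  Suppose that S and T do not commute, and let R be the projection onto a minimal joint invariant
  subspace on which they do not commute. On the range of R no nontrivial combination xS + yT is
  scalar, so no cut can pass through it: in each direction R lies above the cut (R below P_p) or
  below it (R orthogonal to P_p), and never both. Both possibilities are closed conditions on
  (x, y), and the punctured plane is connected; so R lies above the cut everywhere, or below it
  everywhere, and the second case becomes the first on passing to complements. The direction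
  (-x, -y) reverses the order of the eigenvalues. Hence the parts below the cut for (x, y) and for
  (-x, -y), and the range of R, are mutually orthogonal, and 2 (n - k) + rank R \<le> n. Since
  rank R \<ge> 2 and k differs from n/2 by at most 1, equality holds. Then the projection for (-x, -y)
  determines the one for (x, y), the latter is locally constant and thus constant, and the part
  below the cut is orthogonal to itself, so k = n, a contradiction.
  This argument is \<open>dominated_pencil_commutes\<close>.
\<close>

section \<open>Adjoints, traces and unitary diagonal forms\<close>

abbreviation adj :: "complex mat \<Rightarrow> complex mat"  ("_\<^sup>\<dagger>" [1000] 1000)
  where "M\<^sup>\<dagger> \<equiv> mat_adjoint M"

lemma adj_dim [simp]:
  "dim_row (M\<^sup>\<dagger>) = dim_col M" "dim_col (M\<^sup>\<dagger>) = dim_row M"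
  by (auto simp: mat_adjoint_def)

lemma adj_index [simp]:
  "i < dim_col M \<Longrightarrow> j < dim_row M \<Longrightarrow> M\<^sup>\<dagger> $$ (i, j) = cnj (M $$ (j, i))"
  by (auto simp: mat_adjoint_def mat_of_rows_index)

lemma adj_carrier [simp]: "M \<in> carrier_mat a b \<Longrightarrow> M\<^sup>\<dagger> \<in> carrier_mat b a"
  by auto

lemma adj_adj [simp]: "M\<^sup>\<dagger>\<^sup>\<dagger> = M"
  by (rule eq_matI) auto

lemma adj_one [simp]: "(1\<^sub>m n)\<^sup>\<dagger> = 1\<^sub>m n"
  by (rule eq_matI) auto

lemma adj_mult:
  assumes "A \<in> carrier_mat a b" "B \<in> carrier_mat b c"
  shows "(A * B)\<^sup>\<dagger> = B\<^sup>\<dagger> * A\<^sup>\<dagger>"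
  using assms by (intro eq_matI) (auto simp: scalar_prod_def mult.commute intro!: sum.cong)

lemma adj_add:
  assumes "A \<in> carrier_mat a b" "B \<in> carrier_mat a b"
  shows "(A + B)\<^sup>\<dagger> = A\<^sup>\<dagger> + B\<^sup>\<dagger>"
  using assms by (intro eq_matI) auto

lemma adj_minus:
  assumes "A \<in> carrier_mat a b" "B \<in> carrier_mat a b"
  shows "(A - B)\<^sup>\<dagger> = A\<^sup>\<dagger> - B\<^sup>\<dagger>"
  using assms by (intro eq_matI) auto

lemma adj_smult: "(c \<cdot>\<^sub>m A)\<^sup>\<dagger> = cnj c \<cdot>\<^sub>m A\<^sup>\<dagger>"
  by (intro eq_matI) auto

lemma adj_mat_diag: "(mat_diag n d)\<^sup>\<dagger> = mat_diag n (\<lambda>i. cnj (d i))"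
  by (intro eq_matI) (auto simp: mat_diag_def)

lemma trace_comm:
  assumes "A \<in> carrier_mat a b" "B \<in> carrier_mat b a"
  shows "mat_trace (A * B) = mat_trace (B * (A :: complex mat))"
proof -
  have "mat_trace (A * B) = (\<Sum>i<a. \<Sum>j<b. A $$ (i, j) * B $$ (j, i))"
    using assms by (auto simp: mat_trace_def scalar_prod_def atLeast0LessThan intro!: sum.cong)
  also have "\<dots> = (\<Sum>j<b. \<Sum>i<a. A $$ (i, j) * B $$ (j, i))"
    by (rule sum.swap)
  also have "\<dots> = mat_trace (B * A)"
    using assms by (auto simp: mat_trace_def scalar_prod_def atLeast0LessThan mult.commute intro!: sum.cong)
  finally show ?thesis .
qed

lemma trace_add:
  assumes "A \<in> carrier_mat a a" "B \<in> carrier_mat a a"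
  shows "mat_trace (A + B) = mat_trace A + mat_trace (B :: complex mat)"
  using assms by (auto simp: mat_trace_def sum.distrib)

lemma trace_minus:
  assumes "A \<in> carrier_mat a a" "B \<in> carrier_mat a a"
  shows "mat_trace (A - B) = mat_trace A - mat_trace (B :: complex mat)"
  using assms by (auto simp: mat_trace_def sum_subtractf)

lemma trace_smult:
  assumes "A \<in> carrier_mat a a"
  shows "mat_trace (c \<cdot>\<^sub>m A) = c * mat_trace (A :: complex mat)"
  using assms by (auto simp: mat_trace_def sum_distrib_left)

lemma trace_one [simp]: "mat_trace (1\<^sub>m n :: complex mat) = of_nat n"
  by (auto simp: mat_trace_def)

lemma trace_mat_diag: "mat_trace (mat_diag n d) = (\<Sum>i<n. d i :: complex)"
  by (auto simp: mat_trace_def mat_diag_def)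

lemma trace_adj: "M \<in> carrier_mat n n \<Longrightarrow> mat_trace (M\<^sup>\<dagger>) = cnj (mat_trace M)"
  by (auto simp: mat_trace_def)

lemma trace_adj_self:
  assumes "M \<in> carrier_mat n n"
  shows "mat_trace (M\<^sup>\<dagger> * M) = of_real (\<Sum>i<n. \<Sum>j<n. (cmod (M $$ (j, i)))\<^sup>2)"
  using assms
  by (auto simp: mat_trace_def scalar_prod_def atLeast0LessThan mult.commute
      simp del: of_real_power simp flip: complex_norm_square intro!: sum.cong)

lemma trace_adj_self_pos:
  assumes "M \<in> carrier_mat n n" "M \<noteq> 0\<^sub>m n n"
  shows "Re (mat_trace (M\<^sup>\<dagger> * M)) > 0"
proof -
  obtain i j where ij: "i < n" "j < n" "M $$ (i, j) \<noteq> 0"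
    using assms eq_matI[of "0\<^sub>m n n" M] by fastforce
  have "0 < (cmod (M $$ (i, j)))\<^sup>2" using ij by simp
  also have "\<dots> \<le> (\<Sum>i<n. (cmod (M $$ (i, j)))\<^sup>2)"
    using ij by (intro member_le_sum) auto
  also have "\<dots> \<le> (\<Sum>j<n. \<Sum>i<n. (cmod (M $$ (i, j)))\<^sup>2)"
    using ij by (intro member_le_sum[where f = "\<lambda>j. \<Sum>i<n. (cmod (M $$ (i, j)))\<^sup>2"] sum_nonneg) auto
  finally show ?thesis unfolding trace_adj_self[OF assms(1)] by simp
qed

lemma trace_adj_self_nonneg: "M \<in> carrier_mat n n \<Longrightarrow> Re (mat_trace (M\<^sup>\<dagger> * M)) \<ge> 0"
  unfolding trace_adj_self by (auto intro!: sum_nonneg)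

text \<open>
  The shape in which all spectral information is kept: the i-th column of V is an eigenvector for
  d i, and functional calculus is composition with d.
\<close>
definition udiag :: "nat \<Rightarrow> complex mat \<Rightarrow> (nat \<Rightarrow> complex) \<Rightarrow> complex mat" where
  "udiag n V d = V * mat_diag n d * V\<^sup>\<dagger>"

context
  fixes n :: nat
begin

abbreviation (input) "sq \<equiv> (carrier_mat n n :: complex mat set)"

lemmas sq_mult [simp] = mult_carrier_mat[of _ n n _ n, where 'a = complex]
lemmas sq_add [simp] = add_carrier_mat[of _ n n, where 'a = complex]
lemmas sq_minus [simp] = minus_carrier_mat[of _ n n, where 'a = complex]
lemmas sq_smult [simp] = smult_carrier_mat[of _ n n, where 'a = complex]
lemmas sq_adj [simp] = adj_carrier[of _ n n]
lemmas sq_assoc = assoc_mult_mat[of _ n n _ n _ n, where 'a = complex]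
lemmas sq_adj_mult = adj_mult[of _ n n _ n]
lemmas sq_trace_comm = trace_comm[of _ n n]
lemmas sq_distrib =
  add_mult_distrib_mat[of _ n n _ _ n, where 'a = complex]
  mult_add_distrib_mat[of _ n n _ n, where 'a = complex]
  minus_mult_distrib_mat[of _ n n _ _ n, where 'a = complex]
  mult_minus_distrib_mat[of _ n n _ n, where 'a = complex]
lemmas sq_smult_mult =
  mult_smult_distrib[of _ n n _ n, where 'a = complex]
  mult_smult_assoc_mat[of _ n n _ n, where 'a = complex]
lemmas sq_one = left_mult_one_mat[of _ n n, where 'a = complex] right_mult_one_mat[of _ n n, where 'a = complex]
lemmas sq_zero = left_mult_zero_mat[of _ n n, where 'a = complex] right_mult_zero_mat[of _ n n, where 'a = complex]

lemmas sq_algebra = sq_assoc sq_distrib sq_smult_mult sq_one sq_zero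

lemma sq_commuteI: "A \<in> sq \<Longrightarrow> B \<in> sq \<Longrightarrow> X \<in> sq \<Longrightarrow> A * X = X * A \<Longrightarrow> B * X = X * B
   \<Longrightarrow> A * B * X = X * (A * B)"
  using sq_assoc[of A B X] sq_assoc[of A X B] sq_assoc[of X A B] by simp

lemma unitaryD:
  assumes "unitary_mat n U"
  shows "U \<in> sq" "U\<^sup>\<dagger> * U = 1\<^sub>m n" "U * U\<^sup>\<dagger> = 1\<^sub>m n"
  using assms mat_mult_left_right_inverse[of "U\<^sup>\<dagger>" n U] by (auto simp: unitary_mat_def)

lemma unitary_cancel:
  assumes "unitary_mat n U" "X \<in> sq"
  shows "U\<^sup>\<dagger> * (U * X) = X" "U * (U\<^sup>\<dagger> * X) = X"
  using unitaryD[OF assms(1)] assms(2) sq_assoc[of "U\<^sup>\<dagger>" U X] sq_assoc[of U "U\<^sup>\<dagger>" X]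
  by (simp_all add: sq_one)

lemma unitary_one: "unitary_mat n (1\<^sub>m n)"
  by (auto simp: unitary_mat_def)

lemma unitary_adj:
  assumes "unitary_mat n U"
  shows "unitary_mat n (U\<^sup>\<dagger>)"
  using unitaryD[OF assms] by (simp add: unitary_mat_def)

lemma unitary_mult:
  assumes "unitary_mat n U" "unitary_mat n V"
  shows "unitary_mat n (U * V)"
  using unitaryD[OF assms(1)] unitaryD[OF assms(2)]
  by (simp add: unitary_mat_def sq_adj_mult sq_assoc unitary_cancel[OF assms(1)])

lemma udiag_carrier [simp]: "V \<in> sq \<Longrightarrow> udiag n V d \<in> sq"
  by (simp add: udiag_def)

lemma udiag_mult:
  assumes "unitary_mat n V"
  shows "udiag n V c * udiag n V d = udiag n V (\<lambda>i. c i * d i)"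
proof -
  note V = unitaryD[OF assms]
  have "udiag n V c * udiag n V d = V * (mat_diag n c * mat_diag n d) * V\<^sup>\<dagger>"
    using V by (simp add: udiag_def sq_assoc unitary_cancel[OF assms] del: mat_diag_diag)
  then show ?thesis by (simp add: udiag_def)
qed

lemma udiag_adj: "V \<in> sq \<Longrightarrow> (udiag n V d)\<^sup>\<dagger> = udiag n V (\<lambda>i. cnj (d i))"
  by (simp add: udiag_def sq_adj_mult adj_mat_diag sq_assoc)

lemma udiag_one:
  assumes "unitary_mat n V"
  shows "udiag n V (\<lambda>_. 1) = 1\<^sub>m n"
  using unitaryD[OF assms] by (simp add: udiag_def sq_one)

lemma udiag_smult: "V \<in> sq \<Longrightarrow> c \<cdot>\<^sub>m udiag n V d = udiag n V (\<lambda>i. c * d i)"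
proof -
  assume V: "V \<in> sq"
  have "mat_diag n (\<lambda>i. c * d i) = c \<cdot>\<^sub>m mat_diag n d"
    by (rule eq_matI) (auto simp: mat_diag_def)
  with V show ?thesis by (simp add: udiag_def sq_smult_mult)
qed

lemma trace_udiag:
  assumes "unitary_mat n V"
  shows "mat_trace (udiag n V d) = (\<Sum>i<n. d i)"
proof -
  note V = unitaryD[OF assms]
  have "mat_trace (udiag n V d) = mat_trace (V\<^sup>\<dagger> * (V * mat_diag n d))"
    unfolding udiag_def using V by (intro sq_trace_comm) auto
  then show ?thesis using V by (simp add: unitary_cancel[OF assms] trace_mat_diag)
qed

lemma udiag_cong: "(\<And>i. i < n \<Longrightarrow> c i = d i) \<Longrightarrow> udiag n V c = udiag n V d"
proof -
  assume "\<And>i. i < n \<Longrightarrow> c i = d i"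
  then have "mat_diag n c = mat_diag n d" by (intro eq_matI) (auto simp: mat_diag_def)
  then show ?thesis by (simp add: udiag_def)
qed

lemma udiag_iff:
  assumes "unitary_mat n V" "M \<in> sq"
  shows "M = udiag n V d \<longleftrightarrow> V\<^sup>\<dagger> * M * V = mat_diag n d"
proof -
  note V = unitaryD[OF assms(1)]
  show ?thesis
  proof
    assume "M = udiag n V d"
    with V show "V\<^sup>\<dagger> * M * V = mat_diag n d"
      by (simp add: udiag_def sq_assoc unitary_cancel[OF assms(1)] sq_one)
  next
    assume "V\<^sup>\<dagger> * M * V = mat_diag n d"
    then have "udiag n V d = V * (V\<^sup>\<dagger> * M * V) * V\<^sup>\<dagger>" by (simp add: udiag_def)
    with V assms(2) show "M = udiag n V d"
      by (simp add: sq_assoc unitary_cancel[OF assms(1)] sq_one)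
  qed
qed

lemma udiag_eqD:
  assumes "unitary_mat n V" "udiag n V c = udiag n V d" "i < n"
  shows "c i = d i"
proof -
  note V = unitaryD[OF assms(1)]
  have "mat_diag n c = mat_diag n d"
    using udiag_iff[OF assms(1) udiag_carrier[OF V(1)]] assms(2) by metis
  then have "mat_diag n c $$ (i, i) = mat_diag n d $$ (i, i)" by simp
  with assms(3) show ?thesis by (simp add: mat_diag_def)
qed

lemma udiag_frame_mult:
  "U \<in> sq \<Longrightarrow> V \<in> sq \<Longrightarrow> U * udiag n V d * U\<^sup>\<dagger> = udiag n (U * V) d"
  by (simp add: udiag_def sq_adj_mult sq_assoc)

text \<open>
  Functional calculus respects intertwining: in matrix entries relative to the two frames the
  hypothesis reads Y_ij (d_j - c_i) = 0, and therefore Y_ij (f d_j - f c_i) = 0. For equal frames this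
  says that whatever commutes with a diagonalised matrix commutes with its spectral projections;
  for Z = 1 it says that a spectral projection does not depend on the diagonalisation.
\<close>
lemma udiag_intertwine:
  assumes V: "unitary_mat n V" and W: "unitary_mat n W" and Z: "Z \<in> sq"
    and eq: "Z * udiag n V d = udiag n W c * Z"
  shows "Z * udiag n V (\<lambda>i. f (d i)) = udiag n W (\<lambda>i. f (c i)) * Z"
proof -
  note V' = unitaryD[OF V] and W' = unitaryD[OF W]
  define Y where "Y = W\<^sup>\<dagger> * Z * V"
  have Y: "Y \<in> sq" using Z V' W' by (simp add: Y_def)
  have ZY: "Z = W * Y * V\<^sup>\<dagger>"
    using Z V' W' by (simp add: Y_def sq_assoc unitary_cancel[OF W] sq_one)
  have key: "Z * udiag n V a = W * (Y * mat_diag n a) * V\<^sup>\<dagger>"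
    "udiag n W b * Z = W * (mat_diag n b * Y) * V\<^sup>\<dagger>" for a b
    using V' W' Y unfolding ZY udiag_def
    by (simp_all add: sq_assoc unitary_cancel[OF W] unitary_cancel[OF V])
  have cancel: "A = B" if "W * A * V\<^sup>\<dagger> = W * B * V\<^sup>\<dagger>" "A \<in> sq" "B \<in> sq" for A B
  proof -
    have eq: "W\<^sup>\<dagger> * (W * A * V\<^sup>\<dagger>) * V = W\<^sup>\<dagger> * (W * B * V\<^sup>\<dagger>) * V" using that(1) by (rule arg_cong)
    have *: "W\<^sup>\<dagger> * (W * M * V\<^sup>\<dagger>) * V = M" if "M \<in> sq" for M
      using that V' W' by (simp add: sq_assoc unitary_cancel[OF W] sq_one)
    from eq show ?thesis unfolding *[OF that(2)] *[OF that(3)] .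
  qed
  have "Y * mat_diag n d = mat_diag n c * Y"
    by (rule cancel[OF eq[unfolded key]]) (use Y in auto)
  then have *: "(Y * mat_diag n d) $$ (i, j) = (mat_diag n c * Y) $$ (i, j)" for i j by simp
  have "Y $$ (i, j) * d j = c i * Y $$ (i, j)" if "i < n" "j < n" for i j
    using *[of i j] that Y by (simp add: mat_diag_mult_left[OF Y] mat_diag_mult_right[OF Y])
  then have "Y $$ (i, j) = 0 \<or> d j = c i" if "i < n" "j < n" for i j
    using that by (metis mult.commute mult_cancel_left)
  then have "Y * mat_diag n (\<lambda>i. f (d i)) = mat_diag n (\<lambda>i. f (c i)) * Y"
    using Y by (intro eq_matI) (force simp: mat_diag_mult_left[OF Y] mat_diag_mult_right[OF Y])+
  then show ?thesis unfolding key by simp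
qed

lemma udiag_commute:
  assumes "unitary_mat n V" "Z \<in> sq" "Z * udiag n V d = udiag n V d * Z"
  shows "Z * udiag n V (\<lambda>i. f (d i)) = udiag n V (\<lambda>i. f (d i)) * Z"
  by (rule udiag_intertwine[OF assms(1,1,2,3)])

text \<open>The spectral projections of a diagonalised matrix add up to the identity, so they cannot
  all annihilate a nonzero matrix.\<close>
lemma spectral_component_nonzero:
  assumes V: "unitary_mat n V" and w: "w \<in> sq" "w \<noteq> 0\<^sub>m n n"
  shows "\<exists>i<n. udiag n V (\<lambda>j. if d j = d i then 1 else 0) * w \<noteq> 0\<^sub>m n n"
proof (rule ccontr)
  assume neg: "\<not> ?thesis"
  note V' = unitaryD[OF V]
  have Y: "V\<^sup>\<dagger> * w \<in> sq" using V' w by simp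
  have "(V\<^sup>\<dagger> * w) $$ (i, k) = 0" if "i < n" "k < n" for i k
  proof -
    let ?f = "\<lambda>j. if d j = d i then 1 else 0 :: complex"
    have "udiag n V ?f * w = 0\<^sub>m n n" using neg that by blast
    then have "V\<^sup>\<dagger> * (udiag n V ?f * w) = V\<^sup>\<dagger> * 0\<^sub>m n n" by simp
    then have "mat_diag n ?f * (V\<^sup>\<dagger> * w) = 0\<^sub>m n n"
      using V' w by (simp add: udiag_def sq_assoc unitary_cancel[OF V] sq_zero)
    then have "(mat_diag n ?f * (V\<^sup>\<dagger> * w)) $$ (i, k) = 0" using that by simp
    then show ?thesis using that by (simp add: mat_diag_mult_left[OF Y])
  qed
  then have "V\<^sup>\<dagger> * w = 0\<^sub>m n n" using Y by (intro eq_matI) auto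
  then have "V * (V\<^sup>\<dagger> * w) = V * 0\<^sub>m n n" by simp
  then show False using w V' by (simp add: unitary_cancel[OF V] sq_zero)
qed

end

section \<open>Simultaneous unitary diagonalisation of commuting normal matrices\<close>

text \<open>
  An orthogonal basis that starts with v, from the Gram--Schmidt process, is normalised column by
  column.
\<close>
lemma unitary_with_first_column:
  fixes v :: "complex vec"
  assumes v: "v \<in> carrier_vec n" and v0: "v \<noteq> 0\<^sub>v n"
  shows "\<exists>U c. unitary_mat n U \<and> col U 0 = c \<cdot>\<^sub>v v"
proof -
  interpret cof_vec_space n "TYPE(complex)" .
  define b where "b = basis_completion v"
  define ws where "ws = gram_schmidt n b"
  define W where "W = mat_of_cols n ws"
  have n: "n \<noteq> 0" using v v0 by (metis eq_vecI carrier_vecD index_zero_vec(2) not_less0)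
  from basis_completion[OF v v0, folded b_def]
  have b: "distinct b" "\<not> lin_dep (set b)" "set b \<subseteq> carrier_vec n" "hd b = v" "length b = n"
    by auto
  with n obtain vs where bv: "b = v # vs" by (cases b) auto
  from gram_schmidt_result[OF b(3,1,2) refl, folded ws_def]
  have ws: "set ws \<subseteq> carrier_vec n" "corthogonal ws" "length ws = n"
    by (auto simp: b)
  from gram_schmidt_hd[OF v, of vs, folded bv] have hd: "hd ws = v" unfolding ws_def .
  then have ws0: "ws ! 0 = v" using ws(3) n by (metis hd_conv_nth list.size(3))
  have W: "W \<in> carrier_mat n n" using ws unfolding W_def by (metis mat_of_cols_carrier(1))
  have "corthogonal_mat W" using orthogonal_mat_of_cols[OF ws] unfolding W_def .
  then have diag: "\<And>i j. i < n \<Longrightarrow> j < n \<Longrightarrow> i \<noteq> j \<Longrightarrow> (W\<^sup>\<dagger> * W) $$ (i, j) = 0"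
    and nz: "\<And>i. i < n \<Longrightarrow> (W\<^sup>\<dagger> * W) $$ (i, i) \<noteq> 0"
    using W unfolding corthogonal_mat_def Let_def diagonal_mat_def by auto
  define r where "r i = (\<Sum>j<n. (cmod (W $$ (j, i)))\<^sup>2)" for i
  have r: "(W\<^sup>\<dagger> * W) $$ (i, i) = of_real (r i)" if "i < n" for i
    using W that by (auto simp: r_def scalar_prod_def atLeast0LessThan mult.commute
        simp del: of_real_power simp flip: complex_norm_square intro!: sum.cong)
  have rpos: "r i > 0" if "i < n" for i
    using nz[OF that] r[OF that] unfolding r_def
    by (metis of_real_0 sum_nonneg zero_le_power2 less_eq_real_def)
  define s where "s i = complex_of_real (1 / sqrt (r i))" for i
  define U where "U = W * mat_diag n s"
  have U: "U \<in> carrier_mat n n" using W unfolding U_def by simp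
  have "U\<^sup>\<dagger> * U = mat_diag n (\<lambda>i. cnj (s i)) * ((W\<^sup>\<dagger> * W) * mat_diag n s)"
    using W unfolding U_def by (simp add: adj_mult[of _ n n _ n] adj_mat_diag
        assoc_mult_mat[of _ n n _ n _ n])
  also have "\<dots> = 1\<^sub>m n"
  proof -
    have WW: "W\<^sup>\<dagger> * W \<in> carrier_mat n n" using W by simp
    have "mat_diag n (\<lambda>i. cnj (s i)) * ((W\<^sup>\<dagger> * W) * mat_diag n s) =
        Matrix.mat n n (\<lambda>(i, j). cnj (s i) * ((W\<^sup>\<dagger> * W) $$ (i, j) * s j))"
      using W by (subst mat_diag_mult_left[of _ n n])
        (auto simp: mat_diag_mult_right[OF WW] simp del: index_mult_mat intro!: eq_matI)
    also have "\<dots> = 1\<^sub>m n"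
    proof (rule eq_matI)
      fix i j assume ij: "i < dim_row (1\<^sub>m n :: complex mat)" "j < dim_col (1\<^sub>m n :: complex mat)"
      have "cnj (s i) * (of_real (r i) * s i) = 1" if "i < n" for i
      proof -
        have "cnj (s i) * (of_real (r i) * s i) = of_real (1 / sqrt (r i) * (r i * (1 / sqrt (r i))))"
          by (simp add: s_def flip: of_real_mult)
        also have "1 / sqrt (r i) * (r i * (1 / sqrt (r i))) = 1"
          using rpos[OF that] by (simp add: real_div_sqrt field_simps)
        finally show ?thesis by (simp del: of_real_mult of_real_divide)
      qed
      then show "Matrix.mat n n (\<lambda>(i, j). cnj (s i) * ((W\<^sup>\<dagger> * W) $$ (i, j) * s j)) $$ (i, j)
          = 1\<^sub>m n $$ (i, j)"
        using ij diag[of i j] r[of i] by (cases "i = j") (auto simp del: index_mult_mat)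
    qed auto
    finally show ?thesis .
  qed
  finally have "unitary_mat n U" using U unfolding unitary_mat_def by simp
  moreover have "col U 0 = s 0 \<cdot>\<^sub>v v"
  proof (rule eq_vecI)
    fix i assume "i < dim_vec (s 0 \<cdot>\<^sub>v v)"
    then have i: "i < n" using v by simp
    have "W $$ (i, 0) = v $ i" using i n ws ws0 by (simp add: W_def mat_of_cols_index)
    then show "col U 0 $ i = (s 0 \<cdot>\<^sub>v v) $ i"
      using i n v W by (simp add: U_def mat_diag_mult_right[OF W])
  qed (use U v in auto)
  ultimately show ?thesis by blast
qed

definition scalar_block :: "nat \<Rightarrow> complex \<Rightarrow> complex mat \<Rightarrow> complex mat" where
  "scalar_block n e N = four_block_mat (Matrix.mat 1 1 (\<lambda>_. e)) (0\<^sub>m 1 n) (0\<^sub>m n 1) N"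

lemma scalar_block_carrier [simp]: "N \<in> carrier_mat n n \<Longrightarrow> scalar_block n e N \<in> carrier_mat (Suc n) (Suc n)"
  using four_block_carrier_mat[of "Matrix.mat 1 1 (\<lambda>_. e)" 1 1 N n n] by (simp add: scalar_block_def)

lemma scalar_block_mult:
  assumes "N \<in> carrier_mat n n" "N' \<in> carrier_mat n n"
  shows "scalar_block n e N * scalar_block n f N' = scalar_block n (e * f) (N * N')"
proof -
  have "Matrix.mat 1 1 (\<lambda>_. e) * Matrix.mat 1 1 (\<lambda>_. f) = Matrix.mat 1 1 (\<lambda>_. e * f)"
    by (rule eq_matI) (auto simp: scalar_prod_def)
  then show ?thesis using assms unfolding scalar_block_def
    by (subst mult_four_block_mat[of _ 1 1 _ n _ n _ _ 1 _ n])
      (auto simp: left_mult_zero_mat right_mult_zero_mat intro!: cong_four_block_mat)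
qed

lemma scalar_block_adj: "N \<in> carrier_mat n n \<Longrightarrow> (scalar_block n e N)\<^sup>\<dagger> = scalar_block n (cnj e) (N\<^sup>\<dagger>)"
  by (rule eq_matI) (auto simp: scalar_block_def)

lemma scalar_block_mat_diag: "scalar_block n e (mat_diag n d) = mat_diag (Suc n) (case_nat e d)"
  by (rule eq_matI) (auto simp: scalar_block_def mat_diag_def split: nat.splits)

lemma scalar_block_one: "scalar_block n 1 (1\<^sub>m n) = 1\<^sub>m (Suc n)"
  by (rule eq_matI) (auto simp: scalar_block_def)

lemma scalar_block_inj:
  assumes "N \<in> carrier_mat n n" "N' \<in> carrier_mat n n" "scalar_block n e N = scalar_block n f N'"
  shows "N = N'"
proof (rule eq_matI)
  fix i j assume "i < dim_row N'" "j < dim_col N'"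
  moreover have "scalar_block n e N $$ (Suc i, Suc j) = scalar_block n f N' $$ (Suc i, Suc j)" using assms by simp
  ultimately show "N $$ (i, j) = N' $$ (i, j)" using assms(1,2) by (simp add: scalar_block_def)
qed (use assms in auto)

lemma scalar_block_decompose:
  assumes "M \<in> carrier_mat (Suc n) (Suc n)"
    and "\<And>i. 0 < i \<Longrightarrow> i \<le> n \<Longrightarrow> M $$ (i, 0) = 0 \<and> M $$ (0, i) = 0"
  shows "M = scalar_block n (M $$ (0, 0)) (Matrix.mat n n (\<lambda>(i, j). M $$ (Suc i, Suc j)))"
  using assms by (intro eq_matI) (auto simp: scalar_block_def)

text \<open>The adjoint of a normal matrix has the same eigenvectors, so that an eigenvector
  splits off as a one-dimensional block.\<close>
lemma normal_eigen_adj: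
  assumes N: "N \<in> carrier_mat n n" "normal_mat N" and E: "E \<in> carrier_mat n n" "E\<^sup>\<dagger> = E"
    and eig: "N * E = e \<cdot>\<^sub>m E"
  shows "E * N = e \<cdot>\<^sub>m E"
proof -
  define L where "L = N - e \<cdot>\<^sub>m 1\<^sub>m n"
  have L: "L \<in> carrier_mat n n" using N by (simp add: L_def)
  have Lad: "L\<^sup>\<dagger> = N\<^sup>\<dagger> - cnj e \<cdot>\<^sub>m 1\<^sub>m n"
    using N by (simp add: L_def adj_minus[of _ n n] adj_smult)
  have LE: "L * E = 0\<^sub>m n n"
    using N E eig
    by (simp add: L_def sq_distrib[of _ n] sq_smult_mult[of _ n] sq_one[of _ n])
  have NN: "N * N\<^sup>\<dagger> = N\<^sup>\<dagger> * N" using N by (simp add: normal_mat_def)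
  have norm: "L * L\<^sup>\<dagger> = L\<^sup>\<dagger> * L"
    unfolding Lad unfolding L_def using N NN
    by (simp add: sq_distrib[of _ n] sq_smult_mult[of _ n] sq_one[of _ n]) (rule eq_matI, auto simp: algebra_simps)
  have "mat_trace ((L\<^sup>\<dagger> * E)\<^sup>\<dagger> * (L\<^sup>\<dagger> * E)) = mat_trace (E * ((L * L\<^sup>\<dagger>) * E))"
    using L E by (simp add: sq_adj_mult[of _ n] sq_assoc[of _ n])
  also have "\<dots> = mat_trace (E * (L\<^sup>\<dagger> * (L * E)))"
    unfolding norm using L E by (simp add: sq_assoc[of _ n])
  also have "\<dots> = 0" using L E by (simp add: LE sq_zero mat_trace_def)
  finally have "L\<^sup>\<dagger> * E = 0\<^sub>m n n"
    using trace_adj_self_pos[of "L\<^sup>\<dagger> * E" n] L E by force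
  then have "(L\<^sup>\<dagger> * E)\<^sup>\<dagger> = (0\<^sub>m n n)\<^sup>\<dagger>" by simp
  moreover have "(0\<^sub>m n n :: complex mat)\<^sup>\<dagger> = 0\<^sub>m n n" by (rule eq_matI) auto
  ultimately have "E * L = 0\<^sub>m n n" using L E by (simp add: sq_adj_mult[of _ n])
  then have "E * N - e \<cdot>\<^sub>m E = 0\<^sub>m n n"
    using N E by (simp add: L_def sq_distrib[of _ n] sq_smult_mult[of _ n] sq_one[of _ n])
  then have *: "(E * N - e \<cdot>\<^sub>m E) $$ (i, j) = 0" if "i < n" "j < n" for i j using that by simp
  show ?thesis
  proof (rule eq_matI)
    fix i j assume "i < dim_row (e \<cdot>\<^sub>m E)" "j < dim_col (e \<cdot>\<^sub>m E)"
    then have "i < n" "j < n" using E by auto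
    with *[OF this] show "(E * N) $$ (i, j) = (e \<cdot>\<^sub>m E) $$ (i, j)"
      using N E by (simp del: index_mult_mat(1))
  qed (use N E in auto)
qed

definition commuting_normal :: "nat \<Rightarrow> ('i \<Rightarrow> complex mat) \<Rightarrow> bool" where
  "commuting_normal n A \<longleftrightarrow>
     (\<forall>i. A i \<in> carrier_mat n n \<and> normal_mat (A i)) \<and> (\<forall>i j. A i * A j = A j * A i)"

text \<open>
  The induction that follows serves twice, for one normal matrix and for a commuting family. Only the
  source of a common eigenvector differs, so it enters as a hypothesis. A common eigenvector is
  represented by a nonzero square matrix w, all of whose columns are common eigenvectors or zero;
  this keeps the computations inside the algebra of square matrices.
\<close>
lemma simultaneous_diagonalization_from_eigenvectors:
  fixes A :: "'i \<Rightarrow> complex mat"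
  assumes ev: "\<And>n (A :: 'i \<Rightarrow> complex mat). n > 0 \<Longrightarrow> commuting_normal n A
      \<Longrightarrow> \<exists>w\<in>carrier_mat n n. w \<noteq> 0\<^sub>m n n \<and> (\<forall>i. \<exists>e. A i * w = e \<cdot>\<^sub>m w)"
    and A: "commuting_normal n A"
  shows "\<exists>U d. unitary_mat n U \<and> (\<forall>i. A i = udiag n U (d i))"
  using A
proof (induction n arbitrary: A)
  case 0
  have "A i = udiag 0 (1\<^sub>m 0) (\<lambda>_. 0)" for i
  proof -
    have "A i \<in> carrier_mat 0 0" using 0 unfolding commuting_normal_def by blast
    then show ?thesis by (intro eq_matI) (auto simp: udiag_def)
  qed
  then have "unitary_mat 0 (1\<^sub>m 0) \<and> (\<forall>i. A i = udiag 0 (1\<^sub>m 0) (\<lambda>_. 0))"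
    using unitary_one[of 0] by simp
  then show ?case by (intro exI[of _ "1\<^sub>m 0"] exI[of _ "\<lambda>_ _. 0"])
next
  case (Suc n)
  let ?N = "Suc n"
  have A: "A i \<in> carrier_mat ?N ?N" and An: "normal_mat (A i)" and Acomm: "A i * A j = A j * A i" for i j
    using Suc.prems unfolding commuting_normal_def by blast+
  from ev[OF _ Suc.prems] obtain w where w: "w \<in> carrier_mat ?N ?N" "w \<noteq> 0\<^sub>m ?N ?N"
    and "\<forall>i. \<exists>e. A i * w = e \<cdot>\<^sub>m w" by auto
  then obtain e where e: "\<And>i. A i * w = e i \<cdot>\<^sub>m w" by metis
  obtain p k where pk: "p < ?N" "k < ?N" "w $$ (p, k) \<noteq> 0"
    using w eq_matI[of "0\<^sub>m ?N ?N" w] by fastforce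
  define v where "v = col w k"
  have v: "v \<in> carrier_vec ?N" "v \<noteq> 0\<^sub>v ?N"
  proof -
    show "v \<in> carrier_vec ?N" using w pk by (simp add: v_def)
    have "v $ p \<noteq> 0" using w pk by (simp add: v_def)
    then show "v \<noteq> 0\<^sub>v ?N" using pk by auto
  qed
  have Av: "A i *\<^sub>v v = e i \<cdot>\<^sub>v v" for i
  proof -
    have "col (A i * w) k = col (e i \<cdot>\<^sub>m w) k" by (simp add: e)
    then show ?thesis using A w pk by (simp add: v_def col_mult2[of _ ?N ?N _ ?N] del: col_mult)
  qed
  obtain U c where U: "unitary_mat ?N U" and col: "col U 0 = c \<cdot>\<^sub>v v"
    using unitary_with_first_column[OF v] by blast
  note U' = unitaryD[OF U]
  define E where "E = mat_diag ?N (\<lambda>i. if i = 0 then 1 else 0 :: complex)"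
  have E: "E \<in> carrier_mat ?N ?N" "E\<^sup>\<dagger> = E"
    by (auto simp: E_def adj_mat_diag if_distrib cong: if_cong)
  define B where "B i = U\<^sup>\<dagger> * A i * U" for i
  have B: "B i \<in> carrier_mat ?N ?N" for i using A U' by (simp add: B_def)
  have AUE: "A i * U * E = e i \<cdot>\<^sub>m (U * E)" for i
  proof -
    have "A i *\<^sub>v (c \<cdot>\<^sub>v v) = e i \<cdot>\<^sub>v (c \<cdot>\<^sub>v v)"
      using A v Av by (simp add: mult_mat_vec[of _ ?N ?N] smult_smult_assoc mult.commute)
    then have "col (A i * U) 0 = e i \<cdot>\<^sub>v col U 0"
      using A U' by (simp add: col col_mult2[of _ ?N ?N _ ?N] del: col_mult)
    then have "col (A i * U) 0 $ q = (e i \<cdot>\<^sub>v col U 0) $ q" for q by simp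
    then have *: "(A i * U) $$ (q, 0) = e i * U $$ (q, 0)" if "q < ?N" for q
      using A U' that by (metis B carrier_matD col_dim index_col index_mult_mat(2,3)
          index_smult_vec(1) dim_col zero_less_Suc)
    show ?thesis
      unfolding E_def using A U' *
      by (intro eq_matI) (auto simp: mat_diag_mult_right[of _ ?N] simp del: index_mult_mat(1))
  qed
  have BE: "B i * E = e i \<cdot>\<^sub>m E" for i
  proof -
    have "B i * E = U\<^sup>\<dagger> * (A i * U * E)" using A U' E by (simp add: B_def sq_assoc[of _ ?N])
    then show ?thesis using U' E by (simp add: AUE sq_smult_mult[of _ ?N] unitary_cancel[OF U])
  qed
  have Bmult: "B i * B j = U\<^sup>\<dagger> * (A i * A j) * U" for i j
    using A U' by (simp add: B_def sq_assoc[of _ ?N] unitary_cancel[OF U])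
  have Bad: "(B i)\<^sup>\<dagger> = U\<^sup>\<dagger> * (A i)\<^sup>\<dagger> * U" for i
    using A U' by (simp add: B_def sq_assoc[of _ ?N] sq_adj_mult[of _ ?N])
  have Bnormal: "normal_mat (B i)" for i
  proof -
    have "A i * (A i)\<^sup>\<dagger> = (A i)\<^sup>\<dagger> * A i" using An by (simp add: normal_mat_def)
    moreover have "B i * (B i)\<^sup>\<dagger> = U\<^sup>\<dagger> * (A i * (A i)\<^sup>\<dagger>) * U"
      "(B i)\<^sup>\<dagger> * B i = U\<^sup>\<dagger> * ((A i)\<^sup>\<dagger> * A i) * U"
      unfolding Bad using A U' by (simp_all add: B_def sq_assoc[of _ ?N] unitary_cancel[OF U])
    ultimately show ?thesis by (simp add: normal_mat_def)
  qed
  have EB: "E * B i = e i \<cdot>\<^sub>m E" for i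
    by (rule normal_eigen_adj[OF B Bnormal E BE])
  have Bzero: "B i $$ (q, 0) = 0 \<and> B i $$ (0, q) = 0" if "0 < q" "q \<le> n" for i q
  proof -
    have "(B i * E) $$ (q, 0) = (e i \<cdot>\<^sub>m E) $$ (q, 0)" "(E * B i) $$ (0, q) = (e i \<cdot>\<^sub>m E) $$ (0, q)"
      by (simp_all only: BE EB)
    then show ?thesis using that
      by (simp_all add: E_def mat_diag_mult_right[OF B] mat_diag_mult_left[OF B])
        (simp_all add: mat_diag_def)
  qed
  define B' where "B' i = Matrix.mat n n (\<lambda>(p, q). B i $$ (Suc p, Suc q))" for i
  have B': "B' i \<in> carrier_mat n n" for i by (simp add: B'_def)
  have Bblk: "B i = scalar_block n (B i $$ (0, 0)) (B' i)" for i
    unfolding B'_def by (rule scalar_block_decompose[OF B Bzero])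
  have "commuting_normal n B'"
    unfolding commuting_normal_def
  proof (intro conjI allI)
    fix i j
    have "B i * B j = B j * B i" unfolding Bmult using Acomm by metis
    then have "scalar_block n (B i $$ (0, 0) * B j $$ (0, 0)) (B' i * B' j)
        = scalar_block n (B j $$ (0, 0) * B i $$ (0, 0)) (B' j * B' i)"
      by (metis Bblk B' scalar_block_mult)
    then show "B' i * B' j = B' j * B' i" by (rule scalar_block_inj[rotated 2]) (use B' in auto)
    have "B i * (B i)\<^sup>\<dagger> = (B i)\<^sup>\<dagger> * B i" using Bnormal by (simp add: normal_mat_def)
    then have "scalar_block n (B i $$ (0, 0) * cnj (B i $$ (0, 0))) (B' i * (B' i)\<^sup>\<dagger>)
        = scalar_block n (cnj (B i $$ (0, 0)) * B i $$ (0, 0)) ((B' i)\<^sup>\<dagger> * B' i)"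
      by (metis Bblk B' scalar_block_mult scalar_block_adj adj_carrier)
    then have "B' i * (B' i)\<^sup>\<dagger> = (B' i)\<^sup>\<dagger> * B' i"
      by (rule scalar_block_inj[rotated 2]) (use B' in auto)
    then show "normal_mat (B' i)" by (simp add: normal_mat_def)
  qed (rule B')
  from Suc.IH[OF this] obtain V d where V: "unitary_mat n V" and d: "\<And>i. B' i = udiag n V (d i)"
    by blast
  note V' = unitaryD[OF V]
  define V1 where "V1 = scalar_block n 1 V"
  have V1: "unitary_mat ?N V1"
    using V' by (simp add: unitary_mat_def V1_def scalar_block_adj scalar_block_mult scalar_block_one)
  have "A i = udiag ?N (U * V1) (case_nat (B i $$ (0, 0)) (d i))" for i
  proof -
    have "B i = scalar_block n (B i $$ (0, 0)) (V * mat_diag n (d i) * V\<^sup>\<dagger>)"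
      using Bblk[of i] by (simp add: d udiag_def)
    also have "\<dots> = udiag ?N V1 (case_nat (B i $$ (0, 0)) (d i))"
      using V' by (simp add: udiag_def V1_def scalar_block_adj scalar_block_mult flip: scalar_block_mat_diag)
    finally have "U * B i * U\<^sup>\<dagger> = udiag ?N (U * V1) (case_nat (B i $$ (0, 0)) (d i))"
      using udiag_frame_mult[OF U'(1) unitaryD(1)[OF V1]] by (rule ssubst)
    moreover have "U * B i * U\<^sup>\<dagger> = A i"
      using A U' by (simp add: B_def sq_assoc[of _ ?N] unitary_cancel[OF U] sq_one[of _ ?N])
    ultimately show ?thesis by simp
  qed
  then show ?case using unitary_mult[OF U V1]
    by (intro exI[of _ "U * V1"] exI[of _ "\<lambda>i. case_nat (B i $$ (0, 0)) (d i)"]) simp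
qed

lemma normal_diagonalization:
  assumes M: "M \<in> carrier_mat n n" "normal_mat M"
  shows "\<exists>V d. unitary_mat n V \<and> M = udiag n V d"
proof -
  have "\<exists>U d. unitary_mat n U \<and> (\<forall>i::unit. M = udiag n U (d i))"
  proof (rule simultaneous_diagonalization_from_eigenvectors[where A = "\<lambda>_::unit. M"])
    show "commuting_normal n (\<lambda>_::unit. M)" using M by (simp add: commuting_normal_def)
  next
    fix n and A :: "unit \<Rightarrow> complex mat"
    assume n: "n > 0" and A: "commuting_normal n A"
    then have A': "A () \<in> carrier_mat n n" by (simp add: commuting_normal_def)
    obtain k where "eigenvalue (A ()) k"
      using spectrum_non_empty[OF A' n] by (auto simp: spectrum_def)
    then obtain v where v: "v \<in> carrier_vec n" "v \<noteq> 0\<^sub>v n" "A () *\<^sub>v v = k \<cdot>\<^sub>v v"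
      using A' by (auto simp: eigenvalue_def eigenvector_def)
    define w where "w = Matrix.mat n n (\<lambda>(i, j::nat). v $ i)"
    have w: "w \<in> carrier_mat n n" by (simp add: w_def)
    have colw: "col w j = v" if "j < n" for j using that v by (auto simp: w_def)
    have "w \<noteq> 0\<^sub>m n n"
      using v(2) colw[OF n] n by auto
    moreover have "A () * w = k \<cdot>\<^sub>m w"
      by (rule mat_col_eqI) (use A' w v colw in \<open>auto simp del: index_mult_mat_vec col_mult simp add: col_mult2[of _ n n _ n]\<close>)
    ultimately show "\<exists>w\<in>carrier_mat n n. w \<noteq> 0\<^sub>m n n \<and> (\<forall>i. \<exists>e. A i * w = e \<cdot>\<^sub>m w)"
      using w by (metis (full_types) unit.exhaust)
  qed
  then show ?thesis by blast
qed

text \<open>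
  Each matrix of the family contributes a spectral projection that does not annihilate the common
  eigenmatrix found so far; the projection commutes with the other members, so eigenvalue equations
  obtained before survive.
\<close>
lemma common_eigenmatrix:
  fixes A :: "'i \<Rightarrow> complex mat"
  assumes n: "n > 0" and A: "commuting_normal n A" and S: "finite S"
  shows "\<exists>w\<in>carrier_mat n n. w \<noteq> 0\<^sub>m n n \<and> (\<forall>i\<in>S. \<exists>e. A i * w = e \<cdot>\<^sub>m w)"
  using S
proof (induction S)
  case empty
  have "(1\<^sub>m n :: complex mat) $$ (0, 0) \<noteq> 0\<^sub>m n n $$ (0, 0)" using n by simp
  then show ?case by (metis all_not_in_conv one_carrier_mat)
next
  case (insert i S)
  then obtain w where w: "w \<in> carrier_mat n n" "w \<noteq> 0\<^sub>m n n"
    and ws: "\<And>j. j \<in> S \<Longrightarrow> \<exists>e. A j * w = e \<cdot>\<^sub>m w" by blast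
  have An: "normal_mat (A i)" and A: "A i \<in> carrier_mat n n" and Acomm: "A i * A j = A j * A i" for i j
    using A unfolding commuting_normal_def by blast+
  obtain V d where V: "unitary_mat n V" and d: "A i = udiag n V d"
    using normal_diagonalization[OF A An] by blast
  note V' = unitaryD[OF V]
  obtain k where k: "udiag n V (\<lambda>j. if d j = d k then 1 else 0) * w \<noteq> 0\<^sub>m n n"
    using spectral_component_nonzero[OF V w, of d] by blast
  define E where "E = udiag n V (\<lambda>j. if d j = d k then 1 else 0)"
  have E: "E \<in> carrier_mat n n" using V' by (simp add: E_def)
  have "A i * E = udiag n V (\<lambda>j. d j * (if d j = d k then 1 else 0))"
    unfolding d E_def by (rule udiag_mult[OF V])
  also have "\<dots> = udiag n V (\<lambda>j. d k * (if d j = d k then 1 else 0))"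
    by (rule udiag_cong) auto
  also have "\<dots> = d k \<cdot>\<^sub>m E" unfolding E_def using V' by (simp add: udiag_smult)
  finally have "A i * (E * w) = d k \<cdot>\<^sub>m (E * w)"
    using sq_assoc[OF A E w(1), of i] E w by (simp add: sq_smult_mult)
  moreover have "\<exists>e. A j * (E * w) = e \<cdot>\<^sub>m (E * w)" if j: "j \<in> S" for j
  proof -
    obtain e where e: "A j * w = e \<cdot>\<^sub>m w" using ws[OF j] by blast
    have "A j * E = E * A j"
      unfolding E_def by (rule udiag_commute[OF V]) (use A Acomm in \<open>auto simp flip: d\<close>)
    then have "A j * (E * w) = E * (A j * w)"
      using sq_assoc[OF A E w(1), of j] sq_assoc[OF E A w(1), of j] by simp
    also have "\<dots> = e \<cdot>\<^sub>m (E * w)" unfolding e using E w by (simp add: sq_smult_mult)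
    finally show ?thesis by blast
  qed
  ultimately show ?case using k E w unfolding E_def[symmetric]
    by (intro bexI[of _ "E * w"]) auto
qed

theorem simultaneous_diagonalization:
  fixes A :: "'i::finite \<Rightarrow> complex mat"
  assumes "commuting_normal n A"
  shows "\<exists>U d. unitary_mat n U \<and> (\<forall>i. A i = udiag n U (d i))"
  using common_eigenmatrix[of _ _ "UNIV :: 'i set"]
  by (intro simultaneous_diagonalization_from_eigenvectors assms) auto

lemma hermitian_normal: "hermitian_mat M \<Longrightarrow> normal_mat M"
  by (simp add: hermitian_mat_def normal_mat_def)

lemma hermitian_udiag_real:
  assumes "hermitian_mat (udiag n V d)" "unitary_mat n V"
  shows "udiag n V d = udiag n V (\<lambda>i. of_real (Re (d i)))"
proof (rule udiag_cong)
  fix i assume i: "i < n"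
  have "udiag n V (\<lambda>i. cnj (d i)) = udiag n V d"
    using assms unitaryD[OF assms(2)] by (simp add: hermitian_mat_def udiag_adj)
  from udiag_eqD[OF assms(2) this i] show "d i = of_real (Re (d i))"
    by (simp add: complex_eq_iff)
qed

lemma hermitian_diagonalization:
  assumes "M \<in> carrier_mat n n" "hermitian_mat M"
  shows "\<exists>V d. unitary_mat n V \<and> M = udiag n V (\<lambda>i. complex_of_real (d i))"
  using normal_diagonalization[OF assms(1) hermitian_normal[OF assms(2)]]
    hermitian_udiag_real assms(2) by metis

lemma hermitian_pair_diagonalization:
  assumes "M \<in> carrier_mat n n" "hermitian_mat M" "N \<in> carrier_mat n n" "hermitian_mat N"
    and "M * N = N * M"
  shows "\<exists>V c d. unitary_mat n V \<and> M = udiag n V (\<lambda>i. complex_of_real (c i)) \<and>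
    N = udiag n V (\<lambda>i. complex_of_real (d i))"
proof -
  have "commuting_normal n (\<lambda>b. if b then M else N)"
    using assms by (auto simp: commuting_normal_def hermitian_normal)
  from simultaneous_diagonalization[OF this] obtain V d where V: "unitary_mat n V"
    and d: "\<And>b. (if b then M else N) = udiag n V (d b)" by blast
  have "M = udiag n V (d True)" "N = udiag n V (d False)" using d[of True] d[of False] by auto
  then show ?thesis using V assms(2,4) hermitian_udiag_real by metis
qed

section \<open>Unitary matrices that maximise a trace\<close>

lemma sum_two_support:
  fixes f :: "nat \<Rightarrow> 'a::comm_ring_1"
  assumes "i < n" "j < n" "i \<noteq> j"
  shows "(\<Sum>p<n. (if p = i then x else if p = j then y else 0) * f p) = x * f i + y * f j"
proof -
  have "(\<Sum>p<n. (if p = i then x else if p = j then y else 0) * f p)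
      = (\<Sum>p<n. (if p = i then x * f p else 0) + (if p = j then y * f p else 0))"
    using assms by (intro sum.cong) auto
  also have "\<dots> = x * f i + y * f j"
    using assms by (simp add: sum.distrib)
  finally show ?thesis .
qed

lemma conj_diag_entry:
  assumes "G \<in> carrier_mat n n" "M \<in> carrier_mat n n" "q < n"
  shows "(G\<^sup>\<dagger> * M * G) $$ (q, q) = (\<Sum>r<n. G $$ (r, q) * (\<Sum>p<n. cnj (G $$ (p, q)) * M $$ (p, r)))"
  using assms by (auto simp: scalar_prod_def atLeast0LessThan mult.commute intro!: sum.cong)

text \<open>Rotating in a coordinate plane moves weight between two diagonal entries: this single
  computation yields both the optimality conditions and the transfers of Horn's theorem.\<close>
lemma plane_rotation:
  fixes a b :: complex
  assumes ij: "i < n" "j < n" "i \<noteq> j" and ab: "(cmod a)\<^sup>2 + (cmod b)\<^sup>2 = 1"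
  shows "\<exists>G. unitary_mat n G \<and> (\<forall>M\<in>carrier_mat n n.
      (G\<^sup>\<dagger> * M * G) $$ (i, i) = (cmod a)\<^sup>2 * M $$ (i, i) + (cmod b)\<^sup>2 * M $$ (j, j)
         + (cnj a * b * M $$ (i, j) + a * cnj b * M $$ (j, i)) \<and>
      (G\<^sup>\<dagger> * M * G) $$ (j, j) = (cmod b)\<^sup>2 * M $$ (i, i) + (cmod a)\<^sup>2 * M $$ (j, j)
         - (cnj a * b * M $$ (i, j) + a * cnj b * M $$ (j, i)) \<and>
      (\<forall>l<n. l \<noteq> i \<longrightarrow> l \<noteq> j \<longrightarrow> (G\<^sup>\<dagger> * M * G) $$ (l, l) = M $$ (l, l)))"
proof -
  define g where "g q p = (if q = i then (if p = i then a else if p = j then b else 0)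
    else if q = j then (if p = i then - cnj b else if p = j then cnj a else 0)
    else if p = q then 1 else 0)" for q p :: nat
  define G where "G = Matrix.mat n n (\<lambda>(p, q). g q p)"
  have G: "G \<in> carrier_mat n n" by (simp add: G_def)
  have Gi: "G $$ (p, q) = g q p" if "p < n" "q < n" for p q using that by (simp add: G_def)
  have colsum: "(\<Sum>p<n. g q p * f p) =
      (if q = i then a * f i + b * f j else if q = j then - cnj b * f i + cnj a * f j else f q)"
    if "q < n" for q and f :: "nat \<Rightarrow> complex"
  proof (cases "q = i \<or> q = j")
    case True
    then show ?thesis using ij by (auto simp: g_def sum_two_support)
  next
    case False
    then show ?thesis using that by (simp add: g_def if_distrib[of "\<lambda>x. x * _"] cong: if_cong)
  qed
  have colsum': "(\<Sum>p<n. cnj (g q p) * f p) =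
      (if q = i then cnj a * f i + cnj b * f j else if q = j then - b * f i + a * f j else f q)"
    if "q < n" for q and f :: "nat \<Rightarrow> complex"
  proof -
    have "(\<Sum>p<n. cnj (g q p) * f p) = cnj (\<Sum>p<n. g q p * cnj (f p))" by simp
    then show ?thesis unfolding colsum[OF that] by simp
  qed
  have aa: "cnj a * a = (cmod a)\<^sup>2" "cnj b * b = (cmod b)\<^sup>2"
    by (simp_all add: complex_norm_square mult.commute del: of_real_power)
  have ab': "cnj a * a + cnj b * b = 1" unfolding aa using ab by (metis of_real_1 of_real_add)
  have "G\<^sup>\<dagger> * G = 1\<^sub>m n"
  proof (rule eq_matI)
    fix q r assume "q < dim_row (1\<^sub>m n :: complex mat)" "r < dim_col (1\<^sub>m n :: complex mat)"
    then have qr: "q < n" "r < n" by auto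
    have "(G\<^sup>\<dagger> * G) $$ (q, r) = (\<Sum>p<n. cnj (g q p) * g r p)"
      using qr G by (auto simp: scalar_prod_def atLeast0LessThan Gi intro!: sum.cong)
    also have "\<dots> = (if q = r then 1 else 0)"
      unfolding colsum'[OF qr(1)] using ab' ij by (auto simp: g_def mult.commute add.commute)
    finally show "(G\<^sup>\<dagger> * G) $$ (q, r) = 1\<^sub>m n $$ (q, r)" using qr by simp
  qed (use G in auto)
  then have "unitary_mat n G" using G by (simp add: unitary_mat_def)
  moreover have "(G\<^sup>\<dagger> * M * G) $$ (q, q) =
     (if q = i then (cmod a)\<^sup>2 * M $$ (i, i) + (cmod b)\<^sup>2 * M $$ (j, j)
         + (cnj a * b * M $$ (i, j) + a * cnj b * M $$ (j, i))
      else if q = j then (cmod b)\<^sup>2 * M $$ (i, i) + (cmod a)\<^sup>2 * M $$ (j, j)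
         - (cnj a * b * M $$ (i, j) + a * cnj b * M $$ (j, i))
      else M $$ (q, q))"
    if M: "M \<in> carrier_mat n n" and q: "q < n" for M q
  proof -
    have "(G\<^sup>\<dagger> * M * G) $$ (q, q) = (\<Sum>r<n. g q r * (\<Sum>p<n. cnj (g q p) * M $$ (p, r)))"
      unfolding conj_diag_entry[OF G M q] using q by (intro sum.cong refl) (auto simp: Gi)
    then show ?thesis
      unfolding colsum[OF q] colsum'[OF q] using ij(3)
      by (auto simp: algebra_simps simp del: of_real_power simp flip: aa)
  qed
  ultimately show ?thesis using ij by (intro exI[of _ G]) auto
qed

definition trace_maximal :: "nat \<Rightarrow> complex mat \<Rightarrow> complex mat \<Rightarrow> bool" where
  "trace_maximal n C X \<longleftrightarrow>
     (\<forall>W. unitary_mat n W \<longrightarrow> Re (mat_trace (C * W\<^sup>\<dagger> * X * W)) \<le> Re (mat_trace (C * X)))"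

context
  fixes n :: nat
begin

lemma trace_udiag_mult:
  assumes V: "unitary_mat n V" and X: "X \<in> carrier_mat n n"
  shows "mat_trace (udiag n V c * X) = (\<Sum>i<n. c i * (V\<^sup>\<dagger> * X * V) $$ (i, i))"
proof -
  note V' = unitaryD[OF V]
  have Y: "V\<^sup>\<dagger> * X * V \<in> carrier_mat n n" using V' X by simp
  have "mat_trace (udiag n V c * X) = mat_trace (V * (mat_diag n c * (V\<^sup>\<dagger> * X)))"
    using V' X by (simp add: udiag_def sq_assoc[of _ n])
  also have "\<dots> = mat_trace ((mat_diag n c * (V\<^sup>\<dagger> * X)) * V)"
    using V' X by (intro trace_comm[of _ n n]) auto
  also have "(mat_diag n c * (V\<^sup>\<dagger> * X)) * V = mat_diag n c * (V\<^sup>\<dagger> * X * V)"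
    using V' X by (simp add: sq_assoc[of _ n])
  finally show ?thesis
    using Y by (simp add: mat_diag_mult_left[OF Y] mat_trace_def del: index_mult_mat(1))
qed

text \<open>
  The optimality condition for rotations in the plane (i, j), with an unnormalised direction
  (\<alpha>, \<beta>). The trace changes only through the two diagonal entries i and j, and these change by
  opposite amounts.
\<close>
lemma maximal_rotation:
  fixes c :: "nat \<Rightarrow> real" and \<alpha> \<beta> :: complex
  assumes V: "unitary_mat n V" and X: "X \<in> carrier_mat n n"
    and max: "trace_maximal n (udiag n V (\<lambda>i. of_real (c i))) X"
    and ij: "i < n" "j < n"
    and Y: "Y = V\<^sup>\<dagger> * X * V"
  shows "(c i - c j) * ((cmod \<beta>)\<^sup>2 * (Re (Y $$ (j, j)) - Re (Y $$ (i, i)))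
     + Re (cnj \<alpha> * \<beta> * Y $$ (i, j) + \<alpha> * cnj \<beta> * Y $$ (j, i))) \<le> 0"
proof (cases "i = j \<or> (\<alpha> = 0 \<and> \<beta> = 0)")
  case True then show ?thesis by auto
next
  case False
  note V' = unitaryD[OF V]
  have Yc: "Y \<in> carrier_mat n n" using V' X by (simp add: Y)
  define N where "N = sqrt ((cmod \<alpha>)\<^sup>2 + (cmod \<beta>)\<^sup>2)"
  have N2: "N\<^sup>2 = (cmod \<alpha>)\<^sup>2 + (cmod \<beta>)\<^sup>2" by (simp add: N_def)
  have "N\<^sup>2 > 0" unfolding N2 using False by (auto simp: add_pos_nonneg add_nonneg_pos)
  then have N: "N \<noteq> 0" "N > 0" by (auto simp: N_def)
  define a where "a = \<alpha> / of_real N"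
  define b where "b = \<beta> / of_real N"
  have "(cmod a)\<^sup>2 + (cmod b)\<^sup>2 = ((cmod \<alpha>)\<^sup>2 + (cmod \<beta>)\<^sup>2) / N\<^sup>2"
    by (simp add: a_def b_def norm_divide power_divide add_divide_distrib)
  then have ab: "(cmod a)\<^sup>2 + (cmod b)\<^sup>2 = 1" using N by (simp flip: N2)
  obtain G where G: "unitary_mat n G" and Gd: "\<And>M. M \<in> carrier_mat n n \<Longrightarrow>
      (G\<^sup>\<dagger> * M * G) $$ (i, i) = (cmod a)\<^sup>2 * M $$ (i, i) + (cmod b)\<^sup>2 * M $$ (j, j)
         + (cnj a * b * M $$ (i, j) + a * cnj b * M $$ (j, i)) \<and>
      (G\<^sup>\<dagger> * M * G) $$ (j, j) = (cmod b)\<^sup>2 * M $$ (i, i) + (cmod a)\<^sup>2 * M $$ (j, j)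
         - (cnj a * b * M $$ (i, j) + a * cnj b * M $$ (j, i)) \<and>
      (\<forall>l<n. l \<noteq> i \<longrightarrow> l \<noteq> j \<longrightarrow> (G\<^sup>\<dagger> * M * G) $$ (l, l) = M $$ (l, l))"
    using plane_rotation[OF ij _ ab] False by blast
  note G' = unitaryD[OF G]
  let ?C = "udiag n V (\<lambda>i. complex_of_real (c i))"
  define W where "W = V * G * V\<^sup>\<dagger>"
  have W: "unitary_mat n W" unfolding W_def by (intro unitary_mult unitary_adj V G)
  note W' = unitaryD[OF W]
  have C: "?C \<in> carrier_mat n n" using V' by simp
  have eq: "V\<^sup>\<dagger> * (W\<^sup>\<dagger> * X * W) * V = G\<^sup>\<dagger> * Y * G"
    using V' G' X by (simp add: W_def Y sq_adj_mult[of _ n] sq_assoc[of _ n]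
        unitary_cancel[OF V] sq_one[of _ n])
  have "Re (mat_trace (?C * (W\<^sup>\<dagger> * X * W))) \<le> Re (mat_trace (?C * X))"
  proof -
    have "?C * (W\<^sup>\<dagger> * X * W) = ?C * W\<^sup>\<dagger> * X * W"
      using C W' X by (simp add: sq_assoc[of _ n])
    then show ?thesis using max W by (simp add: trace_maximal_def)
  qed
  then have le: "(\<Sum>l<n. c l * (Re ((G\<^sup>\<dagger> * Y * G) $$ (l, l)) - Re (Y $$ (l, l)))) \<le> 0"
    using W' X by (simp add: trace_udiag_mult[OF V] eq Y[symmetric] right_diff_distrib sum_subtractf
        del: index_mult_mat(1))
  define t where "t = Re ((G\<^sup>\<dagger> * Y * G) $$ (i, i)) - Re (Y $$ (i, i))"
  have a2: "(cmod a)\<^sup>2 = 1 - (cmod b)\<^sup>2" using ab by simp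
  define z where "z = cnj a * b * Y $$ (i, j) + a * cnj b * Y $$ (j, i)"
  have Gi: "Re ((G\<^sup>\<dagger> * Y * G) $$ (i, i)) = (cmod a)\<^sup>2 * Re (Y $$ (i, i)) + (cmod b)\<^sup>2 * Re (Y $$ (j, j)) + Re z"
    and Gj: "Re ((G\<^sup>\<dagger> * Y * G) $$ (j, j)) = (cmod b)\<^sup>2 * Re (Y $$ (i, i)) + (cmod a)\<^sup>2 * Re (Y $$ (j, j)) - Re z"
    using Gd[OF Yc] unfolding z_def[symmetric] by (simp_all del: of_real_power)
  have t1: "t = (cmod b)\<^sup>2 * (Re (Y $$ (j, j)) - Re (Y $$ (i, i))) + Re z"
    unfolding t_def Gi a2 by (simp add: algebra_simps)
  have t2: "Re ((G\<^sup>\<dagger> * Y * G) $$ (j, j)) - Re (Y $$ (j, j)) = - t"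
    unfolding t1 Gj a2 by (simp add: algebra_simps)
  have t3: "Re ((G\<^sup>\<dagger> * Y * G) $$ (l, l)) - Re (Y $$ (l, l)) = 0" if "l < n" "l \<noteq> i" "l \<noteq> j" for l
    using Gd[OF Yc] that by simp
  have "(\<Sum>l<n. c l * (Re ((G\<^sup>\<dagger> * Y * G) $$ (l, l)) - Re (Y $$ (l, l))))
      = (\<Sum>l\<in>{i, j}. c l * (Re ((G\<^sup>\<dagger> * Y * G) $$ (l, l)) - Re (Y $$ (l, l))))"
    using ij by (intro sum.mono_neutral_right) (auto simp: t3)
  also have "\<dots> = (c i - c j) * t"
  proof -
    have "(\<Sum>l\<in>{i, j}. c l * (Re ((G\<^sup>\<dagger> * Y * G) $$ (l, l)) - Re (Y $$ (l, l)))) = c i * t + c j * (- t)"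
      using False unfolding t_def by (simp only: t2[unfolded t_def, symmetric]) simp
    then show ?thesis by (simp add: algebra_simps)
  qed
  finally have "(c i - c j) * t \<le> 0" using le by simp
  then have "N\<^sup>2 * ((c i - c j) * t) \<le> 0" using N by (simp add: mult_le_0_iff)
  moreover have "N\<^sup>2 * t = (cmod \<beta>)\<^sup>2 * (Re (Y $$ (j, j)) - Re (Y $$ (i, i)))
      + Re (cnj \<alpha> * \<beta> * Y $$ (i, j) + \<alpha> * cnj \<beta> * Y $$ (j, i))"
  proof -
    have "N\<^sup>2 * (cmod b)\<^sup>2 = (cmod \<beta>)\<^sup>2"
      using N by (simp add: b_def norm_divide power_divide)
    moreover have "cnj \<alpha> * \<beta> * Y $$ (i, j) + \<alpha> * cnj \<beta> * Y $$ (j, i) = of_real (N\<^sup>2) * z"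
      using N by (simp add: z_def a_def b_def field_simps power2_eq_square)
    ultimately show ?thesis unfolding t1 distrib_left mult.assoc[symmetric]
      by simp
  qed
  ultimately show ?thesis by (metis mult.left_commute)
qed

text \<open>
  In a frame that diagonalises C, an entry of X between different eigenvalues c_i > c_j would give a
  gain of first order for a small rotation with the right phase, against a loss of second order.
\<close>
lemma maximal_commute:
  assumes C: "C \<in> carrier_mat n n" "hermitian_mat C" and X: "X \<in> carrier_mat n n" "hermitian_mat X"
    and max: "trace_maximal n C X"
  shows "C * X = X * C"
proof -
  obtain V c where V: "unitary_mat n V" and Cd: "C = udiag n V (\<lambda>i. complex_of_real (c i))"
    using hermitian_diagonalization[OF C] by blast
  note V' = unitaryD[OF V]
  define Y where "Y = V\<^sup>\<dagger> * X * V"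
  have Y: "Y \<in> carrier_mat n n" using V' X by (simp add: Y_def)
  have Yad: "Y\<^sup>\<dagger> = Y"
    using V' X by (simp add: Y_def hermitian_mat_def sq_adj_mult[of _ n] sq_assoc[of _ n])
  have "c i \<le> c j" if ij: "i < n" "j < n" and nz: "Y $$ (i, j) \<noteq> 0" for i j
  proof (rule ccontr)
    assume "\<not> c i \<le> c j"
    then have pos: "c i - c j > 0" by simp
    let ?y = "Y $$ (i, j)" and ?D = "Re (Y $$ (j, j)) - Re (Y $$ (i, i))"
    have yji: "Y $$ (j, i) = cnj ?y" using Yad ij Y by (metis adj_index carrier_matD)
    \<comment> \<open>small enough for the quadratic term to be at most half of the linear one\<close>
    define t where "t = 1 / (1 + \<bar>?D\<bar>)"
    have t: "t > 0" by (simp add: t_def)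
    have yy: "cnj ?y * ?y = of_real ((cmod ?y)\<^sup>2)"
      by (simp add: complex_norm_square mult.commute del: of_real_power)
    have "(c i - c j) * ((cmod (of_real t * cnj ?y))\<^sup>2 * ?D
        + Re (cnj 1 * (of_real t * cnj ?y) * ?y + 1 * cnj (of_real t * cnj ?y) * cnj ?y)) \<le> 0"
      using maximal_rotation[OF V X(1) max[unfolded Cd] ij Y_def, where \<alpha> = 1 and \<beta> = "of_real t * cnj ?y"]
      unfolding yji .
    also have "cnj 1 * (of_real t * cnj ?y) * ?y + 1 * cnj (of_real t * cnj ?y) * cnj ?y
        = of_real (2 * t * (cmod ?y)\<^sup>2)"
      by (simp add: mult.assoc yy mult.commute[of ?y] del: of_real_power)
    also have "(cmod (of_real t * cnj ?y))\<^sup>2 = t\<^sup>2 * (cmod ?y)\<^sup>2"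
      by (simp add: norm_mult power_mult_distrib)
    finally have "(c i - c j) * (t * (cmod ?y)\<^sup>2 * (t * ?D + 2)) \<le> 0"
      by (simp add: algebra_simps power2_eq_square)
    moreover have "t * (cmod ?y)\<^sup>2 > 0" using t nz by simp
    moreover have "t * ?D + 2 > 0"
    proof -
      have "\<bar>t * ?D\<bar> \<le> 1" using t by (simp add: abs_mult t_def field_simps)
      then show ?thesis by linarith
    qed
    ultimately show False using pos by (metis mult_pos_pos not_less)
  qed
  note le = this
  have key: "of_real (c i) * Y $$ (i, j) = Y $$ (i, j) * complex_of_real (c j)" if ij: "i < n" "j < n" for i j
  proof (cases "Y $$ (i, j) = 0")
    case False
    have "Y $$ (j, i) = cnj (Y $$ (i, j))" using Yad ij Y by (metis adj_index carrier_matD)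
    then have "Y $$ (j, i) \<noteq> 0" using False by simp
    then have "c i = c j" using le[OF ij False] le[OF ij(2,1)] by simp
    then show ?thesis by simp
  qed simp
  have "mat_diag n (\<lambda>i. complex_of_real (c i)) * Y = Y * mat_diag n (\<lambda>i. complex_of_real (c i))"
    using Y by (intro eq_matI) (auto simp: mat_diag_mult_left[OF Y] mat_diag_mult_right[OF Y] key)
  then have "V * (mat_diag n (\<lambda>i. complex_of_real (c i)) * Y) * V\<^sup>\<dagger>
      = V * (Y * mat_diag n (\<lambda>i. complex_of_real (c i))) * V\<^sup>\<dagger>" by simp
  then show ?thesis using V' X
    by (simp add: Cd udiag_def Y_def sq_assoc[of _ n] unitary_cancel[OF V] sq_one[of _ n])
qed

text \<open>
  The rotation with \<alpha> = 0 exchanges the two diagonal entries.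
\<close>
lemma maximal_order:
  assumes V: "unitary_mat n V" and max: "trace_maximal n (udiag n V (\<lambda>i. complex_of_real (c i)))
      (udiag n V (\<lambda>i. complex_of_real (y i)))"
    and ij: "i < n" "j < n" "c i > c j"
  shows "y i \<ge> y j"
proof -
  note V' = unitaryD[OF V]
  let ?X = "udiag n V (\<lambda>i. complex_of_real (y i))"
  have X: "?X \<in> carrier_mat n n" using V' by simp
  have Y: "mat_diag n (\<lambda>i. complex_of_real (y i)) = V\<^sup>\<dagger> * ?X * V"
    using udiag_iff[OF V X] by metis
  have "(c i - c j) * (y j - y i) \<le> 0"
    using maximal_rotation[OF V X max ij(1,2) Y, where \<alpha> = 0 and \<beta> = 1] ij
    by (simp add: mat_diag_def)
  then show ?thesis using ij(3) by (simp add: mult_le_0_iff)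
qed

end

section \<open>Projections\<close>

definition projection :: "nat \<Rightarrow> complex mat \<Rightarrow> bool" where
  "projection n P \<longleftrightarrow> P \<in> carrier_mat n n \<and> P\<^sup>\<dagger> = P \<and> P * P = P"

lemma projectionD:
  assumes "projection n P"
  shows "P \<in> carrier_mat n n" "P\<^sup>\<dagger> = P" "P * P = P"
  using assms by (auto simp: projection_def)

lemma smult_left_cancel:
  assumes "c \<cdot>\<^sub>m A = c \<cdot>\<^sub>m B" "c \<noteq> (0 :: complex)" "A \<in> carrier_mat a b" "B \<in> carrier_mat a b"
  shows "A = B"
proof (rule eq_matI)
  fix i j assume "i < dim_row B" "j < dim_col B"
  moreover have "(c \<cdot>\<^sub>m A) $$ (i, j) = (c \<cdot>\<^sub>m B) $$ (i, j)" by (simp only: assms)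
  ultimately show "A $$ (i, j) = B $$ (i, j)" using assms(2-4) by simp
qed (use assms(3,4) in auto)

lemma minus_eq_zero_iff:
  assumes "A \<in> carrier_mat a b" "B \<in> carrier_mat a b"
  shows "A - B = 0\<^sub>m a b \<longleftrightarrow> A = (B :: complex mat)"
proof
  assume eq: "A - B = 0\<^sub>m a b"
  show "A = B"
  proof (rule eq_matI)
    fix i j assume "i < dim_row B" "j < dim_col B"
    moreover have "(A - B) $$ (i, j) = (0\<^sub>m a b :: complex mat) $$ (i, j)" by (simp only: eq)
    ultimately show "A $$ (i, j) = B $$ (i, j)" using assms by simp
  qed (use assms in auto)
qed (use assms in auto)

text \<open>
  Square matrices u take the place of vectors here: the trace of u^H X u is the sum of the quadratic
  form of X over the columns of u, so that an inequality for all u amounts to one for all vectors,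
  and rank-one spectral projections can serve as eigenvectors.
\<close>
definition quad_form :: "complex mat \<Rightarrow> complex mat \<Rightarrow> real" where
  "quad_form X u = Re (mat_trace (u\<^sup>\<dagger> * X * u))"

definition sq_norm :: "complex mat \<Rightarrow> real" where
  "sq_norm u = Re (mat_trace (u\<^sup>\<dagger> * u))"

text \<open>
  For P commuting with a Hermitian X: no eigenvalue of X on the kernel of P exceeds one on the range.
  Inequalities between quadratic forms, instead of eigenvalues, make the condition visibly closed in X.
\<close>
definition dominates :: "nat \<Rightarrow> complex mat \<Rightarrow> complex mat \<Rightarrow> bool" where
  "dominates n P X \<longleftrightarrow> (\<forall>u\<in>carrier_mat n n. \<forall>w\<in>carrier_mat n n.
     P * u = u \<longrightarrow> P * w = 0\<^sub>m n n \<longrightarrow> quad_form X w * sq_norm u \<le> quad_form X u * sq_norm w)"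

context
  fixes n :: nat
begin

lemma sq_norm_pos: "u \<in> sq n \<Longrightarrow> u \<noteq> 0\<^sub>m n n \<Longrightarrow> sq_norm u > 0"
  unfolding sq_norm_def by (rule trace_adj_self_pos)

lemma quad_form_eigen:
  assumes "X \<in> sq n" "u \<in> sq n" "X * u = complex_of_real a \<cdot>\<^sub>m u"
  shows "quad_form X u = a * sq_norm u"
proof -
  have "u\<^sup>\<dagger> * X * u = u\<^sup>\<dagger> * (X * u)" using assms(1,2) by (simp add: sq_algebra[of _ n])
  also have "\<dots> = complex_of_real a \<cdot>\<^sub>m (u\<^sup>\<dagger> * u)" unfolding assms(3) using assms(2) by (simp add: sq_algebra[of _ n])
  finally show ?thesis
    using assms(2) by (simp add: quad_form_def sq_norm_def trace_smult[of _ n])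
qed

lemma projection_trace_zero:
  assumes "projection n P" "mat_trace P = 0"
  shows "P = 0\<^sub>m n n"
  using trace_adj_self_pos[of P n] projectionD[OF assms(1)] assms(2) by fastforce

lemma projection_compl:
  assumes "projection n P"
  shows "projection n (1\<^sub>m n - P)" "P * (1\<^sub>m n - P) = 0\<^sub>m n n" "(1\<^sub>m n - P) * P = 0\<^sub>m n n"
    "mat_trace (1\<^sub>m n - P) = of_nat n - mat_trace P"
  using projectionD[OF assms]
  by (auto simp: projection_def adj_minus[of _ n n] sq_algebra[of _ n] trace_minus[of _ n])

lemma projection_real_values:
  assumes V: "unitary_mat n V" and P: "projection n (udiag n V d)" and i: "i < n"
  shows "d i = 0 \<or> d i = 1"
proof -
  have "udiag n V (\<lambda>i. d i * d i) = udiag n V d"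
    using projectionD[OF P] udiag_mult[OF V] by metis
  from udiag_eqD[OF V this i] show ?thesis by simp
qed

lemma projection_pair_frame:
  assumes X: "X \<in> sq n" "hermitian_mat X" and P: "projection n P" and comm: "X * P = P * X"
  obtains V y S where "unitary_mat n V" "X = udiag n V (\<lambda>i. complex_of_real (y i))"
    "P = udiag n V (\<lambda>i. of_bool (i \<in> S))" "S \<subseteq> {..<n}"
proof -
  note P' = projectionD[OF P]
  obtain V y p where V: "unitary_mat n V" and y: "X = udiag n V (\<lambda>i. complex_of_real (y i))"
    and p: "P = udiag n V (\<lambda>i. complex_of_real (p i))"
    using hermitian_pair_diagonalization[OF X P'(1) _ comm] P'(2) by (auto simp: hermitian_mat_def)
  have "P = udiag n V (\<lambda>i. of_bool (i \<in> {i. i < n \<and> p i = 1}))"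
    unfolding p by (rule udiag_cong) (use projection_real_values[OF V P[unfolded p]] in auto)
  then show ?thesis using that[OF V y, of "{i. i < n \<and> p i = 1}"] by auto
qed

lemma projection_trace_nat:
  assumes "projection n P"
  shows "\<exists>k. mat_trace P = of_nat k"
proof -
  note P' = projectionD[OF assms]
  obtain V S where V: "unitary_mat n V" and P: "P = udiag n V (\<lambda>i. of_bool (i \<in> S))" "S \<subseteq> {..<n}"
    using projection_pair_frame[OF _ _ assms refl] P' by (metis hermitian_mat_def)
  have "mat_trace P = (\<Sum>i<n. of_bool (i \<in> S))" unfolding P by (rule trace_udiag[OF V])
  also have "\<dots> = of_nat (\<Sum>i<n. of_bool (i \<in> S))" by simp
  finally show ?thesis by blast
qed

lemma udiag_unit_nonzero:
  assumes "unitary_mat n V" "i < n"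
  shows "udiag n V (\<lambda>j. of_bool (j = i)) \<noteq> 0\<^sub>m n n"
proof
  assume "udiag n V (\<lambda>j. of_bool (j = i)) = 0\<^sub>m n n"
  moreover have "mat_trace (udiag n V (\<lambda>j. of_bool (j = i))) = 1"
    using trace_udiag[OF assms(1), of "\<lambda>j. of_bool (j = i)"] assms(2) by simp
  ultimately show False by (simp add: mat_trace_def)
qed

lemma udiag_mult_unit:
  assumes "unitary_mat n V"
  shows "udiag n V d * udiag n V (\<lambda>j. of_bool (j = i)) = d i \<cdot>\<^sub>m udiag n V (\<lambda>j. of_bool (j = i))"
  unfolding udiag_mult[OF assms] udiag_smult[OF unitaryD(1)[OF assms]]
  by (rule udiag_cong) auto

lemma dominates_eigen:
  assumes dom: "dominates n P X" and X: "X \<in> sq n"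
    and u: "u \<in> sq n" "P * u = u" "u \<noteq> 0\<^sub>m n n" "X * u = complex_of_real b \<cdot>\<^sub>m u"
    and w: "w \<in> sq n" "P * w = 0\<^sub>m n n" "w \<noteq> 0\<^sub>m n n" "X * w = complex_of_real a \<cdot>\<^sub>m w"
  shows "a \<le> b"
proof -
  have "quad_form X w * sq_norm u \<le> quad_form X u * sq_norm w"
    using dom u w by (auto simp: dominates_def)
  then have "a * (sq_norm w * sq_norm u) \<le> b * (sq_norm w * sq_norm u)"
    using quad_form_eigen[OF X u(1,4)] quad_form_eigen[OF X w(1,4)] by (simp add: mult_ac)
  then show ?thesis using sq_norm_pos[OF u(1,3)] sq_norm_pos[OF w(1,3)]
    by (simp add: mult_le_cancel_right)
qed

lemma dominates_upper:
  assumes dom: "dominates n P X" and X: "X \<in> sq n"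
    and u: "u \<in> sq n" "P * u = u" "u \<noteq> 0\<^sub>m n n" "X * u = complex_of_real b \<cdot>\<^sub>m u"
    and w: "w \<in> sq n" "P * w = 0\<^sub>m n n"
  shows "quad_form X w \<le> b * sq_norm w"
proof -
  have "quad_form X w * sq_norm u \<le> quad_form X u * sq_norm w"
    using dom u w by (auto simp: dominates_def)
  then have "quad_form X w * sq_norm u \<le> (b * sq_norm w) * sq_norm u"
    using quad_form_eigen[OF X u(1,4)] by (simp add: mult_ac)
  then show ?thesis using sq_norm_pos[OF u(1,3)] by (simp add: mult_le_cancel_right)
qed

lemma quad_form_uminus: "u \<in> sq n \<Longrightarrow> X \<in> sq n \<Longrightarrow> quad_form ((-1) \<cdot>\<^sub>m X) u = - quad_form X u"
  by (simp add: quad_form_def sq_algebra[of _ n] trace_smult[of _ n])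

lemma compl_fix_iff:
  assumes "P \<in> sq n" "u \<in> sq n"
  shows "(1\<^sub>m n - P) * u = u \<longleftrightarrow> P * u = 0\<^sub>m n n" "(1\<^sub>m n - P) * u = 0\<^sub>m n n \<longleftrightarrow> P * u = u"
proof -
  have e: "(1\<^sub>m n - P) * u = u - P * u" using assms by (simp add: sq_algebra[of _ n])
  have "u - P * u = u \<longleftrightarrow> P * u = 0\<^sub>m n n"
  proof
    assume eq: "u - P * u = u"
    show "P * u = 0\<^sub>m n n"
    proof (rule eq_matI)
      fix i j assume "i < dim_row (0\<^sub>m n n :: complex mat)" "j < dim_col (0\<^sub>m n n :: complex mat)"
      moreover have "(u - P * u) $$ (i, j) = u $$ (i, j)" by (simp only: eq)
      ultimately show "(P * u) $$ (i, j) = 0\<^sub>m n n $$ (i, j)"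
        using assms by (simp del: index_mult_mat(1))
    qed (use assms in auto)
  next
    assume "P * u = 0\<^sub>m n n"
    then show "u - P * u = u" using assms by (auto intro!: eq_matI)
  qed
  then show "(1\<^sub>m n - P) * u = u \<longleftrightarrow> P * u = 0\<^sub>m n n" unfolding e .
  show "(1\<^sub>m n - P) * u = 0\<^sub>m n n \<longleftrightarrow> P * u = u"
    unfolding e using assms minus_eq_zero_iff[of u n n "P * u"] by auto
qed

lemma dominates_compl:
  assumes "P \<in> sq n" "X \<in> sq n" "dominates n P X"
  shows "dominates n (1\<^sub>m n - P) ((-1) \<cdot>\<^sub>m X)"
  using assms unfolding dominates_def
  by (auto simp: quad_form_uminus compl_fix_iff)

text \<open>Invariant subspaces on which the numerical values of a Hermitian matrix are separated are
  orthogonal, because eigenvectors to different eigenvalues are.\<close>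
lemma separated_projections_orthogonal:
  assumes X: "X \<in> sq n" "hermitian_mat X" and E: "projection n E" "X * E = E * X"
    and F: "projection n F" "X * F = F * X"
    and up: "\<And>w. w \<in> sq n \<Longrightarrow> E * w = w \<Longrightarrow> quad_form X w \<le> a * sq_norm w"
    and low: "\<And>w. w \<in> sq n \<Longrightarrow> F * w = w \<Longrightarrow> quad_form X w \<ge> b * sq_norm w"
    and "a < b"
  shows "E * F = 0\<^sub>m n n"
proof -
  obtain U y S where U: "unitary_mat n U" and Xy: "X = udiag n U (\<lambda>i. complex_of_real (y i))"
    and ES: "E = udiag n U (\<lambda>i. of_bool (i \<in> S))" "S \<subseteq> {..<n}"
    using projection_pair_frame[OF X E] .
  obtain V z T where V: "unitary_mat n V" and Xz: "X = udiag n V (\<lambda>i. complex_of_real (z i))"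
    and FT: "F = udiag n V (\<lambda>i. of_bool (i \<in> T))" "T \<subseteq> {..<n}"
    using projection_pair_frame[OF X F] .
  note U' = unitaryD[OF U] and V' = unitaryD[OF V]
  have y: "y i \<le> a" if "i \<in> S" for i
  proof -
    let ?G = "udiag n U (\<lambda>j. of_bool (j = i))"
    have i: "i < n" using that ES by auto
    have G: "?G \<in> sq n" using U' by simp
    have "E * ?G = ?G" unfolding ES(1) udiag_mult_unit[OF U] using that by (intro eq_matI) auto
    moreover have "X * ?G = complex_of_real (y i) \<cdot>\<^sub>m ?G" unfolding Xy by (rule udiag_mult_unit[OF U])
    ultimately have "y i * sq_norm ?G \<le> a * sq_norm ?G"
      using up[OF G] quad_form_eigen[OF X(1) G] by simp
    then show ?thesis using sq_norm_pos[OF G udiag_unit_nonzero[OF U i]] by simp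
  qed
  have z: "z i \<ge> b" if "i \<in> T" for i
  proof -
    let ?G = "udiag n V (\<lambda>j. of_bool (j = i))"
    have i: "i < n" using that FT by auto
    have G: "?G \<in> sq n" using V' by simp
    have "F * ?G = ?G" unfolding FT(1) udiag_mult_unit[OF V] using that by (intro eq_matI) auto
    moreover have "X * ?G = complex_of_real (z i) \<cdot>\<^sub>m ?G" unfolding Xz by (rule udiag_mult_unit[OF V])
    ultimately have "z i * sq_norm ?G \<ge> b * sq_norm ?G"
      using low[OF G] quad_form_eigen[OF X(1) G] by simp
    then show ?thesis using sq_norm_pos[OF G udiag_unit_nonzero[OF V i]] by simp
  qed
  define Z where "Z = U\<^sup>\<dagger> * V"
  have Z: "Z \<in> sq n" using U' V' by (simp add: Z_def)
  have "U * mat_diag n (\<lambda>i. complex_of_real (y i)) * U\<^sup>\<dagger> = V * mat_diag n (\<lambda>i. complex_of_real (z i)) * V\<^sup>\<dagger>"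
    using Xy Xz by (simp add: udiag_def)
  then have "U\<^sup>\<dagger> * (U * mat_diag n (\<lambda>i. complex_of_real (y i)) * U\<^sup>\<dagger>) * V
      = U\<^sup>\<dagger> * (V * mat_diag n (\<lambda>i. complex_of_real (z i)) * V\<^sup>\<dagger>) * V" by simp
  then have eq: "mat_diag n (\<lambda>i. complex_of_real (y i)) * Z = Z * mat_diag n (\<lambda>i. complex_of_real (z i))"
    using U' V' by (simp add: Z_def sq_algebra[of _ n] unitary_cancel[OF U])
  have ent: "complex_of_real (y i) * Z $$ (i, j) = Z $$ (i, j) * complex_of_real (z j)"
    if "i < n" "j < n" for i j
  proof -
    have "(mat_diag n (\<lambda>i. complex_of_real (y i)) * Z) $$ (i, j) = (Z * mat_diag n (\<lambda>i. complex_of_real (z i))) $$ (i, j)"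
      by (simp only: eq)
    then show ?thesis using that by (simp add: mat_diag_mult_left[OF Z] mat_diag_mult_right[OF Z])
  qed
  have Z0: "Z $$ (i, j) = 0" if "i \<in> S" "j \<in> T" for i j
  proof -
    have ij: "i < n" "j < n" using that ES FT by auto
    have "y i < z j" using y z that \<open>a < b\<close> by fastforce
    then show ?thesis using ent[OF ij] by auto
  qed
  have ZT: "Z * mat_diag n (\<lambda>i. of_bool (i \<in> T)) \<in> sq n" using Z by simp
  have "mat_diag n (\<lambda>i. of_bool (i \<in> S)) * (Z * mat_diag n (\<lambda>i. of_bool (i \<in> T))) = 0\<^sub>m n n"
    unfolding mat_diag_mult_left[OF ZT]
    by (rule eq_matI) (use Z Z0 in \<open>auto simp: mat_diag_mult_right[OF Z]\<close>)
  then have "U * (mat_diag n (\<lambda>i. of_bool (i \<in> S)) * (Z * mat_diag n (\<lambda>i. of_bool (i \<in> T)))) * V\<^sup>\<dagger>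
     = U * 0\<^sub>m n n * V\<^sup>\<dagger>" by simp
  moreover have "U * 0\<^sub>m n n * V\<^sup>\<dagger> = 0\<^sub>m n n" using U' V' by (simp add: sq_algebra[of _ n])
  ultimately show ?thesis
    using U' V' by (simp add: ES FT udiag_def Z_def sq_algebra[of _ n])
qed

end

section \<open>A pencil dominated by finitely many projections commutes\<close>

definition noncommuting_projection :: "nat \<Rightarrow> complex mat \<Rightarrow> complex mat \<Rightarrow> complex mat \<Rightarrow> bool" where
  "noncommuting_projection n S T R \<longleftrightarrow>
     projection n R \<and> R * S = S * R \<and> R * T = T * R \<and> R * (S * T) \<noteq> R * (T * S)"

text \<open>
  Minimality makes the range irreducible: if it split into two joint invariant subspaces, S and T
  would fail to commute on one of them.
\<close>
definition irreducible_projection :: "nat \<Rightarrow> complex mat \<Rightarrow> complex mat \<Rightarrow> complex mat \<Rightarrow> bool" where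
  "irreducible_projection n S T R \<longleftrightarrow> noncommuting_projection n S T R \<and>
     (\<forall>Q. noncommuting_projection n S T Q \<longrightarrow> Q * R = Q \<longrightarrow> Q = R)"

definition pencil :: "complex mat \<Rightarrow> complex mat \<Rightarrow> complex \<Rightarrow> complex mat" where
  "pencil S T z = complex_of_real (Re z) \<cdot>\<^sub>m S + complex_of_real (Im z) \<cdot>\<^sub>m T"

text \<open>
  The sets with the same label as i and the sets with other labels form two disjoint closed parts.
\<close>
lemma connected_finite_closed_cover_const:
  fixes T :: "'i \<Rightarrow> 'a::topological_space set"
  assumes S: "connected S" and I: "finite I" and T: "\<And>i. i \<in> I \<Longrightarrow> closed (T i)"
    and cover: "S \<subseteq> (\<Union>i\<in>I. T i)"
    and f: "\<And>i j x. \<lbrakk>i \<in> I; j \<in> I; x \<in> S; x \<in> T i; x \<in> T j\<rbrakk> \<Longrightarrow> f i = f j"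
    and ij: "i \<in> I" "j \<in> I" "x \<in> S" "x \<in> T i" "y \<in> S" "y \<in> T j"
  shows "f i = f j"
proof (rule ccontr)
  assume ne: "f i \<noteq> f j"
  define A where "A = (\<Union>l\<in>{l\<in>I. f l = f i}. T l)"
  define B where "B = (\<Union>l\<in>{l\<in>I. f l \<noteq> f i}. T l)"
  have "closed A" "closed B" unfolding A_def B_def using I T by (auto intro!: closed_UN)
  moreover have "S \<subseteq> A \<union> B" using cover by (auto simp: A_def B_def)
  moreover have "x \<notin> B" if x: "x \<in> A" "x \<in> S" for x
  proof
    assume "x \<in> B"
    then obtain l where l: "l \<in> I" "f l \<noteq> f i" "x \<in> T l" by (auto simp: B_def)
    obtain k where k: "k \<in> I" "f k = f i" "x \<in> T k" using x by (auto simp: A_def)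
    show False using f[OF k(1) l(1) x(2) k(3) l(3)] k(2) l(2) by simp
  qed
  then have "A \<inter> B \<inter> S = {}" by blast
  moreover have "x \<in> A" using ij by (auto simp: A_def)
  moreover have "y \<in> B" using ij ne unfolding B_def by (intro UN_I[of j]) auto
  ultimately show False using S ij(3,5) unfolding connected_closed by blast
qed

context
  fixes n :: nat
begin

lemma pencil_carrier [simp]: "S \<in> sq n \<Longrightarrow> T \<in> sq n \<Longrightarrow> pencil S T z \<in> sq n"
  by (simp add: pencil_def)

lemma pencil_hermitian:
  assumes "S \<in> sq n" "T \<in> sq n" "hermitian_mat S" "hermitian_mat T"
  shows "hermitian_mat (pencil S T z)"
  using assms by (simp add: pencil_def hermitian_mat_def adj_add[of _ n n] adj_smult)

lemma pencil_uminus: "S \<in> sq n \<Longrightarrow> T \<in> sq n \<Longrightarrow> pencil S T (- z) = (-1) \<cdot>\<^sub>m pencil S T z"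
  by (rule eq_matI) (auto simp: pencil_def)

lemma pencil_commute:
  assumes "S \<in> sq n" "T \<in> sq n" "P \<in> sq n" "P * S = S * P" "P * T = T * P"
  shows "pencil S T z * P = P * pencil S T z"
  using assms by (simp add: pencil_def sq_algebra[of _ n])

lemma quad_form_pencil:
  assumes "S \<in> sq n" "T \<in> sq n" "u \<in> sq n"
  shows "quad_form (pencil S T z) u = Re z * quad_form S u + Im z * quad_form T u"
  using assms by (simp add: quad_form_def pencil_def sq_algebra[of _ n] trace_add[of _ n] trace_smult[of _ n])

lemma closed_dominates_pencil:
  assumes "S \<in> sq n" "T \<in> sq n"
  shows "closed {z. dominates n P (pencil S T z)}"
proof -
  define D where "D = {(u, w). u \<in> sq n \<and> w \<in> sq n \<and> P * u = u \<and> P * w = 0\<^sub>m n n}"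
  have "{z. dominates n P (pencil S T z)} = (\<Inter>p\<in>D. {z.
      (Re z * quad_form S (snd p) + Im z * quad_form T (snd p)) * sq_norm (fst p)
      \<le> (Re z * quad_form S (fst p) + Im z * quad_form T (fst p)) * sq_norm (snd p)})"
    using assms by (auto simp: dominates_def D_def quad_form_pencil)
  also have "closed \<dots>"
    by (intro closed_INT ballI closed_Collect_le continuous_intros)
  finally show ?thesis .
qed

lemma projection_mult:
  assumes "projection n P" "projection n Q" "P * Q = Q * P"
  shows "projection n (P * Q)"
proof -
  note P = projectionD[OF assms(1)] and Q = projectionD[OF assms(2)]
  have "P * Q * (P * Q) = P * (Q * P) * Q" using P Q by (simp add: sq_algebra[of _ n])
  also have "\<dots> = P * P * (Q * Q)" using P(1) Q(1) by (simp add: sq_algebra[of _ n] flip: assms(3))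
  finally show ?thesis using P Q assms(3) by (simp add: projection_def sq_adj_mult[of _ n])
qed

lemma projection_minus:
  assumes "projection n P" "projection n Q" "P * Q = Q"
  shows "projection n (P - Q)"
proof -
  note P = projectionD[OF assms(1)] and Q = projectionD[OF assms(2)]
  have "(P * Q)\<^sup>\<dagger> = Q\<^sup>\<dagger>" by (simp only: assms(3))
  then have QP: "Q * P = Q" using P Q by (simp add: sq_adj_mult[of _ n])
  have "(P - Q) * (P - Q) = P - Q - (Q - Q)"
    using P Q by (simp add: sq_algebra[of _ n] assms(3) QP)
  also have "\<dots> = P - Q" using P(1) Q(1) by (intro eq_matI) auto
  finally show ?thesis using P Q by (simp add: projection_def adj_minus[of _ n n])
qed

lemma subprojection_trace_eq:
  assumes "projection n P" "projection n Q" "P * Q = Q" "mat_trace P = mat_trace Q"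
  shows "P = Q"
  using projection_trace_zero[OF projection_minus[OF assms(1-3)]] assms(4)
    projectionD[OF assms(1)] projectionD[OF assms(2)]
  by (simp add: trace_minus[of _ n] minus_eq_zero_iff[of _ n n])

text \<open>
  A noncommuting projection of least trace is minimal, since traces of projections are natural
  numbers and the trace is strict on subprojections.
\<close>
lemma exists_irreducible_projection:
  assumes ST: "S \<in> sq n" "T \<in> sq n" and ne: "S * T \<noteq> T * S"
  shows "\<exists>R. irreducible_projection n S T R"
proof -
  let ?N = "noncommuting_projection n S T"
  define r where "r R = (THE k. mat_trace R = (of_nat k :: complex))" for R :: "complex mat"
  have r: "mat_trace R = of_nat (r R)" if "?N R" for R
  proof -
    from that have "projection n R" by (simp add: noncommuting_projection_def)
    then obtain k where "mat_trace R = of_nat k" using projection_trace_nat by blast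
    then show ?thesis by (simp add: r_def)
  qed
  have "?N (1\<^sub>m n)"
    using ST ne by (simp add: noncommuting_projection_def projection_def sq_algebra[of _ n])
  then obtain R where R: "?N R" and min: "\<And>Q. ?N Q \<Longrightarrow> r R \<le> r Q"
    using ex_has_least_nat[of ?N _ r] by blast
  have "Q = R" if Q: "?N Q" and QR: "Q * R = Q" for Q
  proof -
    have p: "projection n R" "projection n Q" using R Q by (simp_all add: noncommuting_projection_def)
    note R' = projectionD[OF p(1)] and Q' = projectionD[OF p(2)]
    have "(Q * R)\<^sup>\<dagger> = Q\<^sup>\<dagger>" by (simp only: QR)
    then have RQ: "R * Q = Q" using R' Q' by (simp add: sq_adj_mult[of _ n])
    obtain k where "mat_trace (R - Q) = of_nat k"
      using projection_trace_nat[OF projection_minus[OF p RQ]] by blast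
    then have "of_nat (r R) - of_nat (r Q) = (of_nat k :: complex)"
      using R' Q' by (simp add: trace_minus[of _ n] r[OF R] r[OF Q])
    then have "of_nat (r R) = (of_nat (r Q + k) :: complex)" by (simp add: algebra_simps)
    then have "r R = r Q + k" by (simp only: of_nat_eq_iff)
    then have "r R = r Q" using min[OF Q] by simp
    then show ?thesis using subprojection_trace_eq[OF p RQ] r[OF R] r[OF Q] by simp
  qed
  then show ?thesis using R unfolding irreducible_projection_def by blast
qed

context
  fixes S T R :: "complex mat"
  assumes S: "S \<in> carrier_mat n n" "hermitian_mat S"
    and T: "T \<in> carrier_mat n n" "hermitian_mat T"
    and irr: "irreducible_projection n S T R"
begin

lemma irreducibleD:
  "R \<in> sq n" "R\<^sup>\<dagger> = R" "R * R = R" "projection n R" "R * S = S * R" "R * T = T * R"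
  "R * (S * T) \<noteq> R * (T * S)"
  using irr by (auto simp: irreducible_projection_def noncommuting_projection_def projection_def)

text \<open>Schur's lemma: a spectral projection of the compression would split the irreducible
  projection otherwise.\<close>
lemma irreducible_compression_scalar:
  assumes P: "P \<in> sq n" "P\<^sup>\<dagger> = P" "P * S = S * P" "P * T = T * P"
  shows "\<exists>c. R * P * R = c \<cdot>\<^sub>m R"
proof -
  note R = irreducibleD
  define H where "H = R * P * R"
  have H: "H \<in> sq n" "hermitian_mat H"
    using P R by (simp_all add: H_def hermitian_mat_def sq_adj_mult[of _ n] sq_algebra[of _ n])
  have comm: "H * Y = Y * H" if Y: "Y \<in> sq n" "R * Y = Y * R" "P * Y = Y * P" for Y
  proof -
    have "H * Y = R * P * (R * Y)" using P R Y by (simp add: H_def sq_algebra[of _ n])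
    also have "\<dots> = R * (P * Y) * R" unfolding Y(2) using P(1) R(1) Y(1) by (simp add: sq_algebra[of _ n])
    also have "\<dots> = (R * Y) * P * R" unfolding Y(3) using P(1) R(1) Y(1) by (simp add: sq_algebra[of _ n])
    also have "\<dots> = Y * H" unfolding Y(2) using P(1) R(1) Y(1) by (simp add: H_def sq_algebra[of _ n])
    finally show ?thesis .
  qed
  have HR: "H * R = H" "R * H = H"
    using P(1) R(1) by (simp add: H_def sq_algebra[of _ n] R(3),
        simp add: H_def sq_assoc[of R n R, symmetric] R(3) sq_algebra[of _ n])
  obtain V h where V: "unitary_mat n V" and Hh: "H = udiag n V (\<lambda>i. complex_of_real (h i))"
    using hermitian_diagonalization[OF H] by blast
  note V' = unitaryD[OF V]
  have "R \<noteq> 0\<^sub>m n n" using R(1,7) S(1) T(1) by (auto simp: sq_algebra[of _ n])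
  from spectral_component_nonzero[OF V R(1) this, of "\<lambda>i. complex_of_real (h i)"]
  obtain i where i: "udiag n V (\<lambda>j. if complex_of_real (h j) = of_real (h i) then 1 else 0) * R \<noteq> 0\<^sub>m n n"
    by blast
  define E where "E = udiag n V (\<lambda>j. if complex_of_real (h j) = of_real (h i) then 1 else 0)"
  have E: "projection n E"
    unfolding projection_def E_def using V' by (auto simp: udiag_adj udiag_mult[OF V] intro!: udiag_cong)
  note E' = projectionD[OF E]
  have Ecomm: "Y * E = E * Y" if Y: "Y \<in> sq n" "H * Y = Y * H" for Y
    unfolding E_def by (rule udiag_commute[OF V Y(1)]) (use Y in \<open>simp flip: Hh\<close>)
  have ER: "E * R = R * E" using Ecomm[OF R(1)] HR by simp
  have ES: "E * S = S * E" using Ecomm[OF S(1)] comm[OF S(1) R(5) P(3)] by simp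
  have ET: "E * T = T * E" using Ecomm[OF T(1)] comm[OF T(1) R(6) P(4)] by simp
  have split: "projection n (F * R) \<and> F * R * S = S * (F * R) \<and> F * R * T = T * (F * R) \<and> F * R * R = F * R"
    if F: "projection n F" "F * R = R * F" "F * S = S * F" "F * T = T * F" for F
    using projection_mult[OF F(1) R(4) F(2)] sq_commuteI[OF projectionD(1)[OF F(1)] R(1) S(1) F(3) R(5)]
      sq_commuteI[OF projectionD(1)[OF F(1)] R(1) T(1) F(4) R(6)] projectionD(1)[OF F(1)] R(1)
    by (simp add: sq_algebra[of _ n] R(3))
  have eqR: "F * R = R"
    if F: "projection n F" "F * R = R * F" "F * S = S * F" "F * T = T * F"
      "F * R * (S * T) \<noteq> F * R * (T * S)" for F
    using split[OF F(1-4)] F(5) irr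
    by (auto simp: irreducible_projection_def noncommuting_projection_def)
  let ?E' = "1\<^sub>m n - E"
  have "E * R = R"
  proof (rule ccontr)
    assume ne: "E * R \<noteq> R"
    have 1: "E * R * (S * T) = E * R * (T * S)" using eqR[OF E ER ES ET] ne by blast
    have "?E' * R = R"
    proof (rule eqR)
      show "projection n ?E'" by (rule projection_compl[OF E])
      show "?E' * R = R * ?E'" "?E' * S = S * ?E'" "?E' * T = T * ?E'"
        using E' R(1) S T ER ES ET by (simp_all add: sq_algebra[of _ n])
      show "?E' * R * (S * T) \<noteq> ?E' * R * (T * S)"
      proof
        assume "?E' * R * (S * T) = ?E' * R * (T * S)"
        then have "?E' * R * (S * T) + E * R * (S * T) = ?E' * R * (T * S) + E * R * (T * S)"
          using 1 by simp
        moreover have "?E' * R * Y + E * R * Y = R * Y" if Y: "Y \<in> sq n" for Y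
        proof -
          have "?E' * R * Y + E * R * Y = R * Y - E * R * Y + E * R * Y"
            using E' R(1) Y by (simp add: sq_algebra[of _ n])
          also have "\<dots> = R * Y" using E'(1) R(1) Y by (intro eq_matI) (auto simp del: index_mult_mat(1))
          finally show ?thesis .
        qed
        ultimately show False using R(7) S(1) T(1) by simp
      qed
    qed
    then have "E * R = 0\<^sub>m n n" using compl_fix_iff[OF E'(1) R(1)] by blast
    then show False using i by (simp add: E_def)
  qed
  have HE: "H * E = complex_of_real (h i) \<cdot>\<^sub>m E"
    unfolding Hh E_def udiag_mult[OF V] udiag_smult[OF V'(1)] by (rule udiag_cong) auto
  have "H = H * (E * R)" using HR \<open>E * R = R\<close> by simp
  also have "\<dots> = complex_of_real (h i) \<cdot>\<^sub>m (E * R)"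
    using sq_assoc[OF H(1) E'(1) R(1)] E'(1) R(1) by (simp add: HE sq_algebra[of _ n])
  finally show ?thesis using \<open>E * R = R\<close> unfolding H_def by auto
qed

text \<open>
  If xS + yT is scalar on the range of R and x is nonzero, then on this range S is a combination of T
  and the identity and commutes with T; likewise with the roles of S and T exchanged.
\<close>
lemma pencil_scalar_contradiction:
  assumes z: "z \<noteq> 0" and eq: "pencil S T z * R = c \<cdot>\<^sub>m R"
  shows False
proof -
  note R = irreducibleD
  have gen: "R * (A * B) = R * (B * A)"
    if A: "A \<in> sq n" "R * A = A * R" and B: "B \<in> sq n" "R * B = B * R" and a: "a \<noteq> 0"
      and eq: "(a \<cdot>\<^sub>m A + b \<cdot>\<^sub>m B) * R = c \<cdot>\<^sub>m R" for A B and a b :: complex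
  proof (rule smult_left_cancel[of a])
    have 1: "a \<cdot>\<^sub>m (A * R) = c \<cdot>\<^sub>m R - b \<cdot>\<^sub>m (B * R)"
    proof (rule eq_matI)
      fix i j assume "i < dim_row (c \<cdot>\<^sub>m R - b \<cdot>\<^sub>m (B * R))" "j < dim_col (c \<cdot>\<^sub>m R - b \<cdot>\<^sub>m (B * R))"
      then have ij: "i < n" "j < n" using R(1) B(1) by auto
      have "a \<cdot>\<^sub>m (A * R) + b \<cdot>\<^sub>m (B * R) = c \<cdot>\<^sub>m R" using eq A(1) B(1) R(1) by (simp add: sq_algebra[of _ n])
      then have "(a \<cdot>\<^sub>m (A * R) + b \<cdot>\<^sub>m (B * R)) $$ (i, j) = (c \<cdot>\<^sub>m R) $$ (i, j)" by simp
      then show "(a \<cdot>\<^sub>m (A * R)) $$ (i, j) = (c \<cdot>\<^sub>m R - b \<cdot>\<^sub>m (B * R)) $$ (i, j)"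
        using ij A(1) B(1) R(1) by (simp add: algebra_simps del: index_mult_mat(1))
    qed (use A(1) B(1) R(1) in auto)
    have "a \<cdot>\<^sub>m (R * (A * B)) = a \<cdot>\<^sub>m (A * R) * B"
      using sq_assoc[OF R(1) A(1) B(1)] A(1) B(1) R(1) A(2) by (simp add: sq_algebra[of _ n])
    also have "\<dots> = c \<cdot>\<^sub>m (B * R) - b \<cdot>\<^sub>m (B * (B * R))"
      unfolding 1 using A(1) B(1) R(1) by (simp add: sq_algebra[of _ n] B(2))
    also have "\<dots> = B * (a \<cdot>\<^sub>m (A * R))"
      unfolding 1 using A(1) B(1) R(1) by (simp add: sq_algebra[of _ n])
    also have "\<dots> = a \<cdot>\<^sub>m (R * (B * A))"
      using sq_assoc[OF R(1) B(1) A(1)] A(1) B(1) R(1) by (simp add: sq_algebra[of _ n] A(2) B(2))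
    finally show "a \<cdot>\<^sub>m (R * (A * B)) = a \<cdot>\<^sub>m (R * (B * A))" .
  qed (use a A(1) B(1) R(1) in auto)
  from z have "Re z \<noteq> 0 \<or> Im z \<noteq> 0" by (simp add: complex_eq_iff)
  then have "R * (S * T) = R * (T * S)"
  proof
    assume "Re z \<noteq> 0"
    then show ?thesis
      using gen[OF S(1) R(5) T(1) R(6), of "of_real (Re z)" "of_real (Im z)"] eq by (simp add: pencil_def)
  next
    assume "Im z \<noteq> 0"
    moreover have "pencil S T z = complex_of_real (Im z) \<cdot>\<^sub>m T + complex_of_real (Re z) \<cdot>\<^sub>m S"
      unfolding pencil_def using S(1) T(1) by (intro comm_add_mat[of _ n n]) auto
    ultimately show ?thesis
      using gen[OF T(1) R(6) S(1) R(5), of "of_real (Im z)" "of_real (Re z)"] eq by simp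
  qed
  with R(7) show False by simp
qed

lemma pencil_two_eigenvalues:
  assumes z: "z \<noteq> 0"
  obtains a b u w where "a < b"
    "u \<in> sq n" "u \<noteq> 0\<^sub>m n n" "R * u = u" "pencil S T z * u = complex_of_real b \<cdot>\<^sub>m u"
    "w \<in> sq n" "w \<noteq> 0\<^sub>m n n" "R * w = w" "pencil S T z * w = complex_of_real a \<cdot>\<^sub>m w"
    "Re (mat_trace R) \<ge> 2"
proof -
  note R = irreducibleD
  let ?X = "pencil S T z"
  have X: "?X \<in> sq n" "hermitian_mat ?X" using S T by (auto intro: pencil_hermitian)
  obtain V y I where V: "unitary_mat n V" and Xy: "?X = udiag n V (\<lambda>i. complex_of_real (y i))"
    and RI: "R = udiag n V (\<lambda>i. of_bool (i \<in> I))" "I \<subseteq> {..<n}"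
    using projection_pair_frame[OF X R(4) pencil_commute[OF S(1) T(1) R(1,5,6)]] .
  note V' = unitaryD[OF V]
  have "\<exists>i\<in>I. \<exists>j\<in>I. y i < y j"
  proof (rule ccontr)
    assume neg: "\<not> ?thesis"
    obtain c where c: "\<And>i. i \<in> I \<Longrightarrow> y i = c"
    proof (cases "I = {}")
      case False
      then obtain j where j: "j \<in> I" by blast
      have "y i = y j" if "i \<in> I" for i
        using neg that j by (meson linorder_neqE_linordered_idom)
      then show ?thesis by (rule that)
    qed (use that in auto)
    have "?X * R = complex_of_real c \<cdot>\<^sub>m R"
      unfolding Xy RI udiag_mult[OF V] udiag_smult[OF V'(1)] by (rule udiag_cong) (auto simp: c)
    then show False by (rule pencil_scalar_contradiction[OF z])
  qed
  then obtain i j where ij: "i \<in> I" "j \<in> I" "y i < y j" by blast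
  define G where "G k = udiag n V (\<lambda>j. of_bool (j = k))" for k
  have fixG: "R * G k = G k" if "k \<in> I" for k
    unfolding RI G_def udiag_mult_unit[OF V] using that V' by (intro eq_matI) auto
  have XG: "?X * G k = complex_of_real (y k) \<cdot>\<^sub>m G k" for k
    unfolding Xy G_def by (rule udiag_mult_unit[OF V])
  have G: "G k \<in> sq n" for k using V' by (simp add: G_def)
  have Gnz: "G k \<noteq> 0\<^sub>m n n" if "k \<in> I" for k
    unfolding G_def using that RI(2) by (intro udiag_unit_nonzero[OF V]) auto
  have fin: "finite I" using RI(2) finite_subset by blast
  have "mat_trace R = (\<Sum>i<n. of_bool (i \<in> I))" unfolding RI by (rule trace_udiag[OF V])
  also have "\<dots> = of_nat (card I)" using RI(2) fin by (simp add: Int_absorb1)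
  finally have "Re (mat_trace R) = card I" by simp
  moreover have "card {i, j} \<le> card I" using ij fin by (intro card_mono) auto
  moreover have "i \<noteq> j" using ij(3) by auto
  ultimately have "Re (mat_trace R) \<ge> 2" by simp
  then show ?thesis
    using that[OF ij(3) G Gnz[OF ij(2)] fixG[OF ij(2)] XG G Gnz[OF ij(1)] fixG[OF ij(1)] XG] by blast
qed

text \<open>
  Since R P R = c R, for c different from 0 and 1 both P and 1 - P would map eigenvectors in the
  range of R to nonzero eigenvectors for the same eigenvalue. Every eigenvalue of the pencil on this
  range would then occur on both sides of the cut, which is impossible for two different ones.
\<close>
lemma dominating_projection_dichotomy:
  assumes z: "z \<noteq> 0" and P: "projection n P" "P * S = S * P" "P * T = T * P"
    and dom: "dominates n P (pencil S T z)"
  shows "P * R = R \<or> P * R = 0\<^sub>m n n"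
proof -
  note R = irreducibleD and P' = projectionD[OF P(1)]
  let ?X = "pencil S T z"
  have X: "?X \<in> sq n" using S T by simp
  have XP: "?X * P = P * ?X" by (rule pencil_commute[OF S(1) T(1) P'(1) P(2,3)])
  obtain c where c: "R * P * R = c \<cdot>\<^sub>m R"
    using irreducible_compression_scalar[OF P'(1,2) P(2,3)] by blast
  have zeroI: "Q * R = 0\<^sub>m n n" if Q: "projection n Q" "R * Q * R = 0\<^sub>m n n" for Q
  proof -
    note Q' = projectionD[OF Q(1)]
    have "Q * (Q * R) = Q * R" using sq_assoc[OF Q'(1) Q'(1) R(1)] Q'(3) by simp
    then have "(Q * R)\<^sup>\<dagger> * (Q * R) = R * Q * R"
      using Q'(1,2) R(1,2) by (simp add: sq_adj_mult[of _ n] sq_algebra[of _ n])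
    also have "\<dots> = 0\<^sub>m n n" using Q Q' by simp
    finally have "mat_trace ((Q * R)\<^sup>\<dagger> * (Q * R)) = 0" by (simp add: mat_trace_def)
    then show ?thesis using trace_adj_self_pos[of "Q * R" n] Q' R(1) by force
  qed
  consider "c = 0" | "c = 1" | "c \<noteq> 0" "c \<noteq> 1" by blast
  then show ?thesis
  proof cases
    case 1
    have "R * P * R = 0\<^sub>m n n" unfolding c 1 using R(1) by (intro eq_matI) auto
    then show ?thesis using zeroI[OF P(1)] by blast
  next
    case 2
    have "R * (1\<^sub>m n - P) * R = R - R * P * R" using P' R(1,3) by (simp add: sq_algebra[of _ n])
    also have "\<dots> = 0\<^sub>m n n" unfolding c 2 using R(1) by (intro eq_matI) auto
    finally show ?thesis
      using zeroI[OF projection_compl(1)[OF P(1)]] compl_fix_iff[OF P'(1) R(1)] by blast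
  next
    case 3
    obtain a b u w where "a < b"
      and u: "u \<in> sq n" "u \<noteq> 0\<^sub>m n n" "R * u = u" "?X * u = complex_of_real b \<cdot>\<^sub>m u"
      and w: "w \<in> sq n" "w \<noteq> 0\<^sub>m n n" "R * w = w" "?X * w = complex_of_real a \<cdot>\<^sub>m w"
      using pencil_two_eigenvalues[OF z] .
    have comp: "R * (P * v) = c \<cdot>\<^sub>m v" if v: "v \<in> sq n" "R * v = v" for v
    proof -
      have "R * (P * v) = R * P * (R * v)" using P'(1) R(1) v by (simp add: sq_algebra[of _ n])
      also have "\<dots> = R * P * R * v" using P'(1) R(1) v(1) by (simp add: sq_algebra[of _ n])
      finally show ?thesis unfolding c using R(1) v by (simp add: sq_algebra[of _ n])
    qed
    have Pw: "P * w \<noteq> 0\<^sub>m n n"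
    proof
      assume "P * w = 0\<^sub>m n n"
      then have "R * (P * w) = c \<cdot>\<^sub>m 0\<^sub>m n n" using R(1) by (simp add: sq_algebra[of _ n])
      then have "c \<cdot>\<^sub>m w = c \<cdot>\<^sub>m 0\<^sub>m n n" unfolding comp[OF w(1,3)] .
      then show False using smult_left_cancel[OF _ 3(1) w(1)] w(2) by simp
    qed
    have Pu: "(1\<^sub>m n - P) * u \<noteq> 0\<^sub>m n n"
    proof
      assume "(1\<^sub>m n - P) * u = 0\<^sub>m n n"
      then have "P * u = u" using compl_fix_iff[OF P'(1) u(1)] by blast
      then have "u = c \<cdot>\<^sub>m u" using comp[OF u(1,3)] u(3) by simp
      then have "(1 - c) \<cdot>\<^sub>m u = (1 - c) \<cdot>\<^sub>m 0\<^sub>m n n"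
      proof (intro eq_matI)
        fix i j assume eq: "u = c \<cdot>\<^sub>m u" and "i < dim_row ((1 - c) \<cdot>\<^sub>m 0\<^sub>m n n)" "j < dim_col ((1 - c) \<cdot>\<^sub>m 0\<^sub>m n n)"
        then have "i < n" "j < n" by auto
        moreover have "u $$ (i, j) = (c \<cdot>\<^sub>m u) $$ (i, j)" using eq by (rule arg_cong)
        ultimately show "((1 - c) \<cdot>\<^sub>m u) $$ (i, j) = ((1 - c) \<cdot>\<^sub>m 0\<^sub>m n n) $$ (i, j)"
          using u(1) by (simp add: algebra_simps)
      qed (use u(1) in auto)
      then show False using smult_left_cancel[of "1 - c" u "0\<^sub>m n n" n n] 3(2) u(1,2) by simp
    qed
    have "b \<le> a"
    proof (rule dominates_eigen[OF dom X])
      show "P * (P * w) = P * w"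
        using sq_assoc[OF P'(1) P'(1) w(1)] P'(3) by simp
      have "?X * (P * w) = P * (?X * w)"
        using sq_assoc[OF X P'(1) w(1)] sq_assoc[OF P'(1) X w(1)] XP by simp
      then show "?X * (P * w) = complex_of_real a \<cdot>\<^sub>m (P * w)"
        using P'(1) w(1) by (simp add: w(4) sq_algebra[of _ n])
      show "P * ((1\<^sub>m n - P) * u) = 0\<^sub>m n n"
        using sq_assoc[of P n "1\<^sub>m n - P" u] projection_compl(2)[OF P(1)] P'(1) u(1) by (simp add: sq_algebra[of _ n])
      have XQ: "?X * (1\<^sub>m n - P) = (1\<^sub>m n - P) * ?X" using XP X P'(1) by (simp add: sq_algebra[of _ n])
      have "?X * ((1\<^sub>m n - P) * u) = (1\<^sub>m n - P) * (?X * u)"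
        using sq_assoc[of ?X n "1\<^sub>m n - P" u] sq_assoc[of "1\<^sub>m n - P" n ?X u] XQ X P'(1) u(1) by simp
      then show "?X * ((1\<^sub>m n - P) * u) = complex_of_real b \<cdot>\<^sub>m ((1\<^sub>m n - P) * u)"
        using P'(1) u(1) by (simp add: u(4) sq_smult_mult[of _ n])
    qed (use P'(1) u(1) w(1) Pw Pu in auto)
    with \<open>a < b\<close> show ?thesis by simp
  qed
qed

text \<open>
  Let a < b be eigenvalues of the pencil at z on the range of R. This range lies above both cuts, so
  the pencil is at most a on the kernel of P. At -z the same argument gives at most -b on the kernel
  of Q, that is, at least b at z.
\<close>
lemma opposite_kernels_orthogonal:
  assumes z: "z \<noteq> 0" and P: "projection n P" "P * S = S * P" "P * T = T * P"
    and Q: "projection n Q" "Q * S = S * Q" "Q * T = T * Q"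
    and domP: "dominates n P (pencil S T z)" and domQ: "dominates n Q (pencil S T (- z))"
    and PR: "P * R = R" and QR: "Q * R = R"
  shows "(1\<^sub>m n - P) * (1\<^sub>m n - Q) = 0\<^sub>m n n"
proof -
  note R = irreducibleD and P' = projectionD[OF P(1)] and Q' = projectionD[OF Q(1)]
  let ?X = "pencil S T z"
  have X: "?X \<in> sq n" "hermitian_mat ?X" using S T by (auto intro: pencil_hermitian)
  obtain a b u w where ab: "a < b"
    and u: "u \<in> sq n" "u \<noteq> 0\<^sub>m n n" "R * u = u" "?X * u = complex_of_real b \<cdot>\<^sub>m u"
    and w: "w \<in> sq n" "w \<noteq> 0\<^sub>m n n" "R * w = w" "?X * w = complex_of_real a \<cdot>\<^sub>m w"
    using pencil_two_eigenvalues[OF z] .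
  have Pw: "P * w = w" using sq_assoc[OF P'(1) R(1) w(1)] PR w(3) by simp
  have Qu: "Q * u = u" using sq_assoc[OF Q'(1) R(1) u(1)] QR u(3) by simp
  have Xu: "pencil S T (- z) * u = complex_of_real (- b) \<cdot>\<^sub>m u"
  proof -
    have "pencil S T (- z) * u = (-1) \<cdot>\<^sub>m (?X * u)"
      using X(1) u(1) by (simp add: pencil_uminus[OF S(1) T(1)] sq_smult_mult[of _ n])
    also have "\<dots> = complex_of_real (- b) \<cdot>\<^sub>m u" unfolding u(4) by (rule eq_matI) auto
    finally show ?thesis .
  qed
  have X': "pencil S T (- z) \<in> sq n" using S T by simp
  show ?thesis
  proof (rule separated_projections_orthogonal[OF X])
    show "projection n (1\<^sub>m n - P)" "projection n (1\<^sub>m n - Q)"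
      using projection_compl P Q by auto
    show "?X * (1\<^sub>m n - P) = (1\<^sub>m n - P) * ?X" "?X * (1\<^sub>m n - Q) = (1\<^sub>m n - Q) * ?X"
      using X P'(1) Q'(1) pencil_commute[OF S(1) T(1) P'(1) P(2,3)] pencil_commute[OF S(1) T(1) Q'(1) Q(2,3)]
      by (simp_all add: sq_algebra[of _ n])
    show "quad_form ?X v \<le> a * sq_norm v" if "v \<in> sq n" "(1\<^sub>m n - P) * v = v" for v
      using dominates_upper[OF domP X(1) w(1) Pw w(2,4) that(1)] that compl_fix_iff[OF P'(1)] by blast
    show "b * sq_norm v \<le> quad_form ?X v" if "v \<in> sq n" "(1\<^sub>m n - Q) * v = v" for v
    proof -
      have "quad_form (pencil S T (- z)) v \<le> - b * sq_norm v"
        using dominates_upper[OF domQ X' u(1) Qu u(2) Xu that(1)] that compl_fix_iff[OF Q'(1)] by blast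
      then show ?thesis using that(1) X(1) by (simp add: pencil_uminus[OF S(1) T(1)] quad_form_uminus)
    qed
  qed (rule ab)
qed

text \<open>
  The ranges of R and of 1 - P_z, 1 - P_{-z} are mutually orthogonal, of total dimension at most n.
  As rank R \<ge> 2, the bound on k forces equality, which is the equation P_z + P_{-z} = 1 + R below.
  Hence P_z is determined by any P_{-z}, so it is locally constant and P_1 = P_{-1}; but then
  1 - P_1 is orthogonal to itself, contrary to k < n.
\<close>
lemma not_always_above_cut:
  assumes I: "finite I" and P: "\<And>i. i \<in> I \<Longrightarrow> projection n (P i)"
    "\<And>i. i \<in> I \<Longrightarrow> P i * S = S * P i" "\<And>i. i \<in> I \<Longrightarrow> P i * T = T * P i"
    "\<And>i. i \<in> I \<Longrightarrow> mat_trace (P i) = of_nat k"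
    and cover: "\<And>z. z \<noteq> 0 \<Longrightarrow> \<exists>i\<in>I. dominates n (P i) (pencil S T z)"
    and above: "\<And>i z. i \<in> I \<Longrightarrow> z \<noteq> 0 \<Longrightarrow> dominates n (P i) (pencil S T z) \<Longrightarrow> P i * R = R"
    and k: "k < n" "2 * k \<le> n + 2"
  shows False
proof -
  note R = irreducibleD
  have sum: "P i + P j = 1\<^sub>m n + R"
    if z: "z \<noteq> 0" and ij: "i \<in> I" "j \<in> I"
      and dom: "dominates n (P i) (pencil S T z)" "dominates n (P j) (pencil S T (- z))" for i j z
  proof -
    note Pi = projectionD[OF P(1)[OF ij(1)]] and Pj = projectionD[OF P(1)[OF ij(2)]]
    have nz: "- z \<noteq> 0" using z by simp
    have PR: "P i * R = R" "P j * R = R"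
      using above[OF ij(1) z dom(1)] above[OF ij(2) nz dom(2)] by auto
    have "(P i * R)\<^sup>\<dagger> = R\<^sup>\<dagger>" by (simp only: PR)
    then have RP: "R * P i = R" using Pi R by (simp add: sq_adj_mult[of _ n])
    have E0: "(1\<^sub>m n - P i) * (1\<^sub>m n - P j) = 0\<^sub>m n n"
      by (rule opposite_kernels_orthogonal[OF z P(1-3)[OF ij(1)] P(1-3)[OF ij(2)] dom PR])
    \<comment> \<open>The kernel of P_j lies in the range of P_i and is orthogonal to R.\<close>
    let ?F = "1\<^sub>m n - P j"
    have F: "projection n ?F" using projection_compl P ij by blast
    note F' = projectionD[OF F]
    have PF: "P i * ?F = ?F" using compl_fix_iff(2)[OF Pi(1) F'(1)] E0 by blast
    have D1: "projection n (P i - R)" by (rule projection_minus[OF P(1)[OF ij(1)] R(4) PR(1)])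
    have RF: "R * ?F = 0\<^sub>m n n"
    proof -
      have "(P j * R)\<^sup>\<dagger> = R\<^sup>\<dagger>" by (simp only: PR)
      then have "R * P j = R" using Pj R by (simp add: sq_adj_mult[of _ n])
      then show ?thesis using Pj(1) R(1) by (simp add: sq_algebra[of _ n])
    qed
    have "(P i - R) * ?F = P i * ?F - R * ?F"
      using Pi(1) R(1) F'(1) by (intro minus_mult_distrib_mat[of _ n n _ _ n]) auto
    also have "\<dots> = ?F" unfolding PF RF using Pj(1) by (intro eq_matI) auto
    finally have DF: "(P i - R) * ?F = ?F" .
    have D: "projection n (P i - R - ?F)" by (rule projection_minus[OF D1 F DF])
    obtain d where d: "mat_trace (P i - R - ?F) = of_nat d" using projection_trace_nat[OF D] by blast
    have tr: "mat_trace (P i - R - ?F) = of_nat k - mat_trace R - (of_nat n - of_nat k)"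
      using Pi(1) R(1) Pj(1) P(4)[OF ij(1)] P(4)[OF ij(2)]
      by (simp add: trace_minus[of _ n])
    have "Re (mat_trace R) \<ge> 2" using pencil_two_eigenvalues[OF z] by blast
    moreover have "real d = real k - Re (mat_trace R) - (real n - real k)"
      using arg_cong[OF d[unfolded tr], of Re] by simp
    ultimately have "d = 0" using k(2) by linarith
    then have "P i - R - ?F = 0\<^sub>m n n" using projection_trace_zero[OF D] d by simp
    then have eq: "P i - R = ?F" using Pi(1) R(1) F'(1) by (subst (asm) minus_eq_zero_iff[of _ n n]) auto
    show ?thesis
    proof (rule eq_matI)
      fix p q assume "p < dim_row (1\<^sub>m n + R)" "q < dim_col (1\<^sub>m n + R)"
      then have pq: "p < n" "q < n" using R(1) by auto
      have "(P i - R) $$ (p, q) = ?F $$ (p, q)" by (simp only: eq)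
      then show "(P i + P j) $$ (p, q) = (1\<^sub>m n + R) $$ (p, q)"
        using pq Pi(1) Pj(1) R(1) by (simp add: algebra_simps)
    qed (use Pi(1) Pj(1) R(1) in auto)
  qed
  have uniq: "P i = P j"
    if z: "z \<noteq> 0" and ij: "i \<in> I" "j \<in> I"
      and dom: "dominates n (P i) (pencil S T z)" "dominates n (P j) (pencil S T z)" for i j z
  proof -
    have "- z \<noteq> 0" using z by simp
    then obtain l where l: "l \<in> I" "dominates n (P l) (pencil S T (- z))" using cover by blast
    have eq: "P i + P l = P j + P l"
      using sum[OF z ij(1) l(1) dom(1) l(2)] sum[OF z ij(2) l(1) dom(2) l(2)] by simp
    note c = projectionD(1)[OF P(1)[OF ij(1)]] projectionD(1)[OF P(1)[OF ij(2)]] projectionD(1)[OF P(1)[OF l(1)]]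
    show ?thesis
    proof (rule eq_matI)
      fix p q assume "p < dim_row (P j)" "q < dim_col (P j)"
      moreover have "(P i + P l) $$ (p, q) = (P j + P l) $$ (p, q)" by (simp only: eq)
      ultimately show "P i $$ (p, q) = P j $$ (p, q)" using c by simp
    qed (use c in auto)
  qed
  obtain i where i: "i \<in> I" "dominates n (P i) (pencil S T 1)" using cover[of 1] by auto
  obtain j where j: "j \<in> I" "dominates n (P j) (pencil S T (- 1))" using cover[of "- 1"] by auto
  have "P i = P j"
  proof (rule connected_finite_closed_cover_const[where S = "- {0 :: complex}" and I = I
        and T = "\<lambda>i. {z. dominates n (P i) (pencil S T z)}" and x = 1 and y = "- 1"])
    show "connected (- {0 :: complex})" by (rule connected_punctured_universe) simp
    show "closed {z. dominates n (P i) (pencil S T z)}" for i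
      by (rule closed_dominates_pencil[OF S(1) T(1)])
    show "- {0} \<subseteq> (\<Union>i\<in>I. {z. dominates n (P i) (pencil S T z)})" using cover by auto
    show "P i = P j" if "i \<in> I" "j \<in> I" "x \<in> - {0}" "x \<in> {z. dominates n (P i) (pencil S T z)}"
      "x \<in> {z. dominates n (P j) (pencil S T z)}" for i j x
      using that by (intro uniq[of x]) auto
  qed (use I i j in auto)
  then have "P i + P i = 1\<^sub>m n + R" using sum[OF _ i(1) j(1) i(2) j(2)] by simp
  note Pi = projectionD[OF P(1)[OF i(1)]]
  have "(1\<^sub>m n - P i) * (1\<^sub>m n - P i) = 0\<^sub>m n n"
    using opposite_kernels_orthogonal[of 1 "P i" "P i"] P[OF i(1)] i above[of i 1] j(2) \<open>P i = P j\<close>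
    by simp
  then have "1\<^sub>m n - P i = 0\<^sub>m n n"
    using projectionD(3)[OF projection_compl(1)[OF P(1)[OF i(1)]]] by simp
  then have "mat_trace (1\<^sub>m n - P i) = 0" by (simp add: mat_trace_def)
  then have "of_nat n = (of_nat k :: complex)"
    using projection_compl(4)[OF P(1)[OF i(1)]] P(4)[OF i(1)] by simp
  then show False using k(1) by simp
qed

end

text \<open>
  By connectedness the irreducible part lies above the cut in every direction or below it in every
  direction. In the second case the complementary projections, which dominate the pencil at -z,
  have it above the cut; this is why k is bounded on both sides of n/2.
\<close>
theorem dominated_pencil_commutes:
  assumes S: "S \<in> carrier_mat n n" "hermitian_mat S" and T: "T \<in> carrier_mat n n" "hermitian_mat T"
    and I: "finite I" and P: "\<And>i. i \<in> I \<Longrightarrow> projection n (P i)"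
    "\<And>i. i \<in> I \<Longrightarrow> P i * S = S * P i" "\<And>i. i \<in> I \<Longrightarrow> P i * T = T * P i"
    "\<And>i. i \<in> I \<Longrightarrow> mat_trace (P i) = of_nat k"
    and cover: "\<And>z. z \<noteq> 0 \<Longrightarrow> \<exists>i\<in>I. dominates n (P i) (pencil S T z)"
    and k: "1 \<le> k" "k < n" "2 * k \<le> n + 2" "n \<le> 2 * k + 2"
  shows "S * T = T * S"
proof (rule ccontr)
  assume "S * T \<noteq> T * S"
  then obtain R where irr: "irreducible_projection n S T R"
    using exists_irreducible_projection[OF S(1) T(1)] by blast
  note R = irreducibleD[OF S T irr]
  have Rnz: "R \<noteq> 0\<^sub>m n n" using R(1,7) S(1) T(1) by (auto simp: sq_algebra[of _ n])
  have dich: "P i * R = R \<or> P i * R = 0\<^sub>m n n"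
    if "i \<in> I" "z \<noteq> 0" "dominates n (P i) (pencil S T z)" for i z
    using dominating_projection_dichotomy[OF S T irr that(2) P(1-3)[OF that(1)] that(3)] .
  have excl: False
    if ij: "i \<in> I" "j \<in> I" and z: "z \<noteq> 0"
      and dom: "dominates n (P i) (pencil S T z)" "dominates n (P j) (pencil S T z)"
      and PR: "P i * R = R" "P j * R = 0\<^sub>m n n" for i j z
  proof -
    note Pi = projectionD[OF P(1)[OF ij(1)]] and Pj = projectionD[OF P(1)[OF ij(2)]]
    let ?Q = "1\<^sub>m n - P j"
    note Q = projection_compl[OF P(1)[OF ij(2)]]
    have QQ: "1\<^sub>m n - ?Q = P j" using Pj(1) by (intro eq_matI) auto
    have "dominates n ?Q (pencil S T (- z))"
      using dominates_compl[OF Pj(1) _ dom(2)] S T by (simp add: pencil_uminus)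
    moreover have "?Q * R = R" using compl_fix_iff(1)[OF Pj(1) R(1)] PR by blast
    moreover have "?Q * S = S * ?Q" "?Q * T = T * ?Q"
      using P(2,3)[OF ij(2)] Pj(1) S(1) T(1) by (simp_all add: sq_algebra[of _ n])
    ultimately have "(1\<^sub>m n - P i) * (1\<^sub>m n - ?Q) = 0\<^sub>m n n"
      using opposite_kernels_orthogonal[OF S T irr z P(1-3)[OF ij(1)] Q(1) _ _ dom(1) _ PR(1)] by blast
    then have "P i * P j = P j" unfolding QQ using compl_fix_iff(2)[OF Pi(1) Pj(1)] by blast
    then have "P i = P j"
      using subprojection_trace_eq[OF P(1)[OF ij(1)] P(1)[OF ij(2)]] P(4)[OF ij(1)] P(4)[OF ij(2)] by simp
    then show False using PR Rnz by simp
  qed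
  have const: "(P i * R = R) = (P j * R = R)"
    if "i \<in> I" "j \<in> I" "x \<noteq> 0" "y \<noteq> 0" "dominates n (P i) (pencil S T x)" "dominates n (P j) (pencil S T y)"
    for i j x y
  proof (rule connected_finite_closed_cover_const[where S = "- {0 :: complex}" and I = I
        and T = "\<lambda>i. {z. dominates n (P i) (pencil S T z)}" and x = x and y = y])
    show "connected (- {0 :: complex})" by (rule connected_punctured_universe) simp
    show "closed {z. dominates n (P i) (pencil S T z)}" for i
      by (rule closed_dominates_pencil[OF S(1) T(1)])
    show "- {0} \<subseteq> (\<Union>i\<in>I. {z. dominates n (P i) (pencil S T z)})" using cover by auto
    show "(P i * R = R) = (P j * R = R)" if "i \<in> I" "j \<in> I" "x \<in> - {0}"
      "x \<in> {z. dominates n (P i) (pencil S T z)}" "x \<in> {z. dominates n (P j) (pencil S T z)}" for i j x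
      using that excl[of i j x] excl[of j i x] dich[of i x] dich[of j x] by auto
  qed (use I that in auto)
  obtain i where i: "i \<in> I" "dominates n (P i) (pencil S T 1)" using cover[of 1] by auto
  show False
  proof (cases "P i * R = R")
    case True
    show False
      by (rule not_always_above_cut[OF S T irr I P cover _ k(2,3)])
        (use const[OF i(1) _ _ _ i(2)] True in auto)
  next
    case False
    have below: "P j * R = 0\<^sub>m n n" if "j \<in> I" "z \<noteq> 0" "dominates n (P j) (pencil S T z)" for j z
      using dich[OF that] const[OF i(1) that(1) _ that(2) i(2) that(3)] False by auto
    have compl: "dominates n (P j) (pencil S T z) \<longleftrightarrow> dominates n (1\<^sub>m n - P j) (pencil S T (- z))"
      if j: "j \<in> I" for j z
    proof -
      note Pj = projectionD[OF P(1)[OF j]]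
      have "1\<^sub>m n - (1\<^sub>m n - P j) = P j" using Pj(1) by (intro eq_matI) auto
      moreover have "(-1) \<cdot>\<^sub>m pencil S T (- z) = pencil S T z"
        using pencil_uminus[OF S(1) T(1), of "- z"] by simp
      ultimately show ?thesis
        using dominates_compl[OF Pj(1), of "pencil S T z"]
          dominates_compl[of "1\<^sub>m n - P j" n "pencil S T (- z)"] Pj(1) S T
        by (auto simp: pencil_uminus)
    qed
    show False
    proof (rule not_always_above_cut[OF S T irr I, where P = "\<lambda>i. 1\<^sub>m n - P i" and k = "n - k"])
      fix j assume j: "j \<in> I"
      note Pj = projectionD[OF P(1)[OF j]]
      show "projection n (1\<^sub>m n - P j)" by (rule projection_compl(1)[OF P(1)[OF j]])
      show "(1\<^sub>m n - P j) * S = S * (1\<^sub>m n - P j)" "(1\<^sub>m n - P j) * T = T * (1\<^sub>m n - P j)"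
        using P(2,3)[OF j] Pj(1) S(1) T(1) by (simp_all add: sq_algebra[of _ n])
      show "mat_trace (1\<^sub>m n - P j) = of_nat (n - k)"
        using projection_compl(4)[OF P(1)[OF j]] P(4)[OF j] k by (simp add: of_nat_diff)
      show "(1\<^sub>m n - P j) * R = R" if z: "z \<noteq> 0" "dominates n (1\<^sub>m n - P j) (pencil S T z)" for z
        using below[OF j, of "- z"] compl[OF j, of "- z"] z compl_fix_iff(1)[OF Pj(1) R(1)] by simp
    next
      fix z :: complex assume "z \<noteq> 0"
      then have "- z \<noteq> 0" by simp
      from cover[OF this] show "\<exists>j\<in>I. dominates n (1\<^sub>m n - P j) (pencil S T z)"
        using compl[of _ "- z"] by auto
    qed (use k in auto)
  qed
qed

end

section \<open>Vertices of a polygonal C-numerical range\<close>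

text \<open>
  The real part of M for \<open>False\<close>, the imaginary part for \<open>True\<close>. The flag lets all real and
  imaginary parts of a family be treated alike.
\<close>
definition hermitian_part :: "bool \<Rightarrow> complex mat \<Rightarrow> complex mat" where
  "hermitian_part b M = (if b then (- \<i> / 2) \<cdot>\<^sub>m (M - M\<^sup>\<dagger>) else (1 / 2) \<cdot>\<^sub>m (M + M\<^sup>\<dagger>))"

definition pair_C_range :: "nat \<Rightarrow> complex mat \<Rightarrow> complex mat \<Rightarrow> complex mat \<Rightarrow> complex set" where
  "pair_C_range n C S T = {Complex (Re (mat_trace (C * U\<^sup>\<dagger> * S * U))) (Re (mat_trace (C * U\<^sup>\<dagger> * T * U)))
     | U. unitary_mat n U}"

lemma polytope_minimal_vertices:
  fixes K :: "'a::euclidean_space set"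
  assumes "polytope K"
  shows "\<exists>F. finite F \<and> K = convex hull F \<and> (\<forall>p\<in>F. p \<notin> convex hull (F - {p}))"
proof -
  let ?Q = "\<lambda>F. finite F \<and> K = convex hull F"
  obtain F0 where "?Q F0" using assms by (auto simp: polytope_def)
  then obtain F where F: "?Q F" and min: "\<And>G. ?Q G \<Longrightarrow> card F \<le> card G"
    using ex_has_least_nat[of ?Q F0 card] by blast
  have "p \<notin> convex hull (F - {p})" if p: "p \<in> F" for p
  proof
    assume "p \<in> convex hull (F - {p})"
    then have "F \<subseteq> convex hull (F - {p})" using hull_subset[of "F - {p}" convex] by auto
    then have "convex hull F \<subseteq> convex hull (F - {p})" by (intro hull_minimal) auto
    moreover have "convex hull (F - {p}) \<subseteq> convex hull F" by (intro hull_mono) auto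
    ultimately have "?Q (F - {p})" using F by auto
    from min[OF this] show False using F p card_Diff1_less[of F p] by auto
  qed
  then show ?thesis using F by blast
qed

text \<open>
  A hyperplane separates p strictly from the hull of the other points. Since these are finitely many,
  nearby normals still do so.
\<close>
lemma vertex_open_normal_cone:
  fixes F :: "'a::euclidean_space set"
  assumes F: "finite F" and p: "p \<notin> convex hull (F - {p})"
  shows "\<exists>z e. e > 0 \<and> (\<forall>y v. dist z y < e \<longrightarrow> v \<in> F \<longrightarrow> y \<bullet> v \<le> y \<bullet> p)"
proof -
  have "closed (convex hull (F - {p}))"
    using F by (intro compact_imp_closed finite_imp_compact_convex_hull) auto
  from separating_hyperplane_closed_point[OF convex_convex_hull this p]
  obtain a b where ab: "a \<bullet> p < b" "\<And>x. x \<in> convex hull (F - {p}) \<Longrightarrow> a \<bullet> x > b" by blast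
  define O' where "O' = (\<Inter>v\<in>F - {p}. {y. y \<bullet> v < y \<bullet> p})"
  have "open O'"
    unfolding O'_def using F by (intro open_INT ballI open_Collect_less continuous_intros) auto
  moreover have "- a \<in> O'"
  proof -
    have "(- a) \<bullet> v < (- a) \<bullet> p" if "v \<in> F - {p}" for v
      using ab(1) ab(2)[of v] hull_inc[OF that, of convex] by simp
    then show ?thesis unfolding O'_def by blast
  qed
  ultimately obtain e where e: "e > 0" "ball (- a) e \<subseteq> O'" by (meson openE)
  have "y \<bullet> v \<le> y \<bullet> p" if "dist (- a) y < e" "v \<in> F" for y v
  proof (cases "v = p")
    case False
    have "y \<in> O'" using e(2) that(1) by (auto simp: mem_ball)
    moreover have "v \<in> F - {p}" using False that(2) by blast
    ultimately have "y \<bullet> v < y \<bullet> p" unfolding O'_def by blast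
    then show ?thesis by simp
  qed simp
  with e(1) show ?thesis by blast
qed

context
  fixes n :: nat
begin

lemma dominates_frame:
  assumes V: "unitary_mat n V"
    and le: "\<And>i j. i < n \<Longrightarrow> j < n \<Longrightarrow> i \<notin> I \<Longrightarrow> j \<in> I \<Longrightarrow> y i \<le> y j"
  shows "dominates n (udiag n V (\<lambda>i. of_bool (i \<in> I))) (udiag n V (\<lambda>i. complex_of_real (y i)))"
  unfolding dominates_def
proof (intro ballI impI)
  note V' = unitaryD[OF V]
  let ?P = "udiag n V (\<lambda>i. of_bool (i \<in> I))"
  fix u w assume u: "u \<in> sq n" and w: "w \<in> sq n" and Pu: "?P * u = u" and Pw: "?P * w = 0\<^sub>m n n"
  define r where "r v i = (\<Sum>j<n. (cmod ((V\<^sup>\<dagger> * v) $$ (i, j)))\<^sup>2)" for v i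
  have r_nonneg: "r v i \<ge> 0" for v i by (auto simp: r_def intro: sum_nonneg)
  have qf: "quad_form (udiag n V (\<lambda>i. complex_of_real (a i))) v = (\<Sum>i<n. a i * r v i)"
    if v: "v \<in> sq n" for a v
  proof -
    define x where "x = V\<^sup>\<dagger> * v"
    have x: "x \<in> sq n" using v V' by (simp add: x_def)
    have "v\<^sup>\<dagger> * udiag n V (\<lambda>i. complex_of_real (a i)) * v = x\<^sup>\<dagger> * (mat_diag n (\<lambda>i. complex_of_real (a i)) * x)"
      using v V' by (simp add: x_def udiag_def sq_algebra[of _ n] sq_adj_mult[of _ n])
    also have "mat_trace \<dots> = mat_trace ((mat_diag n (\<lambda>i. complex_of_real (a i)) * x) * x\<^sup>\<dagger>)"
      using x by (intro trace_comm[of _ n n]) auto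
    also have "\<dots> = (\<Sum>i<n. \<Sum>j<n. of_real (a i * (cmod (x $$ (i, j)))\<^sup>2))"
      using x unfolding mat_diag_mult_left[OF x]
      by (auto simp: mat_trace_def scalar_prod_def atLeast0LessThan mult.assoc
          complex_norm_square simp del: of_real_power intro!: sum.cong)
    also have "\<dots> = of_real (\<Sum>i<n. a i * r v i)"
      by (simp add: r_def x_def sum_distrib_left del: index_mult_mat(1))
    finally show ?thesis by (simp add: quad_form_def)
  qed
  have sn: "sq_norm v = (\<Sum>i<n. r v i)" if v: "v \<in> sq n" for v
    using qf[OF v, of "\<lambda>_. 1"] v by (simp add: udiag_one[OF V] quad_form_def sq_norm_def sq_algebra[of _ n])
  have cut: "mat_diag n (\<lambda>i. of_bool (i \<in> I)) * (V\<^sup>\<dagger> * v) = V\<^sup>\<dagger> * (?P * v)" if "v \<in> sq n" for v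
    using that V' by (simp add: udiag_def sq_algebra[of _ n] unitary_cancel[OF V])
  have ru: "r u i = 0" if "i < n" "i \<notin> I" for i
  proof -
    have c: "V\<^sup>\<dagger> * u \<in> sq n" using u V' by simp
    have e: "(V\<^sup>\<dagger> * u) $$ (i, j) = (mat_diag n (\<lambda>i. of_bool (i \<in> I)) * (V\<^sup>\<dagger> * u)) $$ (i, j)" for j
      by (simp only: cut[OF u] Pu)
    have "(V\<^sup>\<dagger> * u) $$ (i, j) = 0" if "j < n" for j
      using e[of j, unfolded mat_diag_mult_left[OF c]] \<open>i < n\<close> \<open>i \<notin> I\<close> that by (simp del: index_mult_mat(1))
    then show ?thesis unfolding r_def by (intro sum.neutral) (auto simp del: index_mult_mat(1))
  qed
  have rw: "r w i = 0" if "i < n" "i \<in> I" for i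
  proof -
    have c: "V\<^sup>\<dagger> * w \<in> sq n" using w V' by simp
    have "V\<^sup>\<dagger> * (?P * w) = 0\<^sub>m n n" unfolding Pw using V' by (simp add: sq_algebra[of _ n])
    then have e: "(mat_diag n (\<lambda>i. of_bool (i \<in> I)) * (V\<^sup>\<dagger> * w)) $$ (i, j) = 0\<^sub>m n n $$ (i, j)" for j
      by (simp only: cut[OF w])
    have "(V\<^sup>\<dagger> * w) $$ (i, j) = 0" if "j < n" for j
      using e[of j, unfolded mat_diag_mult_left[OF c]] \<open>i < n\<close> \<open>i \<in> I\<close> that by (simp del: index_mult_mat(1))
    then show ?thesis unfolding r_def by (intro sum.neutral) (auto simp del: index_mult_mat(1))
  qed
  have "(\<Sum>i<n. y i * r w i) * (\<Sum>j<n. r u j) = (\<Sum>i<n. \<Sum>j<n. y i * (r w i * r u j))"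
    by (simp add: sum_product mult.assoc)
  also have "\<dots> \<le> (\<Sum>i<n. \<Sum>j<n. y j * (r w i * r u j))"
  proof (intro sum_mono)
    fix i j assume "i \<in> {..<n}" "j \<in> {..<n}"
    then show "y i * (r w i * r u j) \<le> y j * (r w i * r u j)"
      using le[of i j] ru[of j] rw[of i] r_nonneg[of w i] r_nonneg[of u j]
      by (cases "i \<in> I"; cases "j \<in> I") (auto intro!: mult_right_mono)
  qed
  also have "\<dots> = (\<Sum>j<n. y j * r u j) * (\<Sum>i<n. r w i)"
    unfolding sum_product by (subst sum.swap) (simp add: mult_ac)
  finally show "quad_form (udiag n V (\<lambda>i. complex_of_real (y i))) w * sq_norm u
      \<le> quad_form (udiag n V (\<lambda>i. complex_of_real (y i))) u * sq_norm w"
    by (simp add: qf[OF u] qf[OF w] sn[OF u] sn[OF w])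
qed

text \<open>
  C and X have a common frame, in which larger eigenvalues of C go with larger eigenvalues of X.
\<close>
lemma maximal_imp_dominates:
  assumes V: "unitary_mat n V" and X: "X \<in> sq n" "hermitian_mat X"
    and max: "trace_maximal n (udiag n V (\<lambda>i. complex_of_real (d i))) X"
  shows "dominates n (udiag n V (\<lambda>i. of_bool (d i > t))) X"
proof -
  note V' = unitaryD[OF V]
  let ?C = "udiag n V (\<lambda>i. complex_of_real (d i))"
  have C: "?C \<in> sq n" "hermitian_mat ?C" using V' by (auto simp: hermitian_mat_def udiag_adj)
  obtain W c y where W: "unitary_mat n W" and Cc: "?C = udiag n W (\<lambda>i. complex_of_real (c i))"
    and Xy: "X = udiag n W (\<lambda>i. complex_of_real (y i))"
    using hermitian_pair_diagonalization[OF C X maximal_commute[OF C X max]] by blast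
  have "1\<^sub>m n * udiag n V (\<lambda>i. of_bool (Re (complex_of_real (d i)) > t))
      = udiag n W (\<lambda>i. of_bool (Re (complex_of_real (c i)) > t)) * 1\<^sub>m n"
    by (rule udiag_intertwine[OF V W, where f = "\<lambda>x. of_bool (Re x > t)"])
      (use C unitaryD[OF W] in \<open>auto simp: Cc sq_algebra[of _ n]\<close>)
  then have P: "udiag n V (\<lambda>i. of_bool (d i > t)) = udiag n W (\<lambda>i. of_bool (i \<in> {i. c i > t}))"
    using V' unitaryD[OF W] by (simp add: sq_algebra[of _ n])
  show ?thesis
    unfolding P Xy
  proof (rule dominates_frame[OF W])
    fix i j assume "i < n" "j < n" "i \<notin> {i. c i > t}" "j \<in> {i. c i > t}"
    then show "y i \<le> y j"
      using maximal_order[OF W max[unfolded Cc Xy], of j i] by auto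
  qed
qed

lemma pencil_add: "S \<in> sq n \<Longrightarrow> T \<in> sq n \<Longrightarrow> pencil S T (z + w) = pencil S T z + pencil S T w"
  by (rule eq_matI) (auto simp: pencil_def algebra_simps)

lemma commute_cancel:
  assumes "C \<in> sq n" "X \<in> sq n" "Y \<in> sq n" "C * X = X * C" "C * (X + Y) = (X + Y) * C"
  shows "C * Y = Y * C"
proof -
  have eq: "X * C + C * Y = X * C + Y * C" using assms by (simp add: sq_algebra[of _ n])
  show ?thesis
  proof (rule eq_matI)
    fix i j assume "i < dim_row (Y * C)" "j < dim_col (Y * C)"
    moreover have "(X * C + C * Y) $$ (i, j) = (X * C + Y * C) $$ (i, j)" by (simp only: eq)
    ultimately show "(C * Y) $$ (i, j) = (Y * C) $$ (i, j)"
      using assms(1-3) by (simp del: index_mult_mat(1))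
  qed (use assms in auto)
qed

lemma inner_pair_C_range:
  assumes S: "S \<in> sq n" and T: "T \<in> sq n" and C: "C \<in> sq n" and U: "U \<in> sq n"
  shows "z \<bullet> Complex (Re (mat_trace (C * U\<^sup>\<dagger> * S * U))) (Re (mat_trace (C * U\<^sup>\<dagger> * T * U)))
    = Re (mat_trace (C * U\<^sup>\<dagger> * pencil S T z * U))"
  using assms by (simp add: inner_complex_def pencil_def sq_algebra[of _ n] trace_add[of _ n] trace_smult[of _ n])

text \<open>
  The vertices index the dominating projections. At a vertex, the conjugate of C that attains it
  commutes with the pencil at all directions near z, hence with the pencil at all small differences
  of such directions, which include multiples of S and T.
\<close>
theorem polygonal_pair_commutes:
  assumes S: "S \<in> sq n" "hermitian_mat S" and T: "T \<in> sq n" "hermitian_mat T"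
    and V: "unitary_mat n V" and C: "C = udiag n V (\<lambda>i. complex_of_real (d i))"
    and k: "card {i. i < n \<and> d i > t} = k" "1 \<le> k" "k < n" "2 * k \<le> n + 2" "n \<le> 2 * k + 2"
    and poly: "polytope (pair_C_range n C S T)"
  shows "S * T = T * S"
proof -
  note V' = unitaryD[OF V]
  have Cc: "C \<in> sq n" "hermitian_mat C" using V' by (auto simp: C hermitian_mat_def udiag_adj)
  let ?w = "\<lambda>U. Complex (Re (mat_trace (C * U\<^sup>\<dagger> * S * U))) (Re (mat_trace (C * U\<^sup>\<dagger> * T * U)))"
  let ?K = "pair_C_range n C S T"
  obtain F where F: "finite F" "?K = convex hull F"
    and vert: "\<And>p. p \<in> F \<Longrightarrow> p \<notin> convex hull (F - {p})"
    using polytope_minimal_vertices[OF poly] by blast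
  have "\<exists>U. unitary_mat n U \<and> p = ?w U" if "p \<in> F" for p
  proof -
    have "p \<in> ?K" unfolding F(2) using that hull_subset by (rule subsetD[rotated])
    then show ?thesis by (auto simp: pair_C_range_def)
  qed
  then obtain U where U: "\<And>p. p \<in> F \<Longrightarrow> unitary_mat n (U p)" and Uw: "\<And>p. p \<in> F \<Longrightarrow> p = ?w (U p)"
    by metis
  define Cp where "Cp p = udiag n (U p * V) (\<lambda>i. complex_of_real (d i))" for p
  define P where "P p = udiag n (U p * V) (\<lambda>i. of_bool (d i > t))" for p
  have UV: "unitary_mat n (U p * V)" if "p \<in> F" for p using U[OF that] V by (rule unitary_mult)
  note UV' = unitaryD[OF UV]
  have CpU: "Cp p = U p * C * (U p)\<^sup>\<dagger>" if "p \<in> F" for p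
    unfolding Cp_def C using udiag_frame_mult[OF unitaryD(1)[OF U[OF that]] V'(1)] by simp
  have Cpc: "Cp p \<in> sq n" "hermitian_mat (Cp p)" if "p \<in> F" for p
    using UV'[OF that] by (auto simp: Cp_def hermitian_mat_def udiag_adj)
  have Xc: "pencil S T z \<in> sq n" "hermitian_mat (pencil S T z)" for z
    using S T by (auto intro: pencil_hermitian)
  have max: "trace_maximal n (Cp p) (pencil S T z)"
    if p: "p \<in> F" and best: "\<And>v. v \<in> F \<Longrightarrow> z \<bullet> v \<le> z \<bullet> p" for p z
    unfolding trace_maximal_def
  proof (intro allI impI)
    fix W assume W: "unitary_mat n W"
    note W' = unitaryD[OF W] and U' = unitaryD[OF U[OF p]]
    let ?X = "pencil S T z"
    have WU: "unitary_mat n (W * U p)" by (rule unitary_mult[OF W U[OF p]])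
    have "convex hull F \<subseteq> {x. z \<bullet> x \<le> z \<bullet> p}"
      using best by (intro hull_minimal convex_halfspace_le) auto
    moreover have "?w (W * U p) \<in> convex hull F"
      using WU unfolding F(2)[symmetric] by (auto simp: pair_C_range_def)
    ultimately have "z \<bullet> ?w (W * U p) \<le> z \<bullet> ?w (U p)" using Uw[OF p] by auto
    then have le: "Re (mat_trace (C * (W * U p)\<^sup>\<dagger> * ?X * (W * U p))) \<le> Re (mat_trace (C * (U p)\<^sup>\<dagger> * ?X * U p))"
      using inner_pair_C_range[OF S(1) T(1) Cc(1)] unitaryD(1)[OF WU] U'(1) by simp
    have "mat_trace (C * (W * U p)\<^sup>\<dagger> * ?X * (W * U p)) = mat_trace ((C * ((U p)\<^sup>\<dagger> * (W\<^sup>\<dagger> * (?X * W)))) * U p)"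
      using W' U' Cc Xc by (simp add: sq_algebra[of _ n] sq_adj_mult[of _ n])
    also have "\<dots> = mat_trace (U p * (C * ((U p)\<^sup>\<dagger> * (W\<^sup>\<dagger> * (?X * W)))))"
      using W' U' Cc Xc by (intro trace_comm[of _ n n]) auto
    also have "\<dots> = mat_trace (Cp p * W\<^sup>\<dagger> * ?X * W)"
      using W' U' Cc Xc by (simp add: CpU[OF p] sq_algebra[of _ n])
    finally have e1: "mat_trace (C * (W * U p)\<^sup>\<dagger> * ?X * (W * U p)) = mat_trace (Cp p * W\<^sup>\<dagger> * ?X * W)" .
    have "mat_trace (C * (U p)\<^sup>\<dagger> * ?X * U p) = mat_trace (U p * (C * (U p)\<^sup>\<dagger> * ?X))"
      using U' Cc Xc by (intro trace_comm[of _ n n]) auto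
    also have "\<dots> = mat_trace (Cp p * ?X)"
      using U' Cc Xc by (simp add: CpU[OF p] sq_algebra[of _ n])
    finally show "Re (mat_trace (Cp p * W\<^sup>\<dagger> * ?X * W)) \<le> Re (mat_trace (Cp p * ?X))"
      using le e1 by simp
  qed
  have comm: "Cp p * S = S * Cp p \<and> Cp p * T = T * Cp p" if p: "p \<in> F" for p
  proof -
    obtain z e where e: "e > 0" and best: "\<And>y v. dist z y < e \<Longrightarrow> v \<in> F \<Longrightarrow> y \<bullet> v \<le> y \<bullet> p"
      using vertex_open_normal_cone[OF F(1) vert[OF p]] by blast
    have cX: "Cp p * pencil S T y = pencil S T y * Cp p" if "dist z y < e" for y
      by (rule maximal_commute[OF Cpc[OF p] Xc max[OF p best[OF that]]])
    have c0: "Cp p * pencil S T w = pencil S T w * Cp p" if "norm w < e" for w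
    proof (rule commute_cancel[OF Cpc(1)[OF p] Xc(1)[of z] Xc(1)])
      show "Cp p * pencil S T z = pencil S T z * Cp p" using cX[of z] e by simp
      show "Cp p * (pencil S T z + pencil S T w) = (pencil S T z + pencil S T w) * Cp p"
        using cX[of "z + w"] that by (simp add: pencil_add[OF S(1) T(1)] dist_norm)
    qed
    let ?a = "complex_of_real (e / 2)"
    have pS: "pencil S T ?a = ?a \<cdot>\<^sub>m S" and pT: "pencil S T (?a * \<i>) = ?a \<cdot>\<^sub>m T"
      using S T by (auto simp: pencil_def intro!: eq_matI)
    have "?a \<cdot>\<^sub>m (Cp p * S) = ?a \<cdot>\<^sub>m (S * Cp p)"
      using c0[of ?a] e Cpc(1)[OF p] S(1) unfolding pS by (simp add: sq_algebra[of _ n])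
    moreover have "?a \<cdot>\<^sub>m (Cp p * T) = ?a \<cdot>\<^sub>m (T * Cp p)"
      using c0[of "?a * \<i>"] e Cpc(1)[OF p] T(1) unfolding pT by (simp add: sq_algebra[of _ n] norm_mult)
    moreover have "?a \<noteq> 0" using e by simp
    ultimately show ?thesis
      using smult_left_cancel[of ?a _ _ n n] Cpc(1)[OF p] S(1) T(1) by (metis sq_mult)
  qed
  have Pcomm: "P p * Y = Y * P p" if p: "p \<in> F" and Y: "Y \<in> sq n" "Cp p * Y = Y * Cp p" for p Y
    using udiag_commute[OF UV[OF p] Y(1), of "\<lambda>i. complex_of_real (d i)" "\<lambda>x. of_bool (Re x > t)"] Y(2)
    by (simp add: P_def Cp_def)
  show ?thesis
  proof (rule dominated_pencil_commutes[OF S T F(1), where P = P and k = k])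
    fix p assume p: "p \<in> F"
    show "projection n (P p)"
      using UV'(1)[OF p] udiag_mult[OF UV[OF p]]
      by (auto simp: projection_def P_def udiag_adj intro!: udiag_cong)
    show "P p * S = S * P p" "P p * T = T * P p"
      using Pcomm[OF p] comm[OF p] S T by auto
    have "mat_trace (P p) = (\<Sum>i<n. of_bool (d i > t))" unfolding P_def by (rule trace_udiag[OF UV[OF p]])
    also have "\<dots> = of_nat (card {i. i < n \<and> d i > t})"
      by (simp add: lessThan_def Collect_conj_eq)
    finally show "mat_trace (P p) = of_nat k" by (simp add: k(1))
  next
    fix z :: complex
    have "?w (1\<^sub>m n) \<in> ?K" using unitary_one unfolding pair_C_range_def by blast
    then have "F \<noteq> {}" using F(2) by auto
    then have "Max ((\<bullet>) z ` F) \<in> (\<bullet>) z ` F" using F(1) by (intro Max_in) auto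
    then obtain p where p0: "p \<in> F" "z \<bullet> p = Max ((\<bullet>) z ` F)" by force
    have p: "p \<in> F" "\<And>v. v \<in> F \<Longrightarrow> z \<bullet> v \<le> z \<bullet> p"
      using p0 F(1) by auto
    have "dominates n (P p) (pencil S T z)"
      unfolding P_def
      by (rule maximal_imp_dominates[OF UV[OF p(1)] Xc]) (use max[OF p] in \<open>simp add: Cp_def\<close>)
    then show "\<exists>p\<in>F. dominates n (P p) (pencil S T z)" using p(1) by blast
  qed (use k in auto)
qed

lemma hermitian_part_carrier [simp]: "M \<in> sq n \<Longrightarrow> hermitian_part b M \<in> sq n"
  by (simp add: hermitian_part_def)

lemma hermitian_part_hermitian:
  assumes "M \<in> sq n"
  shows "hermitian_mat (hermitian_part b M)"
  unfolding hermitian_mat_def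
proof (rule eq_matI)
  fix i j assume "i < dim_row (hermitian_part b M)" "j < dim_col (hermitian_part b M)"
  then have "i < n" "j < n" using assms by (auto simp: hermitian_part_def split: if_splits)
  then show "(hermitian_part b M)\<^sup>\<dagger> $$ (i, j) = hermitian_part b M $$ (i, j)"
    using assms by (auto simp: hermitian_part_def algebra_simps)
qed (use assms in \<open>auto simp: hermitian_part_def\<close>)

lemma hermitian_part_decomp:
  assumes "M \<in> sq n"
  shows "M = hermitian_part False M + \<i> \<cdot>\<^sub>m hermitian_part True M"
    "M\<^sup>\<dagger> = hermitian_part False M - \<i> \<cdot>\<^sub>m hermitian_part True M"
  using assms by (auto simp: hermitian_part_def field_simps intro!: eq_matI)

lemma trace_hermitian_mult_real:
  assumes "C \<in> sq n" "hermitian_mat C" "Y \<in> sq n" "hermitian_mat Y"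
  shows "Im (mat_trace (C * Y)) = 0"
proof -
  have CY: "C * Y \<in> sq n" using assms by simp
  have "cnj (mat_trace (C * Y)) = mat_trace ((C * Y)\<^sup>\<dagger>)" using trace_adj[OF CY] by simp
  also have "\<dots> = mat_trace (Y * C)"
    using assms by (simp add: sq_adj_mult[of _ n] hermitian_mat_def)
  also have "\<dots> = mat_trace (C * Y)" using assms by (intro trace_comm[of _ n n]) auto
  finally have "cnj (mat_trace (C * Y)) = mat_trace (C * Y)" .
  then show ?thesis by (simp add: complex_eq_iff)
qed

lemma trace_hermitian_part:
  assumes C: "C \<in> sq n" "hermitian_mat C" and M: "M \<in> sq n" and U: "U \<in> sq n"
  shows "Re (mat_trace (C * U\<^sup>\<dagger> * hermitian_part b M * U))
    = (if b then Im else Re) (mat_trace (C * U\<^sup>\<dagger> * M * U))"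
proof -
  let ?H = "\<lambda>b. hermitian_part b M"
  have H: "?H b \<in> sq n" "hermitian_mat (?H b)" for b
    using M hermitian_part_hermitian by auto
  have conj: "C * U\<^sup>\<dagger> * Y * U = C * (U\<^sup>\<dagger> * Y * U)" if "Y \<in> sq n" for Y
    using that C U by (simp add: sq_algebra[of _ n])
  have real: "Im (mat_trace (C * U\<^sup>\<dagger> * ?H b * U)) = 0" for b
    unfolding conj[OF H(1)]
    by (rule trace_hermitian_mult_real[OF C])
      (use H[of b] U in \<open>auto simp: hermitian_mat_def sq_algebra[of _ n] sq_adj_mult[of _ n]\<close>)
  have "C * U\<^sup>\<dagger> * M * U = C * U\<^sup>\<dagger> * (?H False + \<i> \<cdot>\<^sub>m ?H True) * U"
    using hermitian_part_decomp(1)[OF M] by simp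
  also have "\<dots> = C * U\<^sup>\<dagger> * ?H False * U + \<i> \<cdot>\<^sub>m (C * U\<^sup>\<dagger> * ?H True * U)"
    using C U H(1)[of True] H(1)[of False] by (simp add: sq_algebra[of _ n])
  finally have "mat_trace (C * U\<^sup>\<dagger> * M * U) = mat_trace (C * U\<^sup>\<dagger> * ?H False * U) + \<i> * mat_trace (C * U\<^sup>\<dagger> * ?H True * U)"
    using C U H(1)[of True] H(1)[of False] by (simp add: trace_add[of _ n] trace_smult[of _ n])
  then show ?thesis using real[of True] real[of False] by simp
qed

theorem polytope_imp_commuting_normal:
  fixes A :: "'m::finite \<Rightarrow> complex mat"
  assumes A: "\<And>j. A j \<in> carrier_mat n n"
    and V: "unitary_mat n V" and C: "C = udiag n V (\<lambda>i. complex_of_real (d i))"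
    and k: "card {i. i < n \<and> d i > t} = k" "1 \<le> k" "k < n" "2 * k \<le> n + 2" "n \<le> 2 * k + 2"
    and poly: "polytope (joint_C_range n C A)"
  shows "commuting_normal n A"
proof -
  note V' = unitaryD[OF V]
  have Cc: "C \<in> sq n" "hermitian_mat C" using V' by (auto simp: C hermitian_mat_def udiag_adj)
  let ?H = "\<lambda>b j. hermitian_part b (A j)"
  have H: "?H b j \<in> sq n" "hermitian_mat (?H b j)" for b j using A hermitian_part_hermitian by auto
  have comm: "?H b i * ?H c j = ?H c j * ?H b i" for b c i j
  proof (rule polygonal_pair_commutes[OF H H V C k])
    define L where "L x = Complex ((if b then Im else Re) (x $ i)) ((if c then Im else Re) (x $ j))"
      for x :: "complex ^ 'm"
    have "linear L" unfolding L_def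
      by (rule linearI) (auto simp: complex_eq_iff)
    moreover have "pair_C_range n C (?H b i) (?H c j) = L ` joint_C_range n C A"
    proof -
      have "Complex (Re (mat_trace (C * U\<^sup>\<dagger> * ?H b i * U))) (Re (mat_trace (C * U\<^sup>\<dagger> * ?H c j * U)))
          = L (\<chi> j. mat_trace (C * U\<^sup>\<dagger> * A j * U))" if "unitary_mat n U" for U
        using trace_hermitian_part[OF Cc A unitaryD(1)[OF that]] by (simp add: L_def)
      then show ?thesis
        unfolding pair_C_range_def joint_C_range_def setcompr_eq_image image_image
        by (intro image_cong) auto
    qed
    ultimately show "polytope (pair_C_range n C (?H b i) (?H c j))"
      using polytope_linear_image[OF _ poly] by simp
  qed
  have mult: "(?H False i + x \<cdot>\<^sub>m ?H True i) * (?H False j + y \<cdot>\<^sub>m ?H True j)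
      = (?H False j + y \<cdot>\<^sub>m ?H True j) * (?H False i + x \<cdot>\<^sub>m ?H True i)" for i j x y
  proof -
    note h = H(1)[of False i] H(1)[of True i] H(1)[of False j] H(1)[of True j]
    have "(?H False i + x \<cdot>\<^sub>m ?H True i) * (?H False j + y \<cdot>\<^sub>m ?H True j)
      = (?H False j * ?H False i + y \<cdot>\<^sub>m (?H True j * ?H False i))
        + (x \<cdot>\<^sub>m (?H False j * ?H True i) + (x * y) \<cdot>\<^sub>m (?H True j * ?H True i))"
      using h by (auto simp: sq_algebra[of _ n] comm[of _ i _ j] simp del: index_mult_mat(1) intro!: eq_matI) (auto simp: algebra_simps simp del: index_mult_mat(1))
    also have "\<dots> = (?H False j + y \<cdot>\<^sub>m ?H True j) * (?H False i + x \<cdot>\<^sub>m ?H True i)"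
      using h by (auto simp: sq_algebra[of _ n] algebra_simps simp del: index_mult_mat(1) intro!: eq_matI)
    finally show ?thesis .
  qed
  have minus: "?H False i - \<i> \<cdot>\<^sub>m ?H True i = ?H False i + (- \<i>) \<cdot>\<^sub>m ?H True i" for i
    using H(1)[of False i] H(1)[of True i] by (intro eq_matI) auto
  show ?thesis
    unfolding commuting_normal_def normal_mat_def
  proof (intro conjI allI A)
    show "A i * (A i)\<^sup>\<dagger> = (A i)\<^sup>\<dagger> * A i" for i
      using hermitian_part_decomp[OF A[of i], unfolded minus] mult by metis
    show "A i * A j = A j * A i" for i j
      using hermitian_part_decomp(1)[OF A] mult by metis
  qed
qed

end

section \<open>Majorisation and diagonals of Hermitian matrices\<close>

text \<open>
  The definition is used for decreasing c, when the sum of the first p entries is the largest sum of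
  p entries.
\<close>
definition majorized :: "nat \<Rightarrow> (nat \<Rightarrow> real) \<Rightarrow> (nat \<Rightarrow> real) \<Rightarrow> bool" where
  "majorized n d c \<longleftrightarrow> (\<Sum>i<n. d i) = (\<Sum>i<n. c i) \<and>
     (\<forall>S. S \<subseteq> {..<n} \<longrightarrow> (\<Sum>i\<in>S. d i) \<le> (\<Sum>i<card S. c i))"

definition transfer :: "nat \<Rightarrow> nat \<Rightarrow> real \<Rightarrow> (nat \<Rightarrow> real) \<Rightarrow> nat \<Rightarrow> real" where
  "transfer i j t f = f(i := t * f i + (1 - t) * f j, j := (1 - t) * f i + t * f j)"

definition transfer_closed :: "nat \<Rightarrow> ((nat \<Rightarrow> real) \<Rightarrow> bool) \<Rightarrow> bool" where
  "transfer_closed n Q \<longleftrightarrow>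
     (\<forall>f g. Q f \<longrightarrow> (\<forall>i<n. f i = g i) \<longrightarrow> Q g) \<and>
     (\<forall>f i j t. Q f \<longrightarrow> i < n \<longrightarrow> j < n \<longrightarrow> i \<noteq> j \<longrightarrow> 0 \<le> t \<longrightarrow> t \<le> 1 \<longrightarrow> Q (transfer i j t f))"

lemma transfer_closedD:
  assumes "transfer_closed n Q"
  shows "\<And>f g. Q f \<Longrightarrow> (\<And>i. i < n \<Longrightarrow> f i = g i) \<Longrightarrow> Q g"
    "\<And>f i j t. Q f \<Longrightarrow> i < n \<Longrightarrow> j < n \<Longrightarrow> i \<noteq> j \<Longrightarrow> 0 \<le> t \<Longrightarrow> t \<le> 1 \<Longrightarrow> Q (transfer i j t f)"
  using assms unfolding transfer_closed_def by blast+

lemma transfer_closed_permute: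
  assumes Q: "transfer_closed n Q" and p: "p permutes {..<n}" and f: "Q f"
  shows "Q (f \<circ> p)"
proof -
  have "\<forall>f. Q f \<longrightarrow> Q (f \<circ> p)"
    using p finite_lessThan
  proof (induction rule: permutes_induct)
    case id
    then show ?case by simp
  next
    case (swap a b p)
    show ?case
    proof (intro allI impI)
      fix f assume f: "Q f"
      have eq: "transfer a b 0 f = f \<circ> Transposition.transpose a b"
        using swap(3) by (auto simp: transfer_def fun_eq_iff Transposition.transpose_def)
      have "Q (transfer a b 0 f)" using transfer_closedD(2)[OF Q f, of a b 0] swap(1-3) by simp
      then have "Q (f \<circ> Transposition.transpose a b)" by (simp only: eq)
      then show "Q (f \<circ> (Transposition.transpose a b \<circ> p))"
        unfolding o_assoc using swap.IH by blast
    qed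
  qed
  with f show ?thesis by blast
qed

lemma antimono_rearrangement:
  fixes d :: "nat \<Rightarrow> real"
  shows "\<exists>p. p permutes {..<n} \<and> (\<forall>i j. i \<le> j \<longrightarrow> j < n \<longrightarrow> d (p j) \<le> d (p i))"
proof -
  define xs where "xs = rev (sort (map d [0..<n]))"
  have "mset xs = mset (map d [0..<n])" by (simp add: xs_def)
  then obtain p where p: "p permutes {..<length (map d [0..<n])}" "permute_list p (map d [0..<n]) = xs"
    by (rule mset_eq_permutation)
  have pn: "p permutes {..<n}" using p(1) by simp
  have nth: "xs ! i = d (p i)" if "i < n" for i
  proof -
    have "p i < n" using permutes_in_image[OF pn, of i] that by simp
    then show ?thesis using that p by (auto simp: permute_list_nth simp flip: p(2))
  qed
  have "sorted_wrt (\<ge>) xs" unfolding xs_def by (simp add: sorted_wrt_rev)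
  moreover have "length xs = n" by (simp add: xs_def)
  ultimately have "xs ! j \<le> xs ! i" if "i \<le> j" "j < n" for i j
    using that by (cases "i = j") (auto simp: sorted_wrt_iff_nth_less)
  then have "d (p j) \<le> d (p i)" if "i \<le> j" "j < n" for i j using nth that by force
  with pn show ?thesis by blast
qed

text \<open>
  The step of Hardy, Littlewood and Polya: transferring from the last position j where c is too large
  to the next position k where c is too small, by the smaller of the two gaps, makes one more entry
  agree; in between the sequences agree, so the partial sums of the new sequence still dominate.
\<close>
lemma transfer_closed_prefix_dominated:
  assumes Q: "transfer_closed n Q" and c: "Q c"
    and prefix: "\<And>p. p \<le> n \<Longrightarrow> (\<Sum>i<p. d i) \<le> (\<Sum>i<p. c i)"
    and total: "(\<Sum>i<n. d i) = (\<Sum>i<n. c i)"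
    and anti: "\<And>i j. i \<le> j \<Longrightarrow> j < n \<Longrightarrow> d j \<le> d i"
  shows "Q d"
  using c prefix total
proof (induction "card {i. i < n \<and> c i \<noteq> d i}" arbitrary: c rule: less_induct)
  case (less c)
  note prefix = less.prems(2) and total = less.prems(3)
  show ?case
  proof (cases "\<forall>i<n. c i = d i")
    case True
    then show ?thesis using transfer_closedD(1)[OF Q less.prems(1)] by blast
  next
    case False
    define J where "J = {i. i < n \<and> d i < c i}"
    have finJ: "finite J" by (simp add: J_def)
    have "J \<noteq> {}"
    proof -
      obtain i where i: "i < n \<and> c i \<noteq> d i" "\<And>l. l < i \<Longrightarrow> \<not> (l < n \<and> c l \<noteq> d l)"
        using False exists_least_iff[of "\<lambda>i. i < n \<and> c i \<noteq> d i"] by auto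
      then have "(\<Sum>l<i. d l) = (\<Sum>l<i. c l)" by (intro sum.cong) auto
      then have "d i \<le> c i" using prefix[of "Suc i"] i(1) by simp
      then show ?thesis using i(1) by (auto simp: J_def)
    qed
    define j where "j = Max J"
    have j: "j < n" "d j < c j" using Max_in[OF finJ \<open>J \<noteq> {}\<close>] by (auto simp: J_def j_def)
    have after: "c i \<le> d i" if "j < i" "i < n" for i
    proof (rule ccontr)
      assume "\<not> c i \<le> d i"
      then have "i \<in> J" using that by (simp add: J_def)
      then show False using Max_ge[OF finJ, of i] that by (simp add: j_def)
    qed
    define K where "K = {i. j < i \<and> i < n \<and> c i < d i}"
    have finK: "finite K" by (simp add: K_def)
    have split: "(\<Sum>i<p. f i) = (\<Sum>i<j. f i) + f j + (\<Sum>i\<in>{j<..<p}. f i)"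
      if "j < p" for p and f :: "nat \<Rightarrow> real"
    proof -
      have "{..<p} = {..<j} \<union> {j} \<union> {j<..<p}" using that by auto
      moreover have "sum f ({..<j} \<union> {j} \<union> {j<..<p}) = sum f ({..<j} \<union> {j}) + sum f {j<..<p}"
        by (rule sum.union_disjoint) auto
      ultimately show ?thesis by simp
    qed
    have "K \<noteq> {}"
    proof
      assume "K = {}"
      then have "(\<Sum>i\<in>{j<..<n}. d i) = (\<Sum>i\<in>{j<..<n}. c i)"
        using after by (intro sum.cong) (force simp: K_def)+
      then have "(\<Sum>i<j. d i) + d j = (\<Sum>i<j. c i) + c j"
        using total split[OF j(1), of d] split[OF j(1), of c] by simp
      then show False using prefix[of j] j by simp
    qed
    define k where "k = Min K"
    have k: "j < k" "k < n" "c k < d k" using Min_in[OF finK \<open>K \<noteq> {}\<close>] by (auto simp: K_def k_def)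
    have between: "c i = d i" if "j < i" "i < k" for i
    proof (rule ccontr)
      assume "c i \<noteq> d i"
      then have "i \<in> K" using after[of i] that k by (simp add: K_def)
      then show False using Min_le[OF finK, of i] that by (simp add: k_def)
    qed
    \<comment> \<open>the smaller gap, so that one of the two entries becomes correct\<close>
    define \<delta> where "\<delta> = min (c j - d j) (d k - c k)"
    have \<delta>: "\<delta> > 0" "\<delta> \<le> c j - d j" "\<delta> \<le> d k - c k" using j k by (auto simp: \<delta>_def)
    have djk: "d k \<le> d j" using anti[of j k] k by simp
    define t where "t = 1 - \<delta> / (c j - c k)"
    have t: "0 \<le> t" "t \<le> 1" using \<delta> djk by (auto simp: t_def field_simps)
    define c' where "c' = c(j := c j - \<delta>, k := c k + \<delta>)"
    have "transfer j k t c = c'"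
    proof -
      have *: "(1 - t) * (c j - c k) = \<delta>" using \<delta> djk by (simp add: t_def)
      then have "t * c j + (1 - t) * c k = c j - \<delta>" "(1 - t) * c j + t * c k = c k + \<delta>"
        by (simp_all add: algebra_simps)
      then show ?thesis by (simp add: transfer_def c'_def)
    qed
    then have Qc': "Q c'" using transfer_closedD(2)[OF Q less.prems(1) j(1) k(2) _ t] k by simp
    have sum_c': "(\<Sum>i<p. c' i) = (\<Sum>i<p. c i) - (if j < p then \<delta> else 0) + (if k < p then \<delta> else 0)" for p
    proof -
      have "(\<Sum>i<p. c' i) = (\<Sum>i<p. c i - (if i = j then \<delta> else 0) + (if i = k then \<delta> else 0))"
        using k by (intro sum.cong) (auto simp: c'_def)
      then show ?thesis by (simp add: sum.distrib sum_subtractf)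
    qed
    have prefix': "(\<Sum>i<p. d i) \<le> (\<Sum>i<p. c' i)" if p: "p \<le> n" for p
    proof -
      consider "p \<le> j" | "j < p" "p \<le> k" | "k < p" using k by linarith
      then show ?thesis
      proof cases
        case 2
        have "(\<Sum>i\<in>{j<..<p}. d i) = (\<Sum>i\<in>{j<..<p}. c i)"
          using between 2 by (intro sum.cong) auto
        then show ?thesis
          using split[OF 2(1), of d] split[OF 2(1), of c] prefix[of j] j \<delta> 2 by (simp add: sum_c')
      qed (use prefix[OF p] k in \<open>auto simp: sum_c'\<close>)
    qed
    have total': "(\<Sum>i<n. d i) = (\<Sum>i<n. c' i)" using total j k by (simp add: sum_c')
    have "{i. i < n \<and> c' i \<noteq> d i} \<subset> {i. i < n \<and> c i \<noteq> d i}"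
    proof (rule psubsetI)
      show "{i. i < n \<and> c' i \<noteq> d i} \<subseteq> {i. i < n \<and> c i \<noteq> d i}" using j k by (auto simp: c'_def)
      have "c' j = d j \<or> c' k = d k" using k by (auto simp: c'_def \<delta>_def min_def)
      moreover have "j \<in> {i. i < n \<and> c i \<noteq> d i}" "k \<in> {i. i < n \<and> c i \<noteq> d i}"
        using j k by simp_all
      ultimately show "{i. i < n \<and> c' i \<noteq> d i} \<noteq> {i. i < n \<and> c i \<noteq> d i}" by blast
    qed
    then have "card {i. i < n \<and> c' i \<noteq> d i} < card {i. i < n \<and> c i \<noteq> d i}"
      by (intro psubset_card_mono) auto
    from less.hyps[OF this Qc' prefix' total'] show ?thesis .
  qed
qed

theorem transfer_closed_majorized:
  assumes Q: "transfer_closed n Q" and c: "Q c" and maj: "majorized n d c"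
  shows "Q d"
proof -
  obtain p where p: "p permutes {..<n}" and anti: "\<And>i j. i \<le> j \<Longrightarrow> j < n \<Longrightarrow> d (p j) \<le> d (p i)"
    using antimono_rearrangement[of n d] by blast
  have "Q (d \<circ> p)"
  proof (rule transfer_closed_prefix_dominated[OF Q c])
    fix q assume q: "q \<le> n"
    have inj: "inj_on p {..<q}" using permutes_inj_on[OF p] .
    have "p i < n" if "i < q" for i using permutes_in_image[OF p, of i] that q by simp
    then have "p ` {..<q} \<subseteq> {..<n}" by blast
    then have "(\<Sum>i\<in>p ` {..<q}. d i) \<le> (\<Sum>i<card (p ` {..<q}). c i)"
      using maj by (simp add: majorized_def)
    then show "(\<Sum>i<q. (d \<circ> p) i) \<le> (\<Sum>i<q. c i)"
      using inj by (simp add: sum.reindex card_image)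
  next
    show "(\<Sum>i<n. (d \<circ> p) i) = (\<Sum>i<n. c i)"
      using maj sum.permute[OF p, of d] by (simp add: majorized_def)
  qed (use anti in auto)
  then have "Q (d \<circ> p \<circ> inv_into UNIV p)" by (intro transfer_closed_permute[OF Q permutes_inv[OF p]])
  then show ?thesis using permutes_inv_o(1)[OF p] by (simp add: comp_assoc)
qed

text \<open>
  Subtracting the threshold m = c (p - 1) from c changes both sides by the same amount, as the weights
  add up to p; afterwards the comparison holds term by term. For p = 0 the truncated difference makes
  m the largest entry, which serves as well.
\<close>
lemma weighted_sum_le_prefix:
  fixes c s :: "nat \<Rightarrow> real"
  assumes anti: "\<And>i j. i \<le> j \<Longrightarrow> j < n \<Longrightarrow> c j \<le> c i"
    and s: "\<And>i. i < n \<Longrightarrow> 0 \<le> s i" "\<And>i. i < n \<Longrightarrow> s i \<le> 1" "(\<Sum>i<n. s i) = real p" and p: "p \<le> n"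
  shows "(\<Sum>i<n. c i * s i) \<le> (\<Sum>i<p. c i)"
proof -
  define m where "m = c (p - 1)"
  have ind: "(\<Sum>i<n. of_bool (i < p) * f i) = (\<Sum>i<p. f i)" for f :: "nat \<Rightarrow> real"
  proof -
    have "(\<Sum>i<n. of_bool (i < p) * f i) = (\<Sum>i<p. of_bool (i < p) * f i)"
      using p by (intro sum.mono_neutral_right) auto
    then show ?thesis by simp
  qed
  have "0 \<le> (\<Sum>i<n. (c i - m) * (of_bool (i < p) - s i))"
  proof (intro sum_nonneg)
    fix i assume i: "i \<in> {..<n}"
    show "0 \<le> (c i - m) * (of_bool (i < p) - s i)"
    proof (cases "i < p")
      case True
      then have "m \<le> c i" using anti[of i "p - 1"] p by (simp add: m_def)
      then show ?thesis using True s(2)[of i] i by simp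
    next
      case False
      then have "c i \<le> m" using anti[of "p - 1" i] i by (simp add: m_def)
      then show ?thesis using False s(1)[of i] i by (simp add: mult_nonpos_nonneg)
    qed
  qed
  also have "\<dots> = (\<Sum>i<n. of_bool (i < p) * c i) - (\<Sum>i<n. c i * s i)
      - m * ((\<Sum>i<n. of_bool (i < p) * 1) - (\<Sum>i<n. s i))"
    by (simp add: algebra_simps sum_subtractf sum.distrib sum_distrib_left)
  also have "\<dots> = (\<Sum>i<p. c i) - (\<Sum>i<n. c i * s i)"
    unfolding ind s(3) by simp
  finally show ?thesis by simp
qed

lemma doubly_stochastic_majorized:
  fixes c :: "nat \<Rightarrow> real" and w :: "nat \<Rightarrow> nat \<Rightarrow> real"
  assumes anti: "\<And>i j. i \<le> j \<Longrightarrow> j < n \<Longrightarrow> c j \<le> c i"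
    and w: "\<And>l i. 0 \<le> w l i" "\<And>l. l < n \<Longrightarrow> (\<Sum>i<n. w l i) = 1" "\<And>i. i < n \<Longrightarrow> (\<Sum>l<n. w l i) = 1"
    and d: "\<And>l. l < n \<Longrightarrow> d l = (\<Sum>i<n. c i * w l i)"
  shows "majorized n d c"
  unfolding majorized_def
proof (intro conjI allI impI)
  have swap: "(\<Sum>l\<in>S. d l) = (\<Sum>i<n. c i * (\<Sum>l\<in>S. w l i))" if "S \<subseteq> {..<n}" for S
  proof -
    have "(\<Sum>l\<in>S. d l) = (\<Sum>l\<in>S. \<Sum>i<n. c i * w l i)" using d that by (intro sum.cong) auto
    also have "\<dots> = (\<Sum>i<n. \<Sum>l\<in>S. c i * w l i)" by (rule sum.swap)
    finally show ?thesis by (simp add: sum_distrib_left)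
  qed
  show "(\<Sum>i<n. d i) = (\<Sum>i<n. c i)" using swap[of "{..<n}"] w(3) by simp
  fix S assume S: "S \<subseteq> {..<n}"
  show "(\<Sum>i\<in>S. d i) \<le> (\<Sum>i<card S. c i)"
    unfolding swap[OF S]
  proof (rule weighted_sum_le_prefix[OF anti])
    fix i assume "i < n"
    have "(\<Sum>l\<in>S. w l i) \<le> (\<Sum>l<n. w l i)" using S w(1) by (intro sum_mono2) auto
    then show "(\<Sum>l\<in>S. w l i) \<le> 1" using w(3)[OF \<open>i < n\<close>] by simp
    show "0 \<le> (\<Sum>l\<in>S. w l i)" using w(1) by (intro sum_nonneg) auto
  next
    have "(\<Sum>i<n. \<Sum>l\<in>S. w l i) = (\<Sum>l\<in>S. \<Sum>i<n. w l i)" by (rule sum.swap)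
    also have "\<dots> = (\<Sum>l\<in>S. 1)" using w(2) S by (intro sum.cong) auto
    finally show "(\<Sum>i<n. \<Sum>l\<in>S. w l i) = real (card S)" by simp
    show "card S \<le> n" using card_mono[OF finite_lessThan S] by simp
  qed
qed

lemma permuted_majorized:
  fixes c :: "nat \<Rightarrow> real"
  assumes anti: "\<And>i j. i \<le> j \<Longrightarrow> j < n \<Longrightarrow> c j \<le> c i" and p: "p permutes {..<n}"
  shows "majorized n (c \<circ> p) c"
proof (rule doubly_stochastic_majorized[OF anti, where w = "\<lambda>l i. of_bool (i = p l)"])
  have pi: "p l < n" if "l < n" for l using permutes_in_image[OF p, of l] that by simp
  show "(\<Sum>i<n. of_bool (i = p l)) = (1::real)" if "l < n" for l
    using pi[OF that] by (simp add: of_bool_def)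
  show "(c \<circ> p) l = (\<Sum>i<n. c i * of_bool (i = p l))" if "l < n" for l
    using pi[OF that] by (simp add: of_bool_def if_distrib cong: if_cong)
  show "(\<Sum>l<n. of_bool (i = p l)) = (1::real)" if "i < n" for i
  proof -
    have "(\<Sum>l<n. of_bool (i = p l)) = (\<Sum>l<n. of_bool (i = l) :: real)"
      using sum.permute[OF p, of "\<lambda>l. of_bool (i = l) :: real"] by (simp add: comp_def)
    then show ?thesis using that by (simp add: of_bool_def)
  qed
qed auto

text \<open>
  The diagonals of Hermitian matrices with eigenvalues c. They are majorised by c because the squared
  moduli of the entries of a unitary matrix are doubly stochastic (Schur), and they exhaust the
  majorised vectors because they are stable under transfers (Horn).
\<close>
definition udiag_diagonal :: "nat \<Rightarrow> (nat \<Rightarrow> real) \<Rightarrow> (nat \<Rightarrow> real) \<Rightarrow> bool" where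
  "udiag_diagonal n c d \<longleftrightarrow>
     (\<exists>W. unitary_mat n W \<and> (\<forall>l<n. udiag n W (\<lambda>i. complex_of_real (c i)) $$ (l, l) = complex_of_real (d l)))"

context
  fixes n :: nat
begin

lemma udiag_diag_entry:
  assumes W: "W \<in> sq n" and l: "l < n"
  shows "udiag n W (\<lambda>i. complex_of_real (c i)) $$ (l, l) = of_real (\<Sum>i<n. c i * (cmod (W $$ (l, i)))\<^sup>2)"
proof -
  have "udiag n W (\<lambda>i. complex_of_real (c i)) $$ (l, l)
      = (\<Sum>i<n. W $$ (l, i) * of_real (c i) * cnj (W $$ (l, i)))"
    using W l unfolding udiag_def mat_diag_mult_right[OF W]
    by (auto simp: scalar_prod_def atLeast0LessThan intro!: sum.cong)
  also have "\<dots> = (\<Sum>i<n. of_real (c i * (cmod (W $$ (l, i)))\<^sup>2))"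
    by (intro sum.cong) (auto simp: complex_norm_square mult_ac simp del: of_real_power)
  finally show ?thesis by simp
qed

lemma unitary_row_norm:
  assumes "unitary_mat n W" "l < n"
  shows "(\<Sum>i<n. (cmod (W $$ (l, i)))\<^sup>2) = 1"
proof -
  have "udiag n W (\<lambda>i. complex_of_real 1) $$ (l, l) = 1"
    using udiag_one[OF assms(1)] assms(2) by simp
  then have "complex_of_real (\<Sum>i<n. (cmod (W $$ (l, i)))\<^sup>2) = 1"
    using udiag_diag_entry[OF unitaryD(1)[OF assms(1)] assms(2), of "\<lambda>_. 1"] by simp
  then show ?thesis using of_real_eq_1_iff by blast
qed

lemma udiag_diagonal_majorized:
  assumes p: "p permutes {..<n}" and anti: "\<And>i j. i \<le> j \<Longrightarrow> j < n \<Longrightarrow> c (p j) \<le> c (p i)"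
    and d: "udiag_diagonal n c d"
  shows "majorized n d (c \<circ> p)"
proof -
  obtain W where W: "unitary_mat n W"
    and Wd: "\<And>l. l < n \<Longrightarrow> udiag n W (\<lambda>i. complex_of_real (c i)) $$ (l, l) = of_real (d l)"
    using d by (auto simp: udiag_diagonal_def)
  note W' = unitaryD[OF W]
  let ?w = "\<lambda>l i. (cmod (W $$ (l, i)))\<^sup>2"
  have perm: "(\<Sum>i<n. f (p i)) = (\<Sum>i<n. f i)" for f :: "nat \<Rightarrow> real"
    using sum.permute[OF p, of f] by (simp add: comp_def)
  show ?thesis
  proof (rule doubly_stochastic_majorized[where w = "\<lambda>l i. ?w l (p i)"])
    show "(c \<circ> p) j \<le> (c \<circ> p) i" if "i \<le> j" "j < n" for i j using anti[OF that] by simp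
    show "(\<Sum>i<n. ?w l (p i)) = 1" if "l < n" for l
      using perm[of "?w l"] unitary_row_norm[OF W that] by simp
    show "(\<Sum>l<n. ?w l (p i)) = 1" if "i < n" for i
    proof -
      have pi: "p i < n" using permutes_in_image[OF p, of i] that by simp
      have "(\<Sum>l<n. (cmod (W\<^sup>\<dagger> $$ (p i, l)))\<^sup>2) = 1"
        by (rule unitary_row_norm[OF unitary_adj[OF W] pi])
      then show ?thesis using pi W'(1) by simp
    qed
    show "d l = (\<Sum>i<n. (c \<circ> p) i * ?w l (p i))" if "l < n" for l
    proof -
      have "complex_of_real (d l) = of_real (\<Sum>i<n. c i * ?w l i)"
        using Wd[OF that] udiag_diag_entry[OF W'(1) that] by simp
      then have "d l = (\<Sum>i<n. c i * ?w l i)" using of_real_eq_iff by blast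
      then show ?thesis using perm[of "\<lambda>i. c i * ?w l i"] by simp
    qed
  qed auto
qed

text \<open>A rotation whose phase is orthogonal to the off-diagonal entry averages two diagonal
  entries without any cross term.\<close>
lemma udiag_diagonal_transfer_closed: "transfer_closed n (udiag_diagonal n c)"
  unfolding transfer_closed_def
proof (intro conjI allI impI)
  fix f g assume "udiag_diagonal n c f" "\<forall>i<n. f i = g i"
  then show "udiag_diagonal n c g" by (auto simp: udiag_diagonal_def)
next
  fix f i j and t :: real
  assume f: "udiag_diagonal n c f" and ij: "i < n" "j < n" "i \<noteq> j" and t: "0 \<le> t" "t \<le> 1"
  obtain W where W: "unitary_mat n W"
    and Wf: "\<And>l. l < n \<Longrightarrow> udiag n W (\<lambda>i. complex_of_real (c i)) $$ (l, l) = of_real (f l)"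
    using f by (auto simp: udiag_diagonal_def)
  note W' = unitaryD[OF W]
  define M where "M = udiag n W (\<lambda>i. complex_of_real (c i))"
  have M: "M \<in> sq n" "M\<^sup>\<dagger> = M" using W' by (auto simp: M_def udiag_adj)
  define y where "y = M $$ (i, j)"
  have yji: "M $$ (j, i) = cnj y" using M ij unfolding y_def by (metis adj_index carrier_matD)
  define \<phi> where "\<phi> = (if y = 0 then 1 else \<i> * cnj (sgn y))"
  have \<phi>: "cmod \<phi> = 1" by (simp add: \<phi>_def norm_mult norm_sgn)
  have orth: "Re (\<phi> * y) = 0"
  proof -
    have "cnj (sgn y) * y = of_real (cmod y)"
    proof (cases "y = 0")
      case False
      have "cnj (sgn y) * y = y * cnj y / of_real (cmod y)" by (simp add: sgn_eq)
      also have "y * cnj y = of_real (cmod y) * of_real (cmod y)"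
        using complex_norm_square[of y] by (simp add: power2_eq_square)
      finally show ?thesis using False by simp
    qed simp
    then have "\<i> * cnj (sgn y) * y = \<i> * of_real (cmod y)" by (simp add: mult.assoc)
    then show ?thesis by (simp add: \<phi>_def)
  qed
  define a where "a = complex_of_real (sqrt t)"
  define b where "b = complex_of_real (sqrt (1 - t)) * \<phi>"
  have ab2: "(cmod a)\<^sup>2 = t" "(cmod b)\<^sup>2 = 1 - t" using t \<phi> by (auto simp: a_def b_def norm_mult)
  have cross: "cnj a * b * y + a * cnj b * cnj y = 0"
  proof -
    have "cnj a * b * y + a * cnj b * cnj y = of_real (sqrt t * sqrt (1 - t)) * (\<phi> * y + cnj (\<phi> * y))"
      by (simp add: a_def b_def algebra_simps)
    also have "\<phi> * y + cnj (\<phi> * y) = 0" using orth by (simp add: complex_eq_iff)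
    finally show ?thesis by simp
  qed
  obtain G where G: "unitary_mat n G" and Gd: "\<And>M. M \<in> carrier_mat n n \<Longrightarrow>
      (G\<^sup>\<dagger> * M * G) $$ (i, i) = (cmod a)\<^sup>2 * M $$ (i, i) + (cmod b)\<^sup>2 * M $$ (j, j)
         + (cnj a * b * M $$ (i, j) + a * cnj b * M $$ (j, i)) \<and>
      (G\<^sup>\<dagger> * M * G) $$ (j, j) = (cmod b)\<^sup>2 * M $$ (i, i) + (cmod a)\<^sup>2 * M $$ (j, j)
         - (cnj a * b * M $$ (i, j) + a * cnj b * M $$ (j, i)) \<and>
      (\<forall>l<n. l \<noteq> i \<longrightarrow> l \<noteq> j \<longrightarrow> (G\<^sup>\<dagger> * M * G) $$ (l, l) = M $$ (l, l))"
    using plane_rotation[OF ij, of a b] ab2 by auto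
  note G' = unitaryD[OF G]
  have GW: "udiag n (G\<^sup>\<dagger> * W) (\<lambda>i. complex_of_real (c i)) = G\<^sup>\<dagger> * M * G"
    using udiag_frame_mult[of "G\<^sup>\<dagger>" n W] G' W' by (simp add: M_def)
  have Mf: "M $$ (l, l) = of_real (f l)" if "l < n" for l using Wf[OF that] by (simp add: M_def)
  have "udiag n (G\<^sup>\<dagger> * W) (\<lambda>i. complex_of_real (c i)) $$ (l, l) = of_real (transfer i j t f l)" if "l < n" for l
    unfolding GW using Gd[OF M(1)] ij that cross
    by (auto simp: transfer_def ab2 yji Mf y_def[symmetric] simp del: index_mult_mat(1) of_real_power)
  moreover have "unitary_mat n (G\<^sup>\<dagger> * W)" by (intro unitary_mult unitary_adj G W)
  ultimately show "udiag_diagonal n c (transfer i j t f)" unfolding udiag_diagonal_def by blast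
qed

end

section \<open>Commuting normal matrices have polyhedral C-numerical ranges\<close>

text \<open>
  In a common frame for the A_j the range is the image under the linear map q of the diagonals of the
  matrices unitarily similar to C, that is, of the vectors majorised by the eigenvalues of C. That
  image is a convex set containing the images of all permutations of the eigenvalues, and
  conversely the property that all permutations of a vector are mapped into the hull K of these
  images is stable under transfers.
\<close>
theorem commuting_normal_imp_polytope:
  fixes A :: "'m::finite \<Rightarrow> complex mat"
  assumes A: "commuting_normal n A" and C: "C \<in> carrier_mat n n" "hermitian_mat C"
  shows "polytope (joint_C_range n C A)"
proof -
  obtain U a where U: "unitary_mat n U" and Aa: "\<And>j. A j = udiag n U (a j)"
    using simultaneous_diagonalization[OF A] by blast
  obtain V c where V: "unitary_mat n V" and Cc: "C = udiag n V (\<lambda>i. complex_of_real (c i))"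
    using hermitian_diagonalization[OF C] by blast
  note U' = unitaryD[OF U] and V' = unitaryD[OF V]
  obtain \<sigma> where \<sigma>: "\<sigma> permutes {..<n}" and anti: "\<And>i j. i \<le> j \<Longrightarrow> j < n \<Longrightarrow> c (\<sigma> j) \<le> c (\<sigma> i)"
    using antimono_rearrangement[of n c] by blast
  define q :: "(nat \<Rightarrow> real) \<Rightarrow> complex ^ 'm"
    where "q d = (\<chi> j. \<Sum>l<n. a j l * complex_of_real (d l))" for d
  define K where "K = convex hull ((\<lambda>\<pi>. q (c \<circ> \<sigma> \<circ> \<pi>)) ` {\<pi>. \<pi> permutes {..<n}})"
  have q_cong: "q f = q g" if "\<And>l. l < n \<Longrightarrow> f l = g l" for f g
    unfolding q_def using that by (auto simp: Finite_Cartesian_Product.vec_eq_iff intro!: sum.cong)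
  have q_comb: "q (\<lambda>l. u * f l + v * g l) = u *\<^sub>R q f + v *\<^sub>R q g" for u v f g
    unfolding q_def by (simp add: Finite_Cartesian_Product.vec_eq_iff algebra_simps sum.distrib sum_distrib_left
        scaleR_conv_of_real[where 'a = complex])
  have range: "joint_C_range n C A = {q d | d. udiag_diagonal n c d}"
  proof -
    have point: "mat_trace (C * W\<^sup>\<dagger> * A j * W)
        = (\<Sum>l<n. a j l * udiag n (U\<^sup>\<dagger> * W * V) (\<lambda>i. complex_of_real (c i)) $$ (l, l))"
      if W: "unitary_mat n W" for W j
    proof -
      note W' = unitaryD[OF W]
      have Ac: "A j \<in> carrier_mat n n" using Aa U' by simp
      have "mat_trace (C * W\<^sup>\<dagger> * A j * W) = mat_trace ((C * W\<^sup>\<dagger>) * (A j * W))"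
        using C W' Ac by (simp add: sq_assoc[of _ n])
      also have "\<dots> = mat_trace (A j * (W * C * W\<^sup>\<dagger>))"
        using C W' Ac trace_comm[of "C * W\<^sup>\<dagger>" n n "A j * W"] by (simp add: sq_assoc[of _ n])
      also have "\<dots> = (\<Sum>l<n. a j l * (U\<^sup>\<dagger> * (W * C * W\<^sup>\<dagger>) * U) $$ (l, l))"
        unfolding Aa using C W' by (intro trace_udiag_mult[OF U]) auto
      also have "U\<^sup>\<dagger> * (W * C * W\<^sup>\<dagger>) * U = (U\<^sup>\<dagger> * W) * C * (U\<^sup>\<dagger> * W)\<^sup>\<dagger>"
        using C U' W' by (simp add: sq_assoc[of _ n] sq_adj_mult[of _ n])
      also have "\<dots> = udiag n (U\<^sup>\<dagger> * W * V) (\<lambda>i. complex_of_real (c i))"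
        unfolding Cc using U' W' V' by (intro udiag_frame_mult) auto
      finally show ?thesis .
    qed
    have diag_real: "udiag n W' (\<lambda>i. complex_of_real (c i)) $$ (l, l)
        = of_real (Re (udiag n W' (\<lambda>i. complex_of_real (c i)) $$ (l, l)))" if "unitary_mat n W'" "l < n" for W' l
      using udiag_diag_entry[OF unitaryD(1)[OF that(1)] that(2), of c] by simp
    show ?thesis
    proof (intro subset_antisym subsetI)
      fix x assume "x \<in> joint_C_range n C A"
      then obtain W where W: "unitary_mat n W" and x: "x = (\<chi> j. mat_trace (C * W\<^sup>\<dagger> * A j * W))"
        by (auto simp: joint_C_range_def)
      let ?W = "U\<^sup>\<dagger> * W * V"
      have W2: "unitary_mat n ?W" by (intro unitary_mult unitary_adj U V W)
      define d where "d l = Re (udiag n ?W (\<lambda>i. complex_of_real (c i)) $$ (l, l))" for l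
      have d: "udiag n ?W (\<lambda>i. complex_of_real (c i)) $$ (l, l) = of_real (d l)" if "l < n" for l
        using diag_real[OF W2 that] by (simp add: d_def)
      have "x = q d"
        unfolding x q_def point[OF W] using d
        by (auto simp: Finite_Cartesian_Product.vec_eq_iff intro!: sum.cong)
      then show "x \<in> {q d | d. udiag_diagonal n c d}" using W2 d by (auto simp: udiag_diagonal_def)
    next
      fix x assume "x \<in> {q d | d. udiag_diagonal n c d}"
      then obtain d W where x: "x = q d" and W: "unitary_mat n W"
        and d: "\<And>l. l < n \<Longrightarrow> udiag n W (\<lambda>i. complex_of_real (c i)) $$ (l, l) = of_real (d l)"
        by (auto simp: udiag_diagonal_def)
      note W' = unitaryD[OF W]
      define Z where "Z = U * W * V\<^sup>\<dagger>"
      have Z: "unitary_mat n Z" unfolding Z_def by (intro unitary_mult unitary_adj U V W)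
      have ZW: "U\<^sup>\<dagger> * Z * V = W"
        using U' V' W' by (simp add: Z_def sq_assoc[of _ n] unitary_cancel[OF U] sq_one[of _ n])
      have "x = (\<chi> j. mat_trace (C * Z\<^sup>\<dagger> * A j * Z))"
        unfolding x q_def point[OF Z] ZW using d
        by (auto simp: Finite_Cartesian_Product.vec_eq_iff intro!: sum.cong)
      then show "x \<in> joint_C_range n C A" using Z by (auto simp: joint_C_range_def)
    qed
  qed
  have "udiag_diagonal n c (c \<circ> \<sigma>)"
  proof (rule transfer_closed_permute[OF udiag_diagonal_transfer_closed \<sigma>])
    have "udiag n (1\<^sub>m n) (\<lambda>i. complex_of_real (c i)) = mat_diag n (\<lambda>i. complex_of_real (c i))"
      unfolding udiag_def by (simp add: left_mult_one_mat[of _ n n] right_mult_one_mat[of _ n n])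
    then show "udiag_diagonal n c c"
      unfolding udiag_diagonal_def using unitary_one[of n] by (intro exI[of _ "1\<^sub>m n"]) (simp add: mat_diag_def)
  qed
  then have horn: "udiag_diagonal n c d" if "majorized n d (c \<circ> \<sigma>)" for d
    using transfer_closed_majorized[OF udiag_diagonal_transfer_closed _ that] by blast
  have schur: "majorized n d (c \<circ> \<sigma>)" if "udiag_diagonal n c d" for d
    by (rule udiag_diagonal_majorized[OF \<sigma> anti that])
  \<comment> \<open>all permutations, because a transfer mixes f with a transposed copy of itself\<close>
  define Q where "Q f \<longleftrightarrow> (\<forall>\<tau>. \<tau> permutes {..<n} \<longrightarrow> q (f \<circ> \<tau>) \<in> K)" for f
  have Q: "transfer_closed n Q"
    unfolding transfer_closed_def
  proof (intro conjI allI impI)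
    fix f g assume f: "Q f" and fg: "\<forall>i<n. f i = g i"
    have "q (g \<circ> \<tau>) = q (f \<circ> \<tau>)" if \<tau>: "\<tau> permutes {..<n}" for \<tau>
    proof (rule q_cong)
      fix l assume "l < n"
      then have "\<tau> l < n" using permutes_in_image[OF \<tau>, of l] by simp
      then show "(g \<circ> \<tau>) l = (f \<circ> \<tau>) l" using fg by simp
    qed
    then show "Q g" using f by (auto simp: Q_def)
  next
    fix f i j and t :: real
    assume f: "Q f" and ij: "i < n" "j < n" "i \<noteq> j" and t: "0 \<le> t" "t \<le> 1"
    show "Q (transfer i j t f)"
      unfolding Q_def
    proof (intro allI impI)
      fix \<tau> assume \<tau>: "\<tau> permutes {..<n}"
      let ?s = "Transposition.transpose i j \<circ> \<tau>"
      have s: "?s permutes {..<n}" using ij by (intro permutes_compose[OF \<tau>] permutes_swap_id) auto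
      have "transfer i j t f \<circ> \<tau> = (\<lambda>l. t * (f \<circ> \<tau>) l + (1 - t) * (f \<circ> ?s) l)"
        using ij(3) by (auto simp: transfer_def fun_eq_iff Transposition.transpose_def algebra_simps)
      then have "q (transfer i j t f \<circ> \<tau>) = t *\<^sub>R q (f \<circ> \<tau>) + (1 - t) *\<^sub>R q (f \<circ> ?s)"
        by (simp only: q_comb)
      moreover have "q (f \<circ> \<tau>) \<in> K" "q (f \<circ> ?s) \<in> K" using f \<tau> s by (auto simp: Q_def)
      moreover have "convex K" unfolding K_def by (rule convex_convex_hull)
      ultimately show "q (transfer i j t f \<circ> \<tau>) \<in> K" using t by (auto intro: convexD)
    qed
  qed
  have "Q (c \<circ> \<sigma>)"
    unfolding Q_def K_def by (intro allI impI hull_inc) auto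
  then have "q d \<in> K" if "majorized n d (c \<circ> \<sigma>)" for d
    using transfer_closed_majorized[OF Q _ that] permutes_id[of "{..<n}"] unfolding Q_def by fastforce
  moreover have "K \<subseteq> {q d | d. majorized n d (c \<circ> \<sigma>)}"
    unfolding K_def
  proof (rule hull_minimal)
    show "(\<lambda>\<pi>. q (c \<circ> \<sigma> \<circ> \<pi>)) ` {\<pi>. \<pi> permutes {..<n}} \<subseteq> {q d | d. majorized n d (c \<circ> \<sigma>)}"
      using permuted_majorized[of n "c \<circ> \<sigma>"] anti by fastforce
    show "convex {q d | d. majorized n d (c \<circ> \<sigma>)}"
    proof (rule convexI)
      fix x y and u v :: real
      assume uv: "0 \<le> u" "0 \<le> v" "u + v = 1"
      assume "x \<in> {q d | d. majorized n d (c \<circ> \<sigma>)}" "y \<in> {q d | d. majorized n d (c \<circ> \<sigma>)}"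
      then obtain d e where d: "x = q d" "majorized n d (c \<circ> \<sigma>)" and e: "y = q e" "majorized n e (c \<circ> \<sigma>)"
        by blast
      have split: "(\<Sum>i\<in>S. u * d i + v * e i) = u * (\<Sum>i\<in>S. d i) + v * (\<Sum>i\<in>S. e i)" for S
        by (simp add: sum.distrib sum_distrib_left)
      have "majorized n (\<lambda>l. u * d l + v * e l) (c \<circ> \<sigma>)"
        unfolding majorized_def split
      proof (intro conjI allI impI)
        show "u * sum d {..<n} + v * sum e {..<n} = sum (c \<circ> \<sigma>) {..<n}"
          using d(2) e(2) uv by (simp add: majorized_def flip: distrib_right)
        fix S assume "S \<subseteq> {..<n}"
        then have "sum d S \<le> sum (c \<circ> \<sigma>) {..<card S}" "sum e S \<le> sum (c \<circ> \<sigma>) {..<card S}"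
          using d(2) e(2) unfolding majorized_def by blast+
        then show "u * sum d S + v * sum e S \<le> sum (c \<circ> \<sigma>) {..<card S}"
          using uv by (intro convex_bound_le)
      qed
      then show "u *\<^sub>R x + v *\<^sub>R y \<in> {q d | d. majorized n d (c \<circ> \<sigma>)}"
        unfolding d(1) e(1) q_comb[symmetric] by blast
    qed
  qed
  ultimately have "joint_C_range n C A = K"
    unfolding range using horn schur by blast
  then show ?thesis
    unfolding K_def polytope_def using finite_permutations[of "{..<n}"] by blast
qed

section \<open>The equivalence\<close>

lemma linear_factors_mset_eq:
  fixes xs ys :: "complex list"
  assumes "(\<Prod>a\<leftarrow>xs. [:- a, 1:]) = (\<Prod>a\<leftarrow>ys. [:- a, 1:])"
  shows "mset xs = mset ys"
proof -
  have "proots (\<Prod>a\<leftarrow>xs. [:- a, 1:]) = mset xs" for xs :: "complex list"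
  proof (induction xs)
    case (Cons a xs)
    have "(\<Prod>a\<leftarrow>xs. [:- a, 1:]) \<noteq> 0" by (auto simp: prod_list_zero_iff)
    then show ?case using Cons by (simp add: proots_mult del: mult_pCons_left)
  qed simp
  then show ?thesis using assms by metis
qed

lemma char_poly_mat_diag:
  fixes d :: "nat \<Rightarrow> complex"
  shows "char_poly (mat_diag n d) = (\<Prod>a\<leftarrow>map d [0..<n]. [:- a, 1:])"
proof -
  have "char_poly (mat_diag n d) = (\<Prod>a\<leftarrow>diag_mat (mat_diag n d). [:- a, 1:])"
    by (rule char_poly_upper_triangular[of _ n]) (auto simp: upper_triangular_def mat_diag_def)
  also have "diag_mat (mat_diag n d) = map d [0..<n]"
    by (auto simp: diag_mat_def mat_diag_def intro!: map_cong)
  finally show ?thesis .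
qed

text \<open>
  The characteristic polynomial determines the multiset of the d i, so the gap after the k-th entry
  of the ordered list makes cs ! k a threshold that exactly k of them exceed.
\<close>
lemma count_above_of_ordered_eigenvalues:
  assumes C: "C \<in> carrier_mat n n" and V: "unitary_mat n V"
    and Cd: "C = udiag n V (\<lambda>i. complex_of_real (d i))"
    and cs: "ordered_eigenvalues C cs" and k: "1 \<le> k" "k < n" "cs ! k < cs ! (k - 1)"
  shows "card {i. i < n \<and> d i > cs ! k} = k"
proof -
  note V' = unitaryD[OF V]
  have "similar_mat C (mat_diag n (\<lambda>i. complex_of_real (d i)))"
    using V' by (intro similar_matI[of _ _ V "V\<^sup>\<dagger>" n]) (auto simp: Cd udiag_def)
  then have "char_poly C = char_poly (mat_diag n (\<lambda>i. complex_of_real (d i)))" by (rule char_poly_similar)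
  also have "\<dots> = (\<Prod>a\<leftarrow>map (\<lambda>i. complex_of_real (d i)) [0..<n]. [:- a, 1:])"
    by (rule char_poly_mat_diag)
  finally have "(\<Prod>a\<leftarrow>map complex_of_real cs. [:- a, 1:]) = (\<Prod>a\<leftarrow>map complex_of_real (map d [0..<n]). [:- a, 1:])"
    using cs by (simp add: ordered_eigenvalues_def comp_def)
  then have "mset (map complex_of_real cs) = mset (map complex_of_real (map d [0..<n]))"
    by (rule linear_factors_mset_eq)
  then have "image_mset complex_of_real (mset cs) = image_mset complex_of_real (mset (map d [0..<n]))"
    by (simp only: mset_map)
  then have "image_mset Re (image_mset complex_of_real (mset cs))
      = image_mset Re (image_mset complex_of_real (mset (map d [0..<n])))" by (rule arg_cong)
  then have mset: "mset cs = mset (map d [0..<n])"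
    by (simp only: multiset.map_comp comp_def Re_complex_of_real multiset.map_ident)
  have len: "length cs = n" using mset_eq_length[OF mset] by simp
  have sorted: "cs ! j \<le> cs ! i" if "i \<le> j" "j < n" for i j
    using cs that len by (cases "i = j") (auto simp: ordered_eigenvalues_def sorted_wrt_iff_nth_less)
  let ?P = "\<lambda>x. x > cs ! k"
  have "card {i. i < n \<and> d i > cs ! k} = length (filter ?P (map d [0..<n]))"
    by (subst length_filter_conv_card) (auto intro: arg_cong[where f = card])
  also have "\<dots> = length (filter ?P cs)" using mset by (metis mset_filter size_mset)
  also have "\<dots> = card {i. i < n \<and> cs ! i > cs ! k}" by (simp add: length_filter_conv_card len)
  also have "{i. i < n \<and> cs ! i > cs ! k} = {..<k}"
  proof (rule antisym; rule subsetI)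
    fix i assume "i \<in> {i. i < n \<and> cs ! i > cs ! k}"
    then have "\<not> k \<le> i" using sorted[of k i] by force
    then show "i \<in> {..<k}" by simp
  next
    fix i assume "i \<in> {..<k}"
    then have "cs ! (k - 1) \<le> cs ! i" using sorted[of i "k - 1"] k by simp
    then show "i \<in> {i. i < n \<and> cs ! i > cs ! k}" using k \<open>i \<in> {..<k}\<close> by simp
  qed
  finally show ?thesis by simp
qed

lemma k_range_matrix:
  assumes "k \<le> n"
  shows "diag_block_mat [1\<^sub>m k, 0\<^sub>m (n - k) (n - k)]
    = udiag n (1\<^sub>m n) (\<lambda>i. complex_of_real (if i < k then 1 else 0))"
proof -
  have "diag_block_mat [1\<^sub>m k, 0\<^sub>m (n - k) (n - k)]
      = mat_diag n (\<lambda>i. complex_of_real (if i < k then 1 else 0))"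
    using assms by (intro eq_matI) (auto simp: mat_diag_def Let_def)
  then show ?thesis
    unfolding udiag_def by (simp add: left_mult_one_mat[of _ n n] right_mult_one_mat[of _ n n])
qed

lemma k_range_matrix_carrier:
  assumes "k \<le> n"
  shows "(diag_block_mat [1\<^sub>m k, 0\<^sub>m (n - k) (n - k)] :: complex mat) \<in> carrier_mat n n"
    "hermitian_mat (diag_block_mat [1\<^sub>m k, 0\<^sub>m (n - k) (n - k)])"
  unfolding k_range_matrix[OF assms] hermitian_mat_def
  by (simp_all add: udiag_carrier[of _ n] udiag_adj[of _ n])

lemma k_range_matrix_eigenvalues:
  assumes "k \<le> n"
  shows "ordered_eigenvalues (diag_block_mat [1\<^sub>m k, 0\<^sub>m (n - k) (n - k)])
    (map (\<lambda>i. if i < k then 1 else 0) [0..<n])"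
  unfolding ordered_eigenvalues_def
proof
  have "diag_block_mat [1\<^sub>m k, 0\<^sub>m (n - k) (n - k)]
      = mat_diag n (\<lambda>i. complex_of_real (if i < k then 1 else 0))"
    unfolding k_range_matrix[OF assms] udiag_def
    by (simp add: left_mult_one_mat[of _ n n] right_mult_one_mat[of _ n n])
  then show "char_poly (diag_block_mat [1\<^sub>m k, 0\<^sub>m (n - k) (n - k)])
      = (\<Prod>c\<leftarrow>map (\<lambda>i. if i < k then 1 else 0) [0..<n]. [:- complex_of_real c, 1:])"
    by (simp only: char_poly_mat_diag) (simp add: comp_def)
qed (auto simp: sorted_wrt_iff_nth_less)

theorem theorem3p3:
  fixes n :: nat and A :: "'m::finite \<Rightarrow> complex mat"
  assumes "n \<ge> 2"
    and "\<And>j. A j \<in> carrier_mat n n"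
  shows
    "(((\<forall>i j. A i * A j = A j * A i) \<and> (\<forall>j. normal_mat (A j)))
        \<longleftrightarrow> (\<exists>k::nat. 1 \<le> k \<and> k \<le> n - 1 \<and> \<bar>real n / 2 - real k\<bar> \<le> 1
              \<and> polytope (joint_k_range n k A)))
   \<and> (((\<forall>i j. A i * A j = A j * A i) \<and> (\<forall>j. normal_mat (A j)))
        \<longleftrightarrow> (\<exists>C\<in>carrier_mat n n. \<exists>cs. hermitian_mat C \<and> ordered_eigenvalues C cs
              \<and> (\<exists>k\<in>{1..n - 1}. \<bar>real n / 2 - real k\<bar> \<le> 1 \<and> cs ! (k - 1) > cs ! k)
              \<and> polytope (joint_C_range n C A)))
   \<and> (((\<forall>i j. A i * A j = A j * A i) \<and> (\<forall>j. normal_mat (A j)))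
        \<longleftrightarrow> (\<forall>C\<in>carrier_mat n n. hermitian_mat C \<longrightarrow> polytope (joint_C_range n C A)))"
proof -
  let ?a = "(\<forall>i j. A i * A j = A j * A i) \<and> (\<forall>j. normal_mat (A j))"
  let ?E = "\<lambda>k. diag_block_mat [1\<^sub>m k, 0\<^sub>m (n - k) (n - k)] :: complex mat"
  let ?b = "\<exists>k::nat. 1 \<le> k \<and> k \<le> n - 1 \<and> \<bar>real n / 2 - real k\<bar> \<le> 1
              \<and> polytope (joint_k_range n k A)"
  let ?c = "\<exists>C\<in>carrier_mat n n. \<exists>cs. hermitian_mat C \<and> ordered_eigenvalues C cs
              \<and> (\<exists>k\<in>{1..n - 1}. \<bar>real n / 2 - real k\<bar> \<le> 1 \<and> cs ! (k - 1) > cs ! k)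
              \<and> polytope (joint_C_range n C A)"
  let ?d = "\<forall>C\<in>carrier_mat n n. hermitian_mat C \<longrightarrow> polytope (joint_C_range n C A)"
  have a_iff: "?a \<longleftrightarrow> commuting_normal n A"
    using assms(2) by (auto simp: commuting_normal_def)
  have central: "2 * k \<le> n + 2 \<and> n \<le> 2 * k + 2" if "\<bar>real n / 2 - real k\<bar> \<le> 1" for k
  proof -
    have "2 * real k \<le> real n + 2" "real n \<le> 2 * real k + 2" using that by linarith+
    then show ?thesis by linarith
  qed
  have ad: ?d if ?a
    using that commuting_normal_imp_polytope unfolding a_iff by blast
  have ca: ?a if ?c
  proof -
    obtain C cs k where C: "C \<in> carrier_mat n n" "hermitian_mat C" and cs: "ordered_eigenvalues C cs"
      and k: "k \<in> {1..n - 1}" "\<bar>real n / 2 - real k\<bar> \<le> 1" "cs ! (k - 1) > cs ! k"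
      and poly: "polytope (joint_C_range n C A)"
      using \<open>?c\<close> by blast
    have k': "1 \<le> k" "k < n" using k(1) assms(1) by auto
    obtain V d where V: "unitary_mat n V" and Cd: "C = udiag n V (\<lambda>i. complex_of_real (d i))"
      using hermitian_diagonalization[OF C] by blast
    show ?thesis
      unfolding a_iff
      using polytope_imp_commuting_normal[OF assms(2) V Cd
          count_above_of_ordered_eigenvalues[OF C(1) V Cd cs k' k(3)] k' _ _ poly] central[OF k(2)]
      by blast
  qed
  have bc: ?c if ?b
  proof -
    obtain k where k: "1 \<le> k" "k \<le> n - 1" "\<bar>real n / 2 - real k\<bar> \<le> 1" "polytope (joint_k_range n k A)"
      using \<open>?b\<close> by blast
    have kn: "k \<le> n" "k < n" using k assms(1) by auto
    let ?cs = "map (\<lambda>i. if i < k then 1 else 0 :: real) [0..<n]"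
    have "?cs ! k < ?cs ! (k - 1)" using k(1) kn by simp
    then have "\<exists>k\<in>{1..n - 1}. \<bar>real n / 2 - real k\<bar> \<le> 1 \<and> ?cs ! k < ?cs ! (k - 1)"
      using k by (intro bexI[of _ k]) auto
    then show ?thesis
      using k_range_matrix_carrier[OF kn(1)] k_range_matrix_eigenvalues[OF kn(1)] k(4)
      unfolding joint_k_range_def by blast
  qed
  have db: ?b if ?d
  proof (intro exI conjI)
    show "1 \<le> n div 2" "n div 2 \<le> n - 1" using assms(1) by linarith+
    have "n = 2 * (n div 2) \<or> n = 2 * (n div 2) + 1" by presburger
    then have "real n = 2 * real (n div 2) \<or> real n = 2 * real (n div 2) + 1" by linarith
    then show "\<bar>real n / 2 - real (n div 2)\<bar> \<le> 1" by linarith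
    show "polytope (joint_k_range n (n div 2) A)"
      unfolding joint_k_range_def using \<open>?d\<close> k_range_matrix_carrier[of "n div 2" n] by auto
  qed
  from ad ca bc db show ?thesis by blast
qed

end
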